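(* Let $\mathcal{H}$ be an infinite dimensional separable Hilbert space and let $T_0=N_0+V$ be a contraction on $\mathcal{H}$, where $N_0$ is a bounded normal operator ($N_0^*N_0=N_0N_0^*$) and $V\in\mathcal{B}_2(\mathcal{H})$. Let $A=A^*\in\mathcal{B}_2(\mathcal{H})$. Put $T_s=e^{isA}T_0$, $s\in[0,1]$, and $T=T_1$. Then for every complex polynomial $p$, $$p(T)-p(T_0)-\frac{d}{ds}\Big|_{s=0}p(T_s)\in\mathcal{B}_1(\mathcal{H}),$$ and there exists a function $\tilde\eta\in L^1(\mathbb{T})$, unique up to an analytic term (i.e. unique modulo $H^1(\mathbb{T})$), such that for every complex polynomial $p$, $$\operatorname{Tr}\Big\{p(T)-p(T_0)-\frac{d}{ds}\Big|_{s=0}p(T_s)\Big\}=\int_0^{2\pi}\frac{d^2}{dt^2}\big(p(e^{it})\big)\,\tilde\eta(t)\,dt.\qquad( * )$$ Moreover, for every given $\epsilon>0$, the function $\tilde\eta$ satisfying $( * )$ can be chosen so that $$\|\tilde\eta\|_{L^1(\mathbb{T})}\le\Big(\frac12+\epsilon\Big)\|A\|_2^2.$$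
   Context: $\mathcal{B}_1(\mathcal{H})$ and $\mathcal{B}_2(\mathcal{H})$ are the trace class and Hilbert-Schmidt operators on $\mathcal{H}$; $\|\cdot\|_2$ is the Hilbert-Schmidt norm. A contraction is a bounded operator of norm at most $1$. The derivative in $s$ is taken in operator norm. Functions on $[0,2\pi]$ are identified (a.e.) with functions on the unit circle $\mathbb{T}$ via $t\mapsto e^{it}$; $\|f\|_{L^1(\mathbb{T})}=\int_0^{2\pi}|f(e^{it})|\,dt$ (arc length). $H^1(\mathbb{T})=\{f\in L^1(\mathbb{T}):\hat f(n)=0\text{ for all }n<0\}$. *)

theory Defs
  imports "HOL-Analysis.Analysis" "HOL-Computational_Algebra.Polynomial"
begin

section \<open>Complex Hilbert spaces\<close>

class scaleC =
  fixes scaleC :: "complex \<Rightarrow> 'a \<Rightarrow> 'a"  (infixr \<open>*\<^sub>C\<close> 75)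

text \<open>
  The inner product is linear in the first argument and conjugate linear in the second.
  The underlying real structure is that of the library, so that norm, topology, convergence
  and the operator norm on the type of bounded (real-)linear maps are the usual ones.
\<close>

class chilbert_space = real_inner + complete_space + scaleC +
  fixes cinner :: "'a \<Rightarrow> 'a \<Rightarrow> complex"
  assumes scaleC_add_right: "c *\<^sub>C (x + y) = c *\<^sub>C x + c *\<^sub>C y"
    and scaleC_add_left: "(c + d) *\<^sub>C x = c *\<^sub>C x + d *\<^sub>C x"
    and scaleC_scaleC: "c *\<^sub>C (d *\<^sub>C x) = (c * d) *\<^sub>C x"
    and scaleC_one: "1 *\<^sub>C x = x"
    and scaleR_scaleC: "r *\<^sub>R x = complex_of_real r *\<^sub>C x"
    and cinner_commute: "cinner x y = cnj (cinner y x)"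
    and cinner_add_left: "cinner (x + y) z = cinner x z + cinner y z"
    and cinner_scaleC_left: "cinner (c *\<^sub>C x) y = c * cinner x y"
    and inner_eq_Re_cinner: "inner x y = Re (cinner x y)"

instantiation complex :: chilbert_space
begin

definition scaleC_complex :: "complex \<Rightarrow> complex \<Rightarrow> complex"
  where "scaleC_complex c z = c * z"

definition cinner_complex :: "complex \<Rightarrow> complex \<Rightarrow> complex"
  where "cinner_complex z w = z * cnj w"

instance
  by standard
    (auto simp: scaleC_complex_def cinner_complex_def algebra_simps inner_complex_def
      scaleR_conv_of_real)

end

interpretation cvec: vector_space "scaleC :: complex \<Rightarrow> 'a \<Rightarrow> 'a::chilbert_space"
  by standard (simp_all add: scaleC_add_right scaleC_add_left scaleC_scaleC scaleC_one)

lemma norm_scaleC: "norm (c *\<^sub>C x) = cmod c * norm (x::'a::chilbert_space)"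
proof -
  have "cinner (c *\<^sub>C x) (c *\<^sub>C x) = c * cnj c * cinner x x"
    using cinner_commute[of x "c *\<^sub>C x"] cinner_commute[of x x]
    by (simp add: cinner_scaleC_left)
  also have "c * cnj c = complex_of_real ((cmod c)\<^sup>2)"
    by (simp only: complex_norm_square)
  finally have "inner (c *\<^sub>C x) (c *\<^sub>C x) = (cmod c)\<^sup>2 * inner x x"
    by (simp add: inner_eq_Re_cinner)
  then have "(norm (c *\<^sub>C x))\<^sup>2 = (cmod c * norm x)\<^sup>2"
    by (simp add: power2_norm_eq_inner power_mult_distrib)
  then show ?thesis by simp
qed

lemma bounded_linear_scaleC: "bounded_linear ((*\<^sub>C) c :: 'a \<Rightarrow> 'a::chilbert_space)"
  by (rule bounded_linear_intro[of _ "cmod c"])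
    (simp_all add: scaleC_add_right scaleR_scaleC scaleC_scaleC norm_scaleC mult.commute)

instantiation blinfun :: (real_normed_vector, chilbert_space) scaleC
begin

lift_definition scaleC_blinfun ::
    "complex \<Rightarrow> ('a \<Rightarrow>\<^sub>L 'b) \<Rightarrow> 'a \<Rightarrow>\<^sub>L 'b"
  is "\<lambda>c T x. c *\<^sub>C T x"
  by (rule bounded_linear_compose[OF bounded_linear_scaleC])

instance ..

end

definition is_onb :: "'a::chilbert_space set \<Rightarrow> bool" where
  "is_onb E \<longleftrightarrow>
     (\<forall>e\<in>E. \<forall>f\<in>E. cinner e f = (if e = f then 1 else 0)) \<and> closure (cvec.span E) = UNIV"

definition some_onb :: "'a::chilbert_space set" where
  "some_onb = (SOME E. is_onb E)"


section \<open>Bounded operators\<close>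

text \<open>
  Operators are elements of \<^typ>\<open>'a \<Rightarrow>\<^sub>L 'a\<close> that are moreover complex linear, which is
  recorded by the following predicate.
\<close>

definition clinear_op :: "('a::chilbert_space \<Rightarrow>\<^sub>L 'a) \<Rightarrow> bool" where
  "clinear_op T \<longleftrightarrow> (\<forall>c x. T (c *\<^sub>C x) = c *\<^sub>C T x)"

definition adj :: "('a::chilbert_space \<Rightarrow>\<^sub>L 'a) \<Rightarrow> 'a \<Rightarrow>\<^sub>L 'a" where
  "adj T = (THE S :: 'a \<Rightarrow>\<^sub>L 'a. \<forall>x y. cinner (T x) y = cinner x (S y))"

definition normal_op :: "('a::chilbert_space \<Rightarrow>\<^sub>L 'a) \<Rightarrow> bool" where
  "normal_op N \<longleftrightarrow> clinear_op N \<and> adj N o\<^sub>L N = N o\<^sub>L adj N"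

definition selfadjoint_op :: "('a::chilbert_space \<Rightarrow>\<^sub>L 'a) \<Rightarrow> bool" where
  "selfadjoint_op A \<longleftrightarrow> clinear_op A \<and> adj A = A"

definition positive_op :: "('a::chilbert_space \<Rightarrow>\<^sub>L 'a) \<Rightarrow> bool" where
  "positive_op P \<longleftrightarrow> clinear_op P \<and> (\<forall>x. cinner (P x) x \<in> \<real>\<^sub>\<ge>\<^sub>0)"

definition contraction_op :: "('a::chilbert_space \<Rightarrow>\<^sub>L 'a) \<Rightarrow> bool" where
  "contraction_op T \<longleftrightarrow> clinear_op T \<and> norm T \<le> 1"

text \<open>The absolute value \<open>(T\<^sup>* T)\<^sup>1\<^sup>/\<^sup>2\<close>.\<close>

definition abs_op :: "('a::chilbert_space \<Rightarrow>\<^sub>L 'a) \<Rightarrow> 'a \<Rightarrow>\<^sub>L 'a" where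
  "abs_op T = (THE P. positive_op P \<and> P o\<^sub>L P = adj T o\<^sub>L T)"

definition pow_op :: "('a::chilbert_space \<Rightarrow>\<^sub>L 'a) \<Rightarrow> nat \<Rightarrow> 'a \<Rightarrow>\<^sub>L 'a" where
  "pow_op T n = ((\<lambda>S. T o\<^sub>L S) ^^ n) id_blinfun"

text \<open>The exponential series converges in operator norm.\<close>

definition exp_op :: "('a::chilbert_space \<Rightarrow>\<^sub>L 'a) \<Rightarrow> 'a \<Rightarrow>\<^sub>L 'a" where
  "exp_op T = (\<Sum>n. pow_op T n /\<^sub>R fact n)"

definition poly_op :: "complex poly \<Rightarrow> ('a::chilbert_space \<Rightarrow>\<^sub>L 'a) \<Rightarrow> 'a \<Rightarrow>\<^sub>L 'a" where
  "poly_op p T = (\<Sum>k\<le>degree p. coeff p k *\<^sub>C pow_op T k)"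


section \<open>Hilbert-Schmidt and trace class operators\<close>

text \<open>
  Summability of the series below, and the values of its sum and of the trace, do not depend
  on the orthonormal basis.
\<close>

definition hilbert_schmidt :: "('a::chilbert_space \<Rightarrow>\<^sub>L 'a) \<Rightarrow> bool" where
  "hilbert_schmidt T \<longleftrightarrow>
     clinear_op T \<and> (\<exists>E. is_onb E \<and> (\<lambda>e. (norm (T e))\<^sup>2) summable_on E)"

definition hs_norm :: "('a::chilbert_space \<Rightarrow>\<^sub>L 'a) \<Rightarrow> real" where
  "hs_norm T = sqrt (\<Sum>\<^sub>\<infinity>e\<in>some_onb. (norm (T e))\<^sup>2)"

definition trace_class :: "('a::chilbert_space \<Rightarrow>\<^sub>L 'a) \<Rightarrow> bool" where
  "trace_class T \<longleftrightarrow>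
     clinear_op T \<and> (\<exists>E. is_onb E \<and> (\<lambda>e. cinner (abs_op T e) e) summable_on E)"

definition trace_op :: "('a::chilbert_space \<Rightarrow>\<^sub>L 'a) \<Rightarrow> complex" where
  "trace_op T = (\<Sum>\<^sub>\<infinity>e\<in>some_onb. cinner (T e) e)"


section \<open>Functions on the circle\<close>

text \<open>
  A function on the circle is represented by a function on the reals of which only the
  restriction to \<open>[0, 2\<pi>]\<close>, up to null sets, is relevant.
\<close>

definition L1_circle :: "(real \<Rightarrow> complex) set" where
  "L1_circle = {f. set_integrable lebesgue {0..2*pi} f}"

definition L1_norm :: "(real \<Rightarrow> complex) \<Rightarrow> real" where
  "L1_norm f = (LINT t:{0..2*pi}|lebesgue. cmod (f t))"

definition fourier_coeff :: "(real \<Rightarrow> complex) \<Rightarrow> int \<Rightarrow> complex" where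
  "fourier_coeff f n = (LINT t:{0..2*pi}|lebesgue. f t * cis (- of_int n * t)) / (2 * pi)"

definition H1_circle :: "(real \<Rightarrow> complex) set" where
  "H1_circle = {f \<in> L1_circle. \<forall>n<0. fourier_coeff f n = 0}"


section \<open>The second order remainder and the trace formula\<close>

definition T_path ::
    "('a::chilbert_space \<Rightarrow>\<^sub>L 'a) \<Rightarrow> ('a \<Rightarrow>\<^sub>L 'a) \<Rightarrow> real \<Rightarrow> 'a \<Rightarrow>\<^sub>L 'a" where
  "T_path A T0 s = exp_op ((\<i> * complex_of_real s) *\<^sub>C A) o\<^sub>L T0"

definition remainder ::
    "('a::chilbert_space \<Rightarrow>\<^sub>L 'a) \<Rightarrow> ('a \<Rightarrow>\<^sub>L 'a) \<Rightarrow> complex poly \<Rightarrow> 'a \<Rightarrow>\<^sub>L 'a" where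
  "remainder A T0 p =
     poly_op p (T_path A T0 1) - poly_op p T0
       - vector_derivative (\<lambda>s. poly_op p (T_path A T0 s)) (at 0 within {0..1})"

definition second_deriv :: "(real \<Rightarrow> complex) \<Rightarrow> real \<Rightarrow> complex" where
  "second_deriv f t = vector_derivative (\<lambda>u. vector_derivative f (at u)) (at t)"

definition trace_formula ::
    "('a::chilbert_space \<Rightarrow>\<^sub>L 'a) \<Rightarrow> ('a \<Rightarrow>\<^sub>L 'a) \<Rightarrow> (real \<Rightarrow> complex) \<Rightarrow> bool" where
  "trace_formula A T0 \<eta> \<longleftrightarrow>
     (\<forall>p. trace_op (remainder A T0 p) =
        (LINT t:{0..2*pi}|lebesgue. second_deriv (\<lambda>u. poly p (cis u)) t * \<eta> t))"

end

theory Submission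
  imports Defs
begin

text \<open>
  Write \<open>T_s = e\<^bsup>isA\<^esup> T_0\<close>. By the cyclicity of the trace, the derivative in \<open>s\<close> of the trace of the
  remainder of \<open>z\<^sup>n\<close> is \<open>i n Tr (A (T_s\<^sup>n - T_0\<^sup>n))\<close>, so the trace formula prescribes the Fourier coefficients of the
  spectral shift function with negative index: up to constants they are the averages over \<open>s\<close> of
  \<open>Tr (A (T_s\<^sup>n - T_0\<^sup>n)) / n\<close>.

  The main estimate is that for contractions \<open>T\<close>, \<open>S\<close> with Hilbert--Schmidt difference and a
  Hilbert--Schmidt operator \<open>Z\<close> the numbers \<open>Tr (Z (T\<^sup>n - S\<^sup>n)) / n\<close> are such coefficients of an integrable
  function of norm at most (essentially) the product of the Hilbert--Schmidt norms of \<open>T - S\<close> and \<open>Z\<close>.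
  Formally, this follows by integrating the divided differences \<open>(\<lambda>\<^sup>n - \<mu>\<^sup>n) / (n (\<lambda> - \<mu>))\<close>, which are
  the moments of a probability measure on the circle (sweep the chord from \<open>\<lambda>\<close> to \<open>\<mu>\<close> to the circle),
  against the product of the semispectral measures of \<open>T\<close> and \<open>S\<close>. Instead of dilations, Fejer means
  of \<open>T\<^sup>j\<close> and \<open>S\<^sup>k\<close> at roots of unity are used; their positivity, also for the simultaneous action of
  \<open>T\<close> from the left and \<open>S\<close> from the right, replaces spectral theory. If \<open>Z\<close> has finite rank then the
  coefficients are \<open>O(1/n)\<close>, which yields functions rather than measures in the limit; the general
  case follows since the integrable functions modulo the Hardy space are complete.

  Applied to pairs \<open>T_s\<close>, \<open>T_r\<close>, whose difference has norm at most \<open>\<bar>s - r\<bar>\<close> times that of \<open>A\<close>, the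
  estimate makes Riemann sums over \<open>s\<close> converge, and the constant is the integral of \<open>s\<close> over \<open>[0, 1]\<close>,
  that is \<open>1/2\<close>.
\<close>


section \<open>Geometry of complex Hilbert spaces\<close>

text \<open>Bounded subsets of L1 are not weakly closed: positive kernels of bounded mass converge
  only to measures. A coefficientwise limit is therefore taken only under a uniform O(1/n) bound,
  because the dyadic blocks of such a sequence have geometrically decaying l2 norms, so the tails
  are small in L1 norm. All other limits have summable increments in the quotient by the Hardy
  space.

  The chord kernel is positive because the normalised divided difference is the average over the
  chord of the powers of its points, and the powers of a point of the disc are the moments of its
  Poisson kernel.

  On the operator side a positive form on Hilbert-Schmidt operators is built first from left and
  then from right multiplication. The second step requires right multiplication to be contractive
  for the form produced by the first; this rests on the commutation of the two multiplications.

  The trace of the remainder of z^n carries n^2: one n counts the equal terms of the derivative, the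
  other is the denominator in the main estimate. This matches the second derivative of
  \<open>cis (n * t)\<close>.\<close>

lemma cinner_add_right: "cinner (x::'a::chilbert_space) (y + z) = cinner x y + cinner x z"
  by (metis cinner_add_left cinner_commute complex_cnj_add)

lemma cinner_scaleC_right: "cinner (x::'a::chilbert_space) (c *\<^sub>C y) = cnj c * cinner x y"
  by (metis cinner_commute cinner_scaleC_left complex_cnj_mult)

lemma cinner_scaleR_left: "cinner (r *\<^sub>R (x::'a::chilbert_space)) y = of_real r * cinner x y"
  by (simp add: scaleR_scaleC cinner_scaleC_left)

lemma cinner_scaleR_right: "cinner (x::'a::chilbert_space) (r *\<^sub>R y) = of_real r * cinner x y"
  by (simp add: scaleR_scaleC cinner_scaleC_right)

text \<open>The factor \<open>c\<close>, unimodular or zero, turns the inner product into its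
  modulus, which reduces the claim to the Cauchy-Schwarz inequality of the underlying real inner
  product.\<close>

lemma norm_cinner_le: "cmod (cinner (x::'a::chilbert_space) y) \<le> norm x * norm y"
proof -
  define c where "c = cnj (sgn (cinner x y))"
  have "cmod (cinner x y) = Re (c * cinner x y)"
    by (cases "cinner x y = 0")
      (simp_all add: c_def sgn_eq complex_norm_square[symmetric] power2_eq_square mult.commute[of "cnj _"]
        flip: complex_norm_square of_real_mult of_real_power)
  also have "\<dots> = inner (c *\<^sub>C x) y"
    by (simp add: inner_eq_Re_cinner cinner_scaleC_left)
  also have "\<dots> \<le> norm (c *\<^sub>C x) * norm y"
    by (rule norm_cauchy_schwarz)
  also have "\<dots> \<le> norm x * norm y"
    by (intro mult_right_mono) (auto simp: norm_scaleC c_def norm_sgn)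
  finally show ?thesis .
qed

interpretation cinner: bounded_bilinear "cinner :: 'a::chilbert_space \<Rightarrow> 'a \<Rightarrow> complex"
  by standard
    (auto simp: cinner_add_left cinner_add_right cinner_scaleR_left cinner_scaleR_right
      scaleR_conv_of_real intro!: exI[of _ 1] norm_cinner_le)

interpretation scaleC: bounded_bilinear "scaleC :: complex \<Rightarrow> 'a \<Rightarrow> 'a::chilbert_space"
proof
  show "(r *\<^sub>R a) *\<^sub>C b = r *\<^sub>R (a *\<^sub>C b)" for r :: real and a and b :: 'a
    unfolding scaleR_scaleC[where 'a='a] scaleR_conv_of_real scaleC_scaleC ..
  show "a *\<^sub>C (r *\<^sub>R b) = r *\<^sub>R (a *\<^sub>C b)" for r :: real and a and b :: 'a
    unfolding scaleR_scaleC[where 'a='a] scaleC_scaleC by (simp add: mult.commute)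
  show "\<exists>K. \<forall>a (b::'a). norm (a *\<^sub>C b) \<le> norm a * norm b * K"
    by (rule exI[of _ 1]) (simp add: norm_scaleC)
qed (simp_all add: scaleC_add_left scaleC_add_right)

lemmas cinner_simps =
  cinner.add_left cinner.diff_left cinner.minus_left cinner.zero_left cinner.sum_left
  cinner.add_right cinner.diff_right cinner.minus_right cinner.zero_right cinner.sum_right
  cinner_scaleC_left cinner_scaleC_right cinner_scaleR_left cinner_scaleR_right

lemma scaleC_of_real: "complex_of_real r *\<^sub>C (x::'a::chilbert_space) = r *\<^sub>R x"
  by (simp add: scaleR_scaleC)

lemma cinner_self: "cinner (x::'a::chilbert_space) x = complex_of_real ((norm x)\<^sup>2)"
proof -
  have "Im (cinner x x) = 0"
    using arg_cong[OF cinner_commute[of x x], of Im] by simp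
  then show ?thesis
    by (simp add: complex_eq_iff power2_norm_eq_inner flip: inner_eq_Re_cinner)
qed

lemma cinner_eqI: "(\<And>z. cinner (x::'a::chilbert_space) z = cinner y z) \<Longrightarrow> x = y"
  by (metis cinner.diff_left cinner_self diff_self eq_iff_diff_eq_0 norm_eq_zero of_real_eq_0_iff
      power_eq_0_iff)

lemma norm_diff_sq:
  "(norm ((x::'a::chilbert_space) - y))\<^sup>2 = (norm x)\<^sup>2 + (norm y)\<^sup>2 - 2 * Re (cinner x y)"
  by (simp add: power2_norm_eq_inner inner_diff_left inner_diff_right inner_commute[of y x]
      flip: inner_eq_Re_cinner)

text \<open>Indexed families with zero vectors allowed: besides a basis, the intended example is the
  family of normalised images \<open>T b /\<^sub>R norm (T b)\<close>, which vanishes where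
  \<open>T b\<close> does. For this reason Pythagoras holds only as an inequality.\<close>

definition ortho_family :: "'b set \<Rightarrow> ('b \<Rightarrow> 'a::chilbert_space) \<Rightarrow> bool" where
  "ortho_family I v \<longleftrightarrow>
     (\<forall>i\<in>I. \<forall>j\<in>I. i \<noteq> j \<longrightarrow> cinner (v i) (v j) = 0) \<and> (\<forall>i\<in>I. v i = 0 \<or> norm (v i) = 1)"

lemma ortho_family_pythagoras:
  assumes "ortho_family I v" "finite F" "F \<subseteq> I"
  shows "(norm (\<Sum>i\<in>F. c i *\<^sub>C v i))\<^sup>2 \<le> (\<Sum>i\<in>F. (cmod (c i))\<^sup>2)"
proof -
  have "complex_of_real ((norm (\<Sum>i\<in>F. c i *\<^sub>C v i))\<^sup>2)
      = (\<Sum>i\<in>F. \<Sum>j\<in>F. c i * cnj (c j) * cinner (v i) (v j))"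
    unfolding cinner_self[symmetric]
    by (subst sum.swap) (simp add: cinner_simps sum_distrib_left mult.assoc mult.left_commute[of "cnj _"])
  also have "\<dots> = (\<Sum>i\<in>F. \<Sum>j\<in>F. if i = j then c i * cnj (c i) * cinner (v i) (v i) else 0)"
    using assms by (intro sum.cong) (auto simp: ortho_family_def)
  also have "\<dots> = (\<Sum>i\<in>F. c i * cnj (c i) * cinner (v i) (v i))"
    using assms by simp
  also have "\<dots> = of_real (\<Sum>i\<in>F. (cmod (c i))\<^sup>2 * (norm (v i))\<^sup>2)"
    by (simp add: cinner_self flip: complex_norm_square)
  finally have "(norm (\<Sum>i\<in>F. c i *\<^sub>C v i))\<^sup>2 = (\<Sum>i\<in>F. (cmod (c i))\<^sup>2 * (norm (v i))\<^sup>2)"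
    by (simp only: of_real_eq_iff)
  also have "\<dots> \<le> (\<Sum>i\<in>F. (cmod (c i))\<^sup>2)"
  proof (rule sum_mono)
    fix i assume "i \<in> F"
    then have "v i = 0 \<or> norm (v i) = 1" using assms by (auto simp: ortho_family_def)
    then show "(cmod (c i))\<^sup>2 * (norm (v i))\<^sup>2 \<le> (cmod (c i))\<^sup>2" by auto
  qed
  finally show ?thesis .
qed

lemma bessel_finite:
  assumes "ortho_family I v" "finite F" "F \<subseteq> I"
  shows "(\<Sum>i\<in>F. (cmod (cinner (v i) x))\<^sup>2) \<le> (norm x)\<^sup>2"
proof -
  define S where "S = (\<Sum>i\<in>F. (cmod (cinner (v i) x))\<^sup>2)"
  define p where "p = (\<Sum>i\<in>F. cinner x (v i) *\<^sub>C v i)"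
  have "cinner x p = of_real S"
    by (simp add: p_def S_def cinner_simps cinner_commute[of x] mult.commute[of "cnj _"]
      flip: complex_norm_square)
  moreover have "(norm p)\<^sup>2 \<le> S"
    using ortho_family_pythagoras[OF assms, of "\<lambda>i. cinner x (v i)"]
    by (simp add: p_def S_def cinner_commute[of x])
  moreover have "0 \<le> (norm (x - p))\<^sup>2" by simp
  ultimately show ?thesis by (simp add: norm_diff_sq S_def)
qed

text \<open>By Pythagoras the tails of the vector series are dominated by those of the scalar
  series, so its partial sums form a Cauchy filter.\<close>

lemma ortho_family_summable:
  fixes v :: "'b \<Rightarrow> 'a::chilbert_space"
  assumes "ortho_family I v" and s: "(\<lambda>i. (cmod (c i))\<^sup>2) summable_on I"
  shows "(\<lambda>i. c i *\<^sub>C v i) summable_on I"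
proof -
  from s obtain L where lim: "(sum (\<lambda>i. (cmod (c i))\<^sup>2) \<longlongrightarrow> L) (finite_subsets_at_top I)"
    unfolding summable_on_def has_sum_def by auto
  then have cau: "cauchy_filter (filtermap (sum (\<lambda>i. (cmod (c i))\<^sup>2)) (finite_subsets_at_top I))"
    by (auto intro!: nhds_imp_cauchy_filter simp: filterlim_def)
  have "\<exists>P. eventually P (finite_subsets_at_top I) \<and>
          (\<forall>F F'. P F \<and> P F' \<longrightarrow> dist (\<Sum>i\<in>F. c i *\<^sub>C v i) (\<Sum>i\<in>F'. c i *\<^sub>C v i) < e)"
    if "e > 0" for e
  proof -
    \<comment> \<open>The bound is on squared norms; e / 4 leaves room for the triangle inequality
      through the sum over \<open>F0\<close>.\<close>
    define d where "d = (e / 4)\<^sup>2"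
    have "d > 0" using that by (simp add: d_def)
    then obtain P where P: "eventually P (finite_subsets_at_top I)"
      and dP: "\<And>F F'. P F \<Longrightarrow> P F' \<Longrightarrow>
        dist (\<Sum>i\<in>F. (cmod (c i))\<^sup>2) (\<Sum>i\<in>F'. (cmod (c i))\<^sup>2) < d"
      using cau unfolding cauchy_filter_metric_filtermap by metis
    from P obtain F0 where F0: "finite F0" "F0 \<subseteq> I"
      and PF: "\<And>F. finite F \<Longrightarrow> F \<supseteq> F0 \<Longrightarrow> F \<subseteq> I \<Longrightarrow> P F"
      unfolding eventually_finite_subsets_at_top by auto
    have *: "norm ((\<Sum>i\<in>F. c i *\<^sub>C v i) - (\<Sum>i\<in>F0. c i *\<^sub>C v i)) < e / 2"
      if F: "finite F" "F \<supseteq> F0" "F \<subseteq> I" for F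
    proof -
      have "(norm (\<Sum>i\<in>F - F0. c i *\<^sub>C v i))\<^sup>2 \<le> (\<Sum>i\<in>F - F0. (cmod (c i))\<^sup>2)"
        using F by (intro ortho_family_pythagoras[OF assms(1)]) auto
      also have "\<dots> = (\<Sum>i\<in>F. (cmod (c i))\<^sup>2) - (\<Sum>i\<in>F0. (cmod (c i))\<^sup>2)"
        using F by (simp add: sum_diff F0)
      also have "\<dots> < d"
        using dP[OF PF[OF F] PF[OF F0(1) order_refl F0(2)]] by (simp add: dist_real_def)
      finally have "norm (\<Sum>i\<in>F - F0. c i *\<^sub>C v i) < e / 4"
        unfolding d_def by (rule power2_less_imp_less) (use \<open>e > 0\<close> in simp)
      moreover have "(\<Sum>i\<in>F - F0. c i *\<^sub>C v i) = (\<Sum>i\<in>F. c i *\<^sub>C v i) - (\<Sum>i\<in>F0. c i *\<^sub>C v i)"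
        using F by (simp add: sum_diff F0)
      ultimately show ?thesis using \<open>e > 0\<close> by simp
    qed
    define P' where "P' F \<longleftrightarrow> finite F \<and> F \<supseteq> F0 \<and> F \<subseteq> I" for F
    have "eventually P' (finite_subsets_at_top I)"
      unfolding P'_def eventually_finite_subsets_at_top using F0 by auto
    moreover have "dist (\<Sum>i\<in>F. c i *\<^sub>C v i) (\<Sum>i\<in>F'. c i *\<^sub>C v i) < e" if "P' F" "P' F'" for F F'
      using *[of F] *[of F'] that unfolding P'_def dist_norm[symmetric]
      using dist_triangle2[of "\<Sum>i\<in>F. c i *\<^sub>C v i" "\<Sum>i\<in>F'. c i *\<^sub>C v i" "\<Sum>i\<in>F0. c i *\<^sub>C v i"]
      by linarith
    ultimately show ?thesis by blast
  qed
  then have "cauchy_filter (filtermap (sum (\<lambda>i. c i *\<^sub>C v i)) (finite_subsets_at_top I))"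
    by (simp add: cauchy_filter_metric_filtermap)
  moreover have "complete (UNIV::'a set)"
    by (meson Cauchy_convergent UNIV_I complete_def convergent_def)
  ultimately obtain L' where "(sum (\<lambda>i. c i *\<^sub>C v i) \<longlongrightarrow> L') (finite_subsets_at_top I)"
    using complete_uniform[where S=UNIV] by (force simp add: filterlim_def)
  then show ?thesis
    using summable_on_def has_sum_def by blast
qed

lemma bessel_summable:
  assumes "ortho_family I v"
  shows "(\<lambda>i. (cmod (cinner x (v i)))\<^sup>2) summable_on I"
proof (rule nonneg_bdd_above_summable_on)
  show "bdd_above (sum (\<lambda>i. (cmod (cinner x (v i)))\<^sup>2) ` {F. F \<subseteq> I \<and> finite F})"
    using bessel_finite[OF assms, of _ x] by (auto intro!: bdd_aboveI simp: cinner_commute[of x])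
qed auto

section \<open>Orthonormal bases: expansion, Parseval, Riesz representation\<close>

lemma onb_ortho_family: "is_onb E \<Longrightarrow> ortho_family E (\<lambda>e. e)"
  by (auto simp: is_onb_def ortho_family_def norm_eq_sqrt_inner inner_eq_Re_cinner)

lemma cinner_onb: "is_onb E \<Longrightarrow> e \<in> E \<Longrightarrow> f \<in> E \<Longrightarrow> cinner e f = (if e = f then 1 else 0)"
  by (simp add: is_onb_def)

lemma cspan_closure_eqI:
  fixes f g :: "'a::chilbert_space \<Rightarrow>\<^sub>L 'b::chilbert_space"
  assumes "closure (cvec.span E) = UNIV" "\<And>e. e \<in> E \<Longrightarrow> f e = g e"
    and lin: "\<And>c x. f (c *\<^sub>C x) = c *\<^sub>C f x" "\<And>c x. g (c *\<^sub>C x) = c *\<^sub>C g x"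
  shows "f = g"
proof (rule blinfun_eqI)
  fix x
  have "cvec.span E \<subseteq> {x. f x = g x}"
    by (rule cvec.span_minimal)
      (auto simp: assms blinfun.bilinear_simps cvec.subspace_def)
  moreover have "closed {x. f x = g x}"
    by (intro closed_Collect_eq continuous_intros)
  ultimately have "closure (cvec.span E) \<subseteq> {x. f x = g x}"
    by (simp add: closure_minimal)
  with assms(1) show "f x = g x" by auto
qed

lemma orthonormal_coefficient:
  assumes orth: "\<forall>e\<in>E. \<forall>f\<in>E. cinner e f = (if e = f then 1 else 0)"
    and y: "((\<lambda>f. c f *\<^sub>C f) has_sum y) E" and e: "e \<in> E"
  shows "cinner y e = c e"
proof -
  have "((\<lambda>f. cinner (c f *\<^sub>C f) e) has_sum cinner y e) E"
    by (rule has_sum_bounded_linear[OF cinner.bounded_linear_left y])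
  moreover have "((\<lambda>f. cinner (c f *\<^sub>C f) e) has_sum c e) E"
    by (rule has_sum_finite_neutralI[of "{e}"]) (use e orth in \<open>auto simp: cinner_simps\<close>)
  ultimately show ?thesis by (rule has_sum_unique)
qed

text \<open>The Fourier series of x converges to some y by Bessel, and x - y is orthogonal to
  \<open>E\<close>; hence x = y is a limit of elements of the span. Intended for maximal orthonormal
  sets of eigenvectors.\<close>

lemma ortho_complement_trivial_imp_onb:
  assumes orth: "\<forall>e\<in>E. \<forall>f\<in>E. cinner e f = (if e = f then 1 else 0)"
    and triv: "\<And>x::'a::chilbert_space. (\<And>e. e \<in> E \<Longrightarrow> cinner x e = 0) \<Longrightarrow> x = 0"
  shows "is_onb E"
proof -
  have o: "ortho_family E (\<lambda>e. e)"
    using orth by (auto simp: ortho_family_def norm_eq_sqrt_inner inner_eq_Re_cinner)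
  have "x \<in> closure (cvec.span E)" for x
  proof -
    obtain y where y: "((\<lambda>e. cinner x e *\<^sub>C e) has_sum y) E"
      using ortho_family_summable[OF o bessel_summable[OF o]] summable_on_def by blast
    have "cinner (x - y) e = 0" if "e \<in> E" for e
      using orthonormal_coefficient[OF orth y that] by (simp add: cinner_simps)
    then have "x = y" using triv[of "x - y"] by auto
    have "(sum (\<lambda>e. cinner x e *\<^sub>C e) \<longlongrightarrow> x) (finite_subsets_at_top E)"
      using y \<open>x = y\<close> by (simp add: has_sum_def)
    moreover have "\<forall>\<^sub>F F in finite_subsets_at_top E.
        (\<Sum>e\<in>F. cinner x e *\<^sub>C e) \<in> closure (cvec.span E)"
      unfolding eventually_finite_subsets_at_top
    proof (rule exI[of _ "{}"], clarsimp)
      fix F assume "F \<subseteq> E"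
      then have "(\<Sum>e\<in>F. cinner x e *\<^sub>C e) \<in> cvec.span E"
        by (intro cvec.span_sum cvec.span_scale cvec.span_base) auto
      then show "(\<Sum>e\<in>F. cinner x e *\<^sub>C e) \<in> closure (cvec.span E)"
        using closure_subset by auto
    qed
    ultimately show ?thesis
      by (intro Lim_in_closed_set[OF closed_closure]) auto
  qed
  then show ?thesis using orth by (auto simp: is_onb_def)
qed

lemma onb_complement_trivial:
  assumes "is_onb E" "\<And>e. e \<in> E \<Longrightarrow> cinner x e = 0"
  shows "x = 0"
proof -
  have "cvec.span E \<subseteq> {y. cinner x y = 0}"
    by (rule cvec.span_minimal) (auto simp: assms cvec.subspace_def cinner_simps)
  moreover have "closed {y. cinner x y = 0}"
    by (intro closed_Collect_eq continuous_on_const cinner.continuous_on continuous_on_id)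
  ultimately have "closure (cvec.span E) \<subseteq> {y. cinner x y = 0}"
    by (simp add: closure_minimal)
  then have "cinner x x = 0" using assms(1) by (auto simp: is_onb_def)
  then show ?thesis by (simp add: cinner_self)
qed

lemma onb_expansion:
  assumes "is_onb E"
  shows "((\<lambda>e. cinner x e *\<^sub>C e) has_sum x) E"
proof -
  note o = onb_ortho_family[OF assms]
  obtain y where y: "((\<lambda>e. cinner x e *\<^sub>C e) has_sum y) E"
    using ortho_family_summable[OF o bessel_summable[OF o]] summable_on_def by blast
  have "cinner (x - y) e = 0" if "e \<in> E" for e
    using orthonormal_coefficient[OF _ y that] assms by (simp add: is_onb_def cinner_simps)
  then have "x = y" using onb_complement_trivial[OF assms, of "x - y"] by auto
  with y show ?thesis by simp
qed

lemma parseval: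
  assumes "is_onb E"
  shows "((\<lambda>e. cinner x e * cinner e y) has_sum cinner x y) E"
  using has_sum_bounded_linear[OF cinner.bounded_linear_left onb_expansion[OF assms]]
  by (simp add: cinner_simps)

lemma parseval_norm:
  assumes "is_onb E"
  shows "((\<lambda>e. (cmod (cinner x e))\<^sup>2) has_sum (norm x)\<^sup>2) E"
proof -
  have *: "cnj (cinner x e) = cinner e x" for e by (rule cinner_commute[symmetric])
  have "((\<lambda>e. complex_of_real ((cmod (cinner x e))\<^sup>2)) has_sum complex_of_real ((norm x)\<^sup>2)) E"
    using parseval[OF assms, of x x]
    unfolding cinner_self complex_norm_square[of "cinner x _"] * .
  then show ?thesis by (simp only: has_sum_of_real_iff)
qed

text \<open>The representing vector is written down as the series of
  \<open>cnj (f e) *\<^sub>C e\<close>. Testing f on its own partial sums gives S^2 \<le> |f|^2 * S,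
  hence the square summability of the coefficients.\<close>

lemma riesz_representation:
  fixes f :: "'a::chilbert_space \<Rightarrow>\<^sub>L complex"
  assumes E: "is_onb (E :: 'a set)" and lin: "\<And>c x. f (c *\<^sub>C x) = c * f x"
  shows "\<exists>y. \<forall>x. f x = cinner x y"
proof -
  note o = onb_ortho_family[OF E]
  have "(\<Sum>e\<in>F. (cmod (f e))\<^sup>2) \<le> (norm f)\<^sup>2" if F: "finite F" "F \<subseteq> E" for F
  proof -
    define S where "S = (\<Sum>e\<in>F. (cmod (f e))\<^sup>2)"
    define p where "p = (\<Sum>e\<in>F. cnj (f e) *\<^sub>C e)"
    have "f p = of_real S"
      by (simp add: p_def S_def blinfun.sum_right lin mult.commute[of "cnj _"]
          flip: complex_norm_square)
    then have "S \<le> norm f * norm p"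
      using norm_blinfun[of f p] by simp
    moreover have "(norm p)\<^sup>2 \<le> S"
      using ortho_family_pythagoras[OF o F, of "\<lambda>e. cnj (f e)"] by (simp add: p_def S_def)
    moreover have "S \<ge> 0" by (simp add: S_def sum_nonneg)
    ultimately have "S\<^sup>2 \<le> (norm f)\<^sup>2 * S"
      using power_mono[of S "norm f * norm p" 2] mult_left_mono[of "(norm p)\<^sup>2" S "(norm f)\<^sup>2"]
      by (simp add: power_mult_distrib)
    with \<open>S \<ge> 0\<close> show ?thesis
      unfolding S_def[symmetric] by (cases "S = 0") (auto simp: power2_eq_square)
  qed
  then have "(\<lambda>e. (cmod (cnj (f e)))\<^sup>2) summable_on E"
    by (intro nonneg_bdd_above_summable_on) (auto intro!: bdd_aboveI)
  from ortho_family_summable[OF o this]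
  obtain y where y: "((\<lambda>e. cnj (f e) *\<^sub>C e) has_sum y) E"
    using summable_on_def by blast
  have "f x = cinner x y" for x
  proof -
    have "((\<lambda>e. cinner x (cnj (f e) *\<^sub>C e)) has_sum cinner x y) E"
      by (rule has_sum_bounded_linear[OF cinner.bounded_linear_right y])
    moreover have "((\<lambda>e. f (cinner x e *\<^sub>C e)) has_sum f x) E"
      by (rule has_sum_bounded_linear[OF blinfun.bounded_linear_right onb_expansion[OF E]])
    ultimately show ?thesis
      by (simp add: lin cinner_simps mult.commute has_sum_unique)
  qed
  then show ?thesis by blast
qed

section \<open>Positive semidefinite sesquilinear forms\<close>

text \<open>Stated for a carrier set and bare scalar multiplication because the forms later live on
  the Hilbert-Schmidt operators, a subset of the type of bounded maps.\<close>

definition csub :: "'v::{real_vector,scaleC} set \<Rightarrow> bool" where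
  "csub V \<longleftrightarrow> (\<forall>x\<in>V. \<forall>y\<in>V. x + y \<in> V) \<and> (\<forall>c. \<forall>x\<in>V. c *\<^sub>C x \<in> V)"

text \<open>Hermitian symmetry makes \<open>q x x\<close> real, so positivity may be stated for the
  real part. Degenerate forms are allowed.\<close>

definition psd_form :: "'v::{real_vector,scaleC} set \<Rightarrow> ('v \<Rightarrow> 'v \<Rightarrow> complex) \<Rightarrow> bool" where
  "psd_form V q \<longleftrightarrow>
     (\<forall>x\<in>V. \<forall>y\<in>V. \<forall>z\<in>V. q (x + y) z = q x z + q y z) \<and>
     (\<forall>c. \<forall>x\<in>V. \<forall>y\<in>V. q (c *\<^sub>C x) y = c * q x y) \<and>
     (\<forall>x\<in>V. \<forall>y\<in>V. q y x = cnj (q x y)) \<and>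
     (\<forall>x\<in>V. 0 \<le> Re (q x x))"

lemma csubD:
  assumes "csub V"
  shows "x \<in> V \<Longrightarrow> y \<in> V \<Longrightarrow> x + y \<in> V" "x \<in> V \<Longrightarrow> c *\<^sub>C x \<in> V"
  using assms by (auto simp: csub_def)

lemma psd_formD:
  assumes "psd_form V q"
  shows "x \<in> V \<Longrightarrow> y \<in> V \<Longrightarrow> z \<in> V \<Longrightarrow> q (x + y) z = q x z + q y z"
    "x \<in> V \<Longrightarrow> y \<in> V \<Longrightarrow> q (c *\<^sub>C x) y = c * q x y"
    "x \<in> V \<Longrightarrow> y \<in> V \<Longrightarrow> q y x = cnj (q x y)"
    "x \<in> V \<Longrightarrow> 0 \<le> Re (q x x)"
  using assms unfolding psd_form_def by blast+

lemma psd_form_right: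
  assumes "psd_form V q" "csub V"
  shows "x \<in> V \<Longrightarrow> y \<in> V \<Longrightarrow> z \<in> V \<Longrightarrow> q z (x + y) = q z x + q z y"
    "x \<in> V \<Longrightarrow> y \<in> V \<Longrightarrow> q x (c *\<^sub>C y) = cnj c * q x y"
  using psd_formD(1)[OF assms(1), of x y z] psd_formD(2)[OF assms(1), of y x c]
    psd_formD(3)[OF assms(1), of "x + y" z] psd_formD(3)[OF assms(1), of x z]
    psd_formD(3)[OF assms(1), of y z] psd_formD(3)[OF assms(1), of y x]
    psd_formD(3)[OF assms(1), of "c *\<^sub>C y" x] csubD[OF assms(2)]
  by auto

lemma psd_form_expand:
  assumes q: "psd_form V q" and V: "csub V" and x: "x \<in> V" and y: "y \<in> V"
  shows "Re (q (x + c *\<^sub>C y) (x + c *\<^sub>C y))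
    = Re (q x x) + (cmod c)\<^sup>2 * Re (q y y) + 2 * Re (cnj c * q x y)"
proof -
  have cy: "c *\<^sub>C y \<in> V" using y by (rule csubD(2)[OF V])
  have "q (x + c *\<^sub>C y) (x + c *\<^sub>C y)
      = q x x + (c * cnj c) * q y y + (cnj c * q x y + cnj (cnj c * q x y))"
    using x y cy csubD(1)[OF V x cy]
    by (simp add: psd_formD(1,2)[OF q] psd_form_right[OF q V] psd_formD(3)[OF q x y] algebra_simps)
  then show ?thesis
    by (simp add: complex_norm_square[symmetric] del: complex_cnj_mult)
qed

text \<open>Positivity at x - t q(x,y) y is an inequality quadratic in t, used at t = 1 / b. Since
  the form may be degenerate, b = 0 is treated apart.\<close>

lemma psd_form_cauchy_schwarz:
  assumes q: "psd_form V q" and V: "csub V" and x: "x \<in> V" and y: "y \<in> V"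
  shows "(cmod (q x y))\<^sup>2 \<le> Re (q x x) * Re (q y y)"
proof -
  define a b m where "a = Re (q x x)" and "b = Re (q y y)" and "m = (cmod (q x y))\<^sup>2"
  have *: "0 \<le> a + t\<^sup>2 * m * b - 2 * t * m" for t :: real
  proof -
    have "0 \<le> Re (q (x + (of_real (-t) * q x y) *\<^sub>C y) (x + (of_real (-t) * q x y) *\<^sub>C y))"
      using q x y V by (intro psd_formD(4)[OF q] csubD)
    also have "\<dots> = a + t\<^sup>2 * m * b - 2 * t * m"
      unfolding psd_form_expand[OF q V x y] a_def b_def m_def
      by (simp add: norm_mult power_mult_distrib cmod_power2) (simp add: power2_eq_square algebra_simps)
    finally show ?thesis .
  qed
  have nn: "0 \<le> a" "0 \<le> b" "0 \<le> m"
    using psd_formD(4)[OF q] x y by (auto simp: a_def b_def m_def)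
  have "m \<le> a * b"
  proof (cases "b = 0")
    case True
    have "m = 0"
    proof (rule ccontr)
      assume "m \<noteq> 0"
      \<comment> \<open>For b = 0 the inequality is affine in t, and this t gives it the value
        -1.\<close>
      then show False using *[of "(a + 1) / (2 * m)"] True nn by (simp add: field_simps)
    qed
    then show ?thesis using nn by simp
  next
    case False
    then show ?thesis using *[of "1 / b"] nn by (simp add: field_simps power2_eq_square)
  qed
  then show ?thesis by (simp add: a_def b_def m_def)
qed

text \<open>Unlike the product bound, this one is additive in q and can be summed over a family of
  forms; the product is recovered later by rescaling the two arguments.\<close>

lemma psd_form_am_gm:
  assumes q: "psd_form V q" and V: "csub V" and x: "x \<in> V" and y: "y \<in> V"
  shows "cmod (q x y) \<le> (Re (q x x) + Re (q y y)) / 2"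
proof -
  have "(cmod (q x y))\<^sup>2 \<le> ((Re (q x x) + Re (q y y)) / 2)\<^sup>2"
    using psd_form_cauchy_schwarz[OF assms] zero_le_power2[of "Re (q x x) - Re (q y y)"]
    by (simp add: power2_eq_square field_simps)
  then show ?thesis
    by (rule power2_le_imp_le) (use psd_formD(4)[OF q x] psd_formD(4)[OF q y] in simp)
qed

section \<open>Adjoints\<close>

lemma clinear_opD: "clinear_op T \<Longrightarrow> T (c *\<^sub>C x) = c *\<^sub>C T x"
  by (simp add: clinear_op_def)

lemmas scaleC_blinfun_apply [simp] = scaleC_blinfun.rep_eq

lemma clinear_op_intros [simp, intro]:
  "clinear_op 0" "clinear_op id_blinfun"
  "clinear_op S \<Longrightarrow> clinear_op T \<Longrightarrow> clinear_op (S + T)"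
  "clinear_op S \<Longrightarrow> clinear_op T \<Longrightarrow> clinear_op (S - T)"
  "clinear_op S \<Longrightarrow> clinear_op T \<Longrightarrow> clinear_op (S o\<^sub>L T)"
  "clinear_op T \<Longrightarrow> clinear_op (c *\<^sub>C T)"
  "clinear_op T \<Longrightarrow> clinear_op (- T)"
  "clinear_op T \<Longrightarrow> clinear_op (r *\<^sub>R T)"
  by (auto simp: clinear_op_def blinfun.bilinear_simps scaleC.add_right scaleC.diff_right
      scaleC_scaleC scaleR_scaleC[where 'a='a] mult.commute scaleC.zero_right scaleC.minus_right)

lemma norm_scaleC_blinfun_le: "norm (c *\<^sub>C (T::'a::chilbert_space \<Rightarrow>\<^sub>L 'a)) \<le> cmod c * norm T"
proof (rule norm_blinfun_bound)
  fix x show "norm (blinfun_apply (c *\<^sub>C T) x) \<le> cmod c * norm T * norm x"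
    using norm_blinfun[of T x] by (simp add: norm_scaleC mult_left_mono mult.assoc)
qed simp

lemma compose_scaleC_left: "(c *\<^sub>C S) o\<^sub>L T = c *\<^sub>C (S o\<^sub>L T)"
  by (rule blinfun_eqI) simp

lemma compose_scaleC_right: "clinear_op S \<Longrightarrow> S o\<^sub>L (c *\<^sub>C T) = c *\<^sub>C (S o\<^sub>L T)"
  by (rule blinfun_eqI) (simp add: clinear_opD)

lemmas compose_scaleC = compose_scaleC_left compose_scaleC_right

lemmas compose_simps =
  bounded_bilinear.add_left[OF bounded_bilinear_blinfun_compose]
  bounded_bilinear.add_right[OF bounded_bilinear_blinfun_compose]
  bounded_bilinear.diff_left[OF bounded_bilinear_blinfun_compose]
  bounded_bilinear.diff_right[OF bounded_bilinear_blinfun_compose]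

lemma compose_assoc: "(R o\<^sub>L S) o\<^sub>L T = R o\<^sub>L (S o\<^sub>L T)"
  by (rule blinfun_eqI) simp

lemma compose_id [simp]: "T o\<^sub>L id_blinfun = T" "id_blinfun o\<^sub>L T = T"
  by (auto intro: blinfun_eqI)

text \<open>A basis is fixed by assumption; the theorem obtains one from the basis hidden in the
  Hilbert-Schmidt condition on \<open>V\<close> and takes \<open>some_onb\<close>, the basis in
  which trace and norm are defined.\<close>

locale hilbert_basis =
  fixes E :: "'a::chilbert_space set"
  assumes onb: "is_onb E"
begin

lemma adj_exists:
  fixes T :: "'a \<Rightarrow>\<^sub>L 'a"
  assumes T: "clinear_op T"
  shows "\<exists>!S :: 'a \<Rightarrow>\<^sub>L 'a. \<forall>x y. cinner (T x) y = cinner x (S y)"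
proof -
  have "\<exists>z. \<forall>x. cinner (T x) y = cinner x z" for y
  proof -
    define f where "f = Blinfun (\<lambda>x. cinner (T x) y)"
    have f: "f x = cinner (T x) y" for x
      unfolding f_def
      by (subst bounded_linear_Blinfun_apply)
        (auto intro!: bounded_linear_compose[OF cinner.bounded_linear_left blinfun.bounded_linear_right])
    show ?thesis
      using riesz_representation[OF onb, of f] by (simp add: f clinear_opD[OF T] cinner_simps)
  qed
  then obtain S where S: "cinner (T x) y = cinner x (S y)" for x y by metis
  have eqI: "u = v" if "\<And>x. cinner x u = cinner x v" for u v :: 'a
    using that cinner_eqI by (metis cinner_commute)
  have "bounded_linear S"
  proof (rule bounded_linear_intro[of _ "norm T"])
    fix x y :: 'a and r :: real
    show "S (x + y) = S x + S y"
      by (rule eqI) (simp add: cinner_simps flip: S)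
    show "S (r *\<^sub>R x) = r *\<^sub>R S x"
      by (rule eqI) (simp add: cinner_simps flip: S)
    have "(norm (S x))\<^sup>2 = cmod (cinner (T (S x)) x)"
      by (simp add: S cinner_self del: of_real_power)
    also have "\<dots> \<le> norm T * norm (S x) * norm x"
      by (rule order_trans[OF norm_cinner_le]) (intro mult_right_mono norm_blinfun norm_ge_zero)
    finally show "norm (S x) \<le> norm x * norm T"
      by (cases "S x = 0") (simp_all add: power2_eq_square mult.commute mult.left_commute)
  qed
  then have "\<forall>x y. cinner (T x) y = cinner x (Blinfun S y)"
    by (simp add: bounded_linear_Blinfun_apply S)
  moreover have "S1 = S2" if "\<forall>x y. cinner (T x) y = cinner x (S1 y)"
    "\<forall>x y. cinner (T x) y = cinner x (S2 y)" for S1 S2 :: "'a \<Rightarrow>\<^sub>L 'a"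
    by (rule blinfun_eqI, rule eqI) (use that in metis)
  ultimately show ?thesis by blast
qed

lemma cinner_adj: "clinear_op T \<Longrightarrow> cinner x (adj T y) = cinner (T x) (y::'a)"
proof -
  assume "clinear_op T"
  then have "\<forall>x y. cinner (T x) y = cinner x (adj T y)"
    unfolding adj_def by (rule theI'[OF adj_exists])
  then show ?thesis by simp
qed

lemma cinner_adj': "clinear_op T \<Longrightarrow> cinner (adj T x) y = cinner (x::'a) (T y)"
  by (subst (1 2) cinner_commute) (simp add: cinner_adj)

lemma adj_eqI:
  fixes S T :: "'a \<Rightarrow>\<^sub>L 'a"
  shows "clinear_op T \<Longrightarrow> (\<And>x y. cinner (T x) y = cinner x (S y)) \<Longrightarrow> adj T = S"
  unfolding adj_def by (rule the1_equality[OF adj_exists]) auto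

lemma clinear_adj [simp]:
  fixes T :: "'a \<Rightarrow>\<^sub>L 'a"
  shows "clinear_op T \<Longrightarrow> clinear_op (adj T)"
  unfolding clinear_op_def[of "adj T"]
  by (intro impI allI cinner_eqI[where x = "adj T _"]) (simp add: cinner_adj' cinner_simps)

lemma adj_adj [simp]: "clinear_op T \<Longrightarrow> adj (adj T) = (T :: 'a \<Rightarrow>\<^sub>L 'a)"
  by (rule adj_eqI) (auto simp: cinner_adj')

lemma adj_compose:
  "clinear_op S \<Longrightarrow> clinear_op T \<Longrightarrow> adj (S o\<^sub>L T) = adj T o\<^sub>L adj (S :: 'a \<Rightarrow>\<^sub>L 'a)"
  by (rule adj_eqI) (auto simp: cinner_adj)

lemma norm_adj_le: 
  fixes T :: "'a \<Rightarrow>\<^sub>L 'a"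
  assumes T: "clinear_op T" shows "norm (adj T) \<le> norm T"
proof (rule norm_blinfun_bound)
  fix x
  have "(norm (adj T x))\<^sup>2 = cmod (cinner (T (adj T x)) x)"
    by (simp add: cinner_self del: of_real_power flip: cinner_adj[OF T])
  also have "\<dots> \<le> norm T * norm (adj T x) * norm x"
    by (rule order_trans[OF norm_cinner_le]) (intro mult_right_mono norm_blinfun norm_ge_zero)
  finally show "norm (adj T x) \<le> norm T * norm x"
    by (cases "adj T x = 0") (simp_all add: power2_eq_square mult.commute mult.left_commute)
qed simp

lemma norm_adj: "clinear_op T \<Longrightarrow> norm (adj T) = norm (T :: 'a \<Rightarrow>\<^sub>L 'a)"
  using norm_adj_le[of T] norm_adj_le[of "adj T"] by simp

section \<open>Hilbert--Schmidt operators\<close>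

lemma norm_cinner_commute: "cmod (cinner x y) = cmod (cinner y (x::'a))"
  by (subst cinner_commute) (rule complex_mod_cnj)

lemma square_le_mult_square: "0 \<le> a \<Longrightarrow> a \<le> b * c \<Longrightarrow> a\<^sup>2 \<le> b\<^sup>2 * (c::real)\<^sup>2"
  using power_mono[of a "b * c" 2] by (simp add: power_mult_distrib)

lemma mult_le_sum_squares: "0 \<le> a \<Longrightarrow> 0 \<le> b \<Longrightarrow> a * b \<le> a\<^sup>2 + (b::real)\<^sup>2"
  using zero_le_power2[of "a - b"] mult_nonneg_nonneg[of a b]
  unfolding power2_diff by linarith

section \<open>Change of orthonormal basis\<close>

lemma matrix_summable:
  fixes T :: "'a \<Rightarrow>\<^sub>L 'a"
  assumes F: "is_onb (F::'a set)" and s: "(\<lambda>e. (norm (T e))\<^sup>2) summable_on D"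
  shows "(\<lambda>(e, f). (cmod (cinner (T e) f))\<^sup>2) summable_on D \<times> F"
proof -
  have 1: "(\<lambda>f. (cmod (cinner (T e) f))\<^sup>2) summable_on F"
    and 2: "infsum (\<lambda>f. (cmod (cinner (T e) f))\<^sup>2) F = (norm (T e))\<^sup>2" for e
    using parseval_norm[OF F, of "T e"] by (auto simp: has_sum_iff)
  then show ?thesis
    using Infinite_Sum.abs_summable_on_Sigma_iff[where f = "\<lambda>p. (cmod (cinner (T (fst p)) (snd p)))\<^sup>2" and A = D and B = "\<lambda>_. F"] s
    by (simp add: case_prod_unfold)
qed

text \<open>The squared matrix entries are summed in the other order. As D and F are independent,
  going to the adjoint and back transfers summability from an arbitrary basis to the fixed
  one.\<close>

lemma adj_summable:
  fixes T :: "'a \<Rightarrow>\<^sub>L 'a"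
  assumes D: "is_onb (D::'a set)" and F: "is_onb (F::'a set)" and T: "clinear_op T"
    and s: "(\<lambda>e. (norm (T e))\<^sup>2) summable_on D"
  shows "(\<lambda>f. (norm (adj T f))\<^sup>2) summable_on F"
proof -
  have "(\<lambda>(f, e). (cmod (cinner (T e) f))\<^sup>2) summable_on F \<times> D"
    using matrix_summable[OF F s] summable_on_swap[of "\<lambda>(e, f). (cmod (cinner (T e) f))\<^sup>2" D F]
    by (simp add: case_prod_unfold)
  then have "(\<lambda>f. infsum (\<lambda>e. (cmod (cinner (T e) f))\<^sup>2) D) summable_on F"
    using summable_on_Sigma_banach[of "\<lambda>f e. (cmod (cinner (T e) f))\<^sup>2" F "\<lambda>_. D"] by simp
  moreover have "infsum (\<lambda>e. (cmod (cinner (T e) f))\<^sup>2) D = (norm (adj T f))\<^sup>2" for f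
    using parseval_norm[OF D, of "adj T f"] norm_cinner_commute[of f]
    by (simp add: cinner_adj'[OF T] has_sum_iff)
  ultimately show ?thesis by simp
qed

definition hs :: "('a \<Rightarrow>\<^sub>L 'a) \<Rightarrow> bool" where
  "hs Y \<longleftrightarrow> clinear_op Y \<and> (\<lambda>e. (norm (Y e))\<^sup>2) summable_on E"

text \<open>The Hilbert-Schmidt inner product, formally the trace of
  \<open>adj Z o\<^sub>L Y\<close>.\<close>

definition hsi :: "('a \<Rightarrow>\<^sub>L 'a) \<Rightarrow> ('a \<Rightarrow>\<^sub>L 'a) \<Rightarrow> complex" where
  "hsi Y Z = (\<Sum>\<^sub>\<infinity>e\<in>E. cinner (Y e) (Z e))"

definition hsn :: "('a \<Rightarrow>\<^sub>L 'a) \<Rightarrow> real" where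
  "hsn Y = sqrt (\<Sum>\<^sub>\<infinity>e\<in>E. (norm (Y e))\<^sup>2)"

lemma hilbert_schmidt_imp_hs: "hilbert_schmidt T \<Longrightarrow> hs T"
  unfolding hilbert_schmidt_def hs_def
  using adj_summable[OF _ onb, of _ T] adj_summable[OF onb onb, of "adj T"]
  by (metis adj_adj clinear_adj)

lemma hs_clinear: "hs Y \<Longrightarrow> clinear_op Y"
  by (simp add: hs_def)

lemma hs_adj: "hs Y \<Longrightarrow> hs (adj Y)"
  unfolding hs_def using adj_summable[OF onb onb, of Y] by simp

lemma hs_bound:
  assumes "clinear_op Y" "hs Z" "\<And>e. norm (Y e) \<le> c * norm (Z e)"
  shows "hs Y"
  unfolding hs_def
proof
  have "(\<lambda>e. c\<^sup>2 * (norm (Z e))\<^sup>2) summable_on E"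
    using assms by (intro summable_on_cmult_right) (auto simp: hs_def)
  then show "(\<lambda>e. (norm (Y e))\<^sup>2) summable_on E"
  proof (rule summable_on_comparison_test)
    fix e show "(norm (Y e))\<^sup>2 \<le> c\<^sup>2 * (norm (Z e))\<^sup>2"
      using assms(3)[of e] by (intro square_le_mult_square) auto
  qed auto
qed fact

lemma hs_compose_left: "clinear_op B \<Longrightarrow> hs Y \<Longrightarrow> hs (B o\<^sub>L Y)"
  by (rule hs_bound[of _ Y "norm B"]) (auto simp: hs_clinear norm_blinfun)

text \<open>Right multiplication moves the basis vectors themselves; after taking adjoints it
  becomes left multiplication.\<close>

lemma hs_compose_right: 
  assumes B: "clinear_op B" and Y: "hs Y" shows "hs (Y o\<^sub>L B)"
proof -
  have "hs (adj B o\<^sub>L adj Y)" using assms by (simp add: hs_compose_left hs_adj)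
  then have "hs (adj (Y o\<^sub>L B))" using assms by (simp add: adj_compose hs_clinear)
  then show ?thesis using hs_adj[of "adj (Y o\<^sub>L B)"] B hs_clinear[OF Y] by simp
qed

lemma hs_scaleC: "hs Y \<Longrightarrow> hs (c *\<^sub>C Y)"
  by (rule hs_bound[of _ Y "cmod c"]) (auto simp: hs_clinear norm_scaleC)

lemma hs_add: assumes "hs Y" "hs Z" shows "hs (Y + Z)"
  unfolding hs_def
proof
  have "(\<lambda>e. 2 * (norm (Y e))\<^sup>2 + 2 * (norm (Z e))\<^sup>2) summable_on E"
    using assms by (intro summable_on_add summable_on_cmult_right) (auto simp: hs_def)
  then show "(\<lambda>e. (norm ((Y + Z) e))\<^sup>2) summable_on E"
  proof (rule summable_on_comparison_test)
    fix e
    have "(norm ((Y + Z) e))\<^sup>2 \<le> (norm (Y e) + norm (Z e))\<^sup>2"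
      by (intro power_mono) (auto simp: blinfun.add_left norm_triangle_ineq)
    also have "\<dots> \<le> 2 * (norm (Y e))\<^sup>2 + 2 * (norm (Z e))\<^sup>2"
      using zero_le_power2[of "norm (Y e) - norm (Z e)"] by (simp add: power2_eq_square algebra_simps)
    finally show "(norm ((Y + Z) e))\<^sup>2 \<le> 2 * (norm (Y e))\<^sup>2 + 2 * (norm (Z e))\<^sup>2" .
  qed auto
qed (use assms in \<open>auto simp: hs_def\<close>)

lemma hs_zero: "hs 0"
  by (simp add: hs_def)

lemma hs_uminus: "hs Y \<Longrightarrow> hs (- Y)"
  by (simp add: hs_def blinfun.minus_left)

lemma hs_diff: "hs Y \<Longrightarrow> hs Z \<Longrightarrow> hs (Y - Z)"
  using hs_add[OF _ hs_uminus, of Y Z] by simp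

lemma hs_scaleR: "hs Y \<Longrightarrow> hs (r *\<^sub>R Y)"
  by (rule hs_bound[of _ Y "\<bar>r\<bar>"]) (auto simp: hs_clinear blinfun.scaleR_left)

lemma hs_sum: "(\<And>i. i \<in> I \<Longrightarrow> hs (f i)) \<Longrightarrow> hs (sum f I)"
  by (induction I rule: infinite_finite_induct) (auto simp: hs_zero hs_add)

lemma csub_hs: "csub (Collect hs)"
  by (auto simp: csub_def hs_add hs_scaleC)

section \<open>The Hilbert-Schmidt inner product and norm\<close>

lemma abs_summable_prod:
  fixes f g :: "'b \<Rightarrow> complex"
  assumes "(\<lambda>x. (cmod (f x))\<^sup>2) summable_on A" "(\<lambda>x. (cmod (g x))\<^sup>2) summable_on A"
  shows "(\<lambda>x. norm (f x * g x)) summable_on A"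
proof (rule summable_on_comparison_test)
  show "(\<lambda>x. (cmod (f x))\<^sup>2 + (cmod (g x))\<^sup>2) summable_on A"
    by (rule summable_on_add[OF assms])
  show "cmod (f x * g x) \<le> (cmod (f x))\<^sup>2 + (cmod (g x))\<^sup>2" for x
    by (simp add: norm_mult mult_le_sum_squares)
qed auto

lemma hsi_summable:
  assumes "hs Y" "hs Z"
  shows "(\<lambda>e. norm (cinner (Y e) (Z e))) summable_on E"
proof (rule summable_on_comparison_test)
  show "(\<lambda>e. (norm (Y e))\<^sup>2 + (norm (Z e))\<^sup>2) summable_on E"
    using assms by (intro summable_on_add) (auto simp: hs_def)
  show "cmod (cinner (Y e) (Z e)) \<le> (norm (Y e))\<^sup>2 + (norm (Z e))\<^sup>2" for e
    by (rule order_trans[OF norm_cinner_le]) (simp add: mult_le_sum_squares)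
qed auto

lemma hsi_has_sum: "hs Y \<Longrightarrow> hs Z \<Longrightarrow> ((\<lambda>e. cinner (Y e) (Z e)) has_sum hsi Y Z) E"
  unfolding hsi_def by (rule has_sum_infsum) (rule abs_summable_summable[OF hsi_summable])

lemma hsi_eqI: "hs Y \<Longrightarrow> hs Z \<Longrightarrow> ((\<lambda>e. cinner (Y e) (Z e)) has_sum s) E \<Longrightarrow> hsi Y Z = s"
  using hsi_has_sum has_sum_unique by blast

lemma hsi_add_left: "hs X \<Longrightarrow> hs Y \<Longrightarrow> hs Z \<Longrightarrow> hsi (X + Y) Z = hsi X Z + hsi Y Z"
  using has_sum_add[OF hsi_has_sum hsi_has_sum, of X Z Y Z]
  by (intro hsi_eqI) (auto simp: hs_add blinfun.add_left cinner_simps)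

lemma hsi_scaleC_left: "hs X \<Longrightarrow> hs Y \<Longrightarrow> hsi (c *\<^sub>C X) Y = c * hsi X Y"
  using has_sum_cmult_right[OF hsi_has_sum, of X Y c]
  by (intro hsi_eqI) (auto simp: hs_scaleC cinner_simps)

lemma hsi_commute: "hs X \<Longrightarrow> hs Y \<Longrightarrow> hsi Y X = cnj (hsi X Y)"
  unfolding hsi_def infsum_cnj[symmetric] by (rule infsum_cong) (rule cinner_commute)

lemma hsn_sq: "hs Y \<Longrightarrow> ((\<lambda>e. (norm (Y e))\<^sup>2) has_sum (hsn Y)\<^sup>2) E"
  unfolding hsn_def
  by (subst real_sqrt_pow2) (auto intro!: infsum_nonneg simp: hs_def)

lemma hsi_self: "hs Y \<Longrightarrow> hsi Y Y = of_real ((hsn Y)\<^sup>2)"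
  by (rule hsi_eqI) (simp_all only: cinner_self has_sum_of_real hsn_sq)

lemma hsn_nonneg [simp]: "0 \<le> hsn Y"
  by (auto simp: hsn_def intro!: infsum_nonneg)

lemma psd_hsi: "psd_form (Collect hs) hsi"
  by (auto simp: psd_form_def hsi_add_left hsi_scaleC_left hsi_commute[symmetric] hsi_self
      simp del: of_real_power)

lemma hsi_add_right: "hs X \<Longrightarrow> hs Y \<Longrightarrow> hs Z \<Longrightarrow> hsi Z (X + Y) = hsi Z X + hsi Z Y"
  using psd_form_right[OF psd_hsi csub_hs] by simp

lemma hsi_scaleC_right: "hs X \<Longrightarrow> hs Y \<Longrightarrow> hsi X (c *\<^sub>C Y) = cnj c * hsi X Y"
  using psd_form_right[OF psd_hsi csub_hs] by simp

lemma uminus_scaleC: "- (Y::'a \<Rightarrow>\<^sub>L 'a) = (-1) *\<^sub>C Y"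
  by (rule blinfun_eqI) (simp add: blinfun.minus_left)

lemma hsi_diff_left: "hs X \<Longrightarrow> hs Y \<Longrightarrow> hs Z \<Longrightarrow> hsi (X - Y) Z = hsi X Z - hsi Y Z"
  using hsi_add_left[of X "- Y" Z] hsi_scaleC_left[of Y Z "-1"]
  by (simp add: hs_uminus flip: uminus_scaleC)

lemma hsi_diff_right: "hs X \<Longrightarrow> hs Y \<Longrightarrow> hs Z \<Longrightarrow> hsi Z (X - Y) = hsi Z X - hsi Z Y"
  using hsi_add_right[of X "- Y" Z] hsi_scaleC_right[of Z Y "-1"]
  by (simp add: hs_uminus flip: uminus_scaleC)

lemma norm_hsi_le:
  assumes "hs Y" "hs Z" shows "cmod (hsi Y Z) \<le> hsn Y * hsn Z"
proof -
  have "(cmod (hsi Y Z))\<^sup>2 \<le> (hsn Y * hsn Z)\<^sup>2"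
    using psd_form_cauchy_schwarz[OF psd_hsi csub_hs, of Y Z] assms
    by (simp add: hsi_self power_mult_distrib del: of_real_power)
  then show ?thesis by (rule power2_le_imp_le) simp
qed

lemma hsn_triangle:
  assumes "hs Y" "hs Z" shows "hsn (Y + Z) \<le> hsn Y + hsn Z"
proof -
  have "(hsn (Y + Z))\<^sup>2 = Re (hsi (Y + Z) (Y + Z))"
    unfolding hsi_self[OF hs_add[OF assms]] by simp
  also have "hsi (Y + Z) (Y + Z) = hsi Y Y + hsi Z Z + (hsi Y Z + cnj (hsi Y Z))"
    using assms by (simp add: hsi_add_left hsi_add_right hs_add hsi_commute[of Y Z])
  also have "Re \<dots> = (hsn Y)\<^sup>2 + (hsn Z)\<^sup>2 + 2 * Re (hsi Y Z)"
    unfolding hsi_self[OF assms(1)] hsi_self[OF assms(2)] by simp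
  also have "\<dots> \<le> (hsn Y)\<^sup>2 + (hsn Z)\<^sup>2 + 2 * (hsn Y * hsn Z)"
    using norm_hsi_le[OF assms] complex_Re_le_cmod[of "hsi Y Z"] by simp
  also have "\<dots> = (hsn Y + hsn Z)\<^sup>2" by (simp add: power2_eq_square algebra_simps)
  finally show ?thesis by (rule power2_le_imp_le) simp
qed

lemma hsn_bound:
  assumes "hs Y" "hs Z" "\<And>e. norm (Y e) \<le> c * norm (Z e)" "0 \<le> c"
  shows "hsn Y \<le> c * hsn Z"
proof -
  have "(hsn Y)\<^sup>2 \<le> c\<^sup>2 * (hsn Z)\<^sup>2"
  proof (rule has_sum_mono[OF hsn_sq[OF assms(1)] has_sum_cmult_right[OF hsn_sq[OF assms(2)]]])
    fix e show "(norm (Y e))\<^sup>2 \<le> c\<^sup>2 * (norm (Z e))\<^sup>2"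
      using assms(3)[of e] by (intro square_le_mult_square) auto
  qed
  then show ?thesis by (intro power2_le_imp_le[of "hsn Y"]) (use assms(4) in \<open>auto simp: power_mult_distrib\<close>)
qed

lemma hsn_compose_left: "clinear_op B \<Longrightarrow> hs Y \<Longrightarrow> hsn (B o\<^sub>L Y) \<le> norm B * hsn Y"
  by (rule hsn_bound) (auto simp: hs_compose_left norm_blinfun)

lemma hsn_scaleC: "hs Y \<Longrightarrow> hsn (c *\<^sub>C Y) \<le> cmod c * hsn Y"
  by (rule hsn_bound) (auto simp: hs_scaleC norm_scaleC)

text \<open>Both sides are the sum over all matrix entries; only the order of summation differs.\<close>

lemma hsi_adj:
  assumes Y: "hs Y" and Z: "hs Z"
  shows "hsi (adj Z) (adj Y) = hsi Y Z"
proof -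
  define g where "g e f = cinner (Y e) f * cinner f (Z e)" for e f
  note cY = hs_clinear[OF Y] and cZ = hs_clinear[OF Z]
  have "(\<lambda>(e, f). (cmod (cinner f (Z e)))\<^sup>2) summable_on E \<times> E"
    using matrix_summable[OF onb, of Z E] Z by (simp add: hs_def norm_cinner_commute)
  then have "(\<lambda>x. norm ((\<lambda>(e, f). g e f) x)) summable_on E \<times> E"
    using abs_summable_prod[of "\<lambda>(e, f). cinner (Y e) f" "E \<times> E" "\<lambda>(e, f). cinner f (Z e)"]
      matrix_summable[OF onb, of Y E] Y by (simp add: hs_def case_prod_unfold g_def)
  then have "infsum (\<lambda>e. infsum (g e) E) E = infsum (\<lambda>f. infsum (\<lambda>e. g e f) E) E"
    by (intro infsum_swap_banach) (rule abs_summable_summable)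
  moreover have "infsum (g e) E = cinner (Y e) (Z e)" for e
    unfolding g_def using parseval[OF onb] by (simp add: has_sum_iff)
  moreover have "infsum (\<lambda>e. g e f) E = cinner (adj Z f) (adj Y f)" for f
    using parseval[OF onb, of "adj Z f" "adj Y f"]
    by (simp add: g_def cinner_adj[OF cY] cinner_adj'[OF cZ] has_sum_iff mult.commute)
  ultimately show ?thesis by (simp add: hsi_def)
qed

lemma hsn_adj: "hs Y \<Longrightarrow> hsn (adj Y) = hsn Y"
proof -
  assume "hs Y"
  then have "complex_of_real ((hsn (adj Y))\<^sup>2) = of_real ((hsn Y)\<^sup>2)"
    using hsi_adj[of Y Y] by (simp add: hsi_self hs_adj del: of_real_power)
  then show ?thesis by (simp only: of_real_eq_iff) simp
qed

lemma hsn_compose_right: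
  assumes "clinear_op B" "hs Y" shows "hsn (Y o\<^sub>L B) \<le> hsn Y * norm B"
proof -
  have "hsn (Y o\<^sub>L B) = hsn (adj B o\<^sub>L adj Y)"
    using hsn_adj[OF hs_compose_right[OF assms]] assms by (simp add: adj_compose hs_clinear)
  also have "\<dots> \<le> norm B * hsn Y"
    using hsn_compose_left[of "adj B" "adj Y"] assms by (simp add: hs_adj norm_adj hsn_adj)
  finally show ?thesis by (simp add: mult.commute)
qed

lemma hsi_compose_left:
  assumes "clinear_op B" "hs Y" "hs Z"
  shows "hsi (B o\<^sub>L Y) Z = hsi Y (adj B o\<^sub>L Z)"
  using assms by (simp add: hsi_def cinner_adj)

lemma hsi_compose_right:
  assumes B: "clinear_op B" and Y: "hs Y" and Z: "hs Z"
  shows "hsi (Y o\<^sub>L B) Z = hsi Y (Z o\<^sub>L adj B)"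
proof -
  note c = B hs_clinear[OF Y] hs_clinear[OF Z]
  have "hsi (Y o\<^sub>L B) Z = hsi (adj Z) (adj B o\<^sub>L adj Y)"
    using hsi_adj[OF hs_compose_right[OF B Y] Z] c by (simp add: adj_compose)
  also have "\<dots> = hsi (B o\<^sub>L adj Z) (adj Y)"
    using hsi_compose_left[OF B hs_adj[OF Z] hs_adj[OF Y]] by simp
  also have "\<dots> = hsi Y (adj (B o\<^sub>L adj Z))"
    using hsi_adj[of "adj (B o\<^sub>L adj Z)" "adj (adj Y)"] hsi_adj[OF Y, of "adj (B o\<^sub>L adj Z)"] c
      hs_compose_left[OF B hs_adj[OF Z]] by (simp add: hs_adj)
  finally show ?thesis using c by (simp add: adj_compose)
qed

text \<open>The coordinate of \<open>adj T x\<close> at e is the inner product of x with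
  \<open>T e\<close>, hence at most \<open>norm (T e) * norm x\<close>; Parseval sums the
  squares.\<close>

lemma norm_le_hsn: assumes "hs T" shows "norm T \<le> hsn T"
proof -
  note c = hs_clinear[OF assms]
  have "norm (adj T) \<le> hsn T"
  proof (rule norm_blinfun_bound)
    fix x
    have "(norm (adj T x))\<^sup>2 \<le> (hsn T)\<^sup>2 * (norm x)\<^sup>2"
    proof (rule has_sum_mono[OF parseval_norm[OF onb] has_sum_cmult_left[OF hsn_sq[OF assms]]])
      fix e
      have "cmod (cinner (adj T x) e) \<le> norm (T e) * norm x"
        using norm_cinner_le[of x "T e"] by (simp add: cinner_adj'[OF c] mult.commute)
      then show "(cmod (cinner (adj T x) e))\<^sup>2 \<le> (norm (T e))\<^sup>2 * (norm x)\<^sup>2"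
        by (intro square_le_mult_square) auto
    qed
    then show "norm (adj T x) \<le> hsn T * norm x"
      by (intro power2_le_imp_le[of "norm (adj T x)"]) (auto simp: power_mult_distrib)
  qed simp
  then show ?thesis by (simp add: norm_adj[OF c])
qed

section \<open>Sums of products of Hilbert--Schmidt operators\<close>

text \<open>The second argument bounds the trace norm.\<close>

inductive nuc :: "('a \<Rightarrow>\<^sub>L 'a) \<Rightarrow> real \<Rightarrow> bool" where
  prod: "hs Y \<Longrightarrow> hs Z \<Longrightarrow> hsn Y * hsn Z \<le> b \<Longrightarrow> nuc (Y o\<^sub>L Z) b"
| add: "nuc S a \<Longrightarrow> nuc T b \<Longrightarrow> nuc (S + T) (a + b)"

definition tr :: "('a \<Rightarrow>\<^sub>L 'a) \<Rightarrow> complex" where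
  "tr T = (\<Sum>\<^sub>\<infinity>e\<in>E. cinner (T e) e)"

lemma nuc_nonneg: "nuc T b \<Longrightarrow> 0 \<le> b"
  by (induction rule: nuc.induct) (auto intro: order_trans[rotated])

lemma nuc_mono: "nuc T b \<Longrightarrow> b \<le> c \<Longrightarrow> nuc T c"
proof (induction arbitrary: c rule: nuc.induct)
  case (prod Y Z b)
  then show ?case by (intro nuc.prod) auto
next
  case (add S a T b)
  \<comment> \<open>All the slack is given to the second summand.\<close>
  from nuc.add[OF add.IH(1)[of a] add.IH(2)[of "c - a"]] add.prems show ?case by simp
qed

lemma nuc_zero: "nuc 0 0"
  using nuc.prod[OF hs_zero hs_zero, of 0] by (simp add: hsn_def)

lemma nuc_sum: "finite I \<Longrightarrow> (\<And>i. i \<in> I \<Longrightarrow> nuc (f i) (b i)) \<Longrightarrow> nuc (sum f I) (sum b I)"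
  by (induction I rule: finite_induct) (auto simp: nuc_zero intro: nuc.add)

lemma nuc_compose_left:
  assumes "nuc T b" "clinear_op B" shows "nuc (B o\<^sub>L T) (norm B * b)"
  using assms(1)
proof (induction rule: nuc.induct)
  case (prod Y Z b)
  have "hsn (B o\<^sub>L Y) * hsn Z \<le> norm B * hsn Y * hsn Z"
    using prod assms(2) by (intro mult_right_mono hsn_compose_left) auto
  also have "\<dots> \<le> norm B * b" using prod by (simp add: mult_left_mono mult.assoc)
  finally show ?case
    using nuc.prod[of "B o\<^sub>L Y" Z] prod assms(2) by (simp add: hs_compose_left compose_assoc)
next
  case (add S a T b)
  then show ?case using nuc.add by (simp add: compose_simps distrib_left)
qed

lemma nuc_compose_right:
  assumes "nuc T b" "clinear_op B" shows "nuc (T o\<^sub>L B) (b * norm B)"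
  using assms(1)
proof (induction rule: nuc.induct)
  case (prod Y Z b)
  have "hsn Y * hsn (Z o\<^sub>L B) \<le> hsn Y * (hsn Z * norm B)"
    using prod assms(2) by (intro mult_left_mono hsn_compose_right) auto
  also have "\<dots> \<le> b * norm B" using prod by (simp add: mult_right_mono flip: mult.assoc)
  finally show ?case
    using nuc.prod[of Y "Z o\<^sub>L B"] prod assms(2) by (simp add: hs_compose_right compose_assoc)
next
  case (add S a T b)
  then show ?case using nuc.add by (simp add: compose_simps distrib_right)
qed

lemma nuc_scaleC: "nuc T b \<Longrightarrow> nuc (c *\<^sub>C T) (cmod c * b)"
proof (induction rule: nuc.induct)
  case (prod Y Z b)
  have "hsn (c *\<^sub>C Y) * hsn Z \<le> cmod c * hsn Y * hsn Z"
    using prod by (intro mult_right_mono hsn_scaleC) auto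
  also have "\<dots> \<le> cmod c * b" using prod by (simp add: mult_left_mono mult.assoc)
  finally show ?case using nuc.prod[of "c *\<^sub>C Y" Z] prod by (simp add: hs_scaleC compose_scaleC)
next
  case (add S a T b)
  have "c *\<^sub>C (S + T) = c *\<^sub>C S + c *\<^sub>C T"
    by (rule blinfun_eqI) (simp add: blinfun.add_left scaleC.add_right)
  then show ?case using add nuc.add by (simp add: distrib_left)
qed

lemma tr_prod_has_sum:
  assumes "hs Y" "hs Z"
  shows "((\<lambda>e. cinner ((Y o\<^sub>L Z) e) e) has_sum hsi Z (adj Y)) E"
  using hsi_has_sum[OF assms(2) hs_adj[OF assms(1)]] assms by (simp add: cinner_adj hs_clinear)

lemma tr_prod: "hs Y \<Longrightarrow> hs Z \<Longrightarrow> tr (Y o\<^sub>L Z) = hsi Z (adj Y)"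
  using tr_prod_has_sum by (simp add: tr_def has_sum_iff)

lemma nuc_tr_summable: "nuc T b \<Longrightarrow> (\<lambda>e. cinner (T e) e) summable_on E"
proof (induction rule: nuc.induct)
  case (prod Y Z b)
  then show ?case using tr_prod_has_sum has_sum_iff by blast
next
  case (add S a T b)
  then show ?case using summable_on_add by (simp add: blinfun.add_left cinner_simps)
qed

lemma tr_add: "nuc S a \<Longrightarrow> nuc T b \<Longrightarrow> tr (S + T) = tr S + tr T"
  unfolding tr_def using infsum_add[OF nuc_tr_summable nuc_tr_summable, of S a T b]
  by (simp add: blinfun.add_left cinner_simps)

lemma tr_scaleC: "tr (c *\<^sub>C T) = c * tr T"
  by (simp add: tr_def cinner_simps infsum_cmult_right')

lemma tr_zero: "tr 0 = 0"
  by (simp add: tr_def cinner_simps)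

lemma tr_sum:
  "finite I \<Longrightarrow> (\<And>i. i \<in> I \<Longrightarrow> nuc (f i) (b i)) \<Longrightarrow> tr (sum f I) = (\<Sum>i\<in>I. tr (f i))"
proof (induction I rule: finite_induct)
  case (insert i I)
  then show ?case using tr_add[of "f i" "b i" "sum f I" "sum b I"] by (simp add: nuc_sum)
qed (simp add: tr_zero)

lemma norm_tr_le: "nuc T b \<Longrightarrow> cmod (tr T) \<le> b"
proof (induction rule: nuc.induct)
  case (prod Y Z b)
  have "cmod (tr (Y o\<^sub>L Z)) \<le> hsn Z * hsn Y"
    using prod norm_hsi_le[of Z "adj Y"] by (simp add: tr_prod hs_adj hsn_adj)
  then show ?case using prod by (simp add: mult.commute)
next
  case (add S a T b)
  then show ?case using tr_add[of S a T b] norm_triangle_ineq[of "tr S" "tr T"] by simp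
qed

text \<open>Cyclicity of the trace: by \<open>tr_prod\<close> the right-hand side is the trace of
  \<open>Z o\<^sub>L Y\<close>.\<close>

lemma tr_prod_commute:
  assumes "hs Y" "hs Z" shows "tr (Y o\<^sub>L Z) = hsi Y (adj Z)"
  using hsi_adj[OF hs_adj[OF assms(2)] assms(1)] hsi_adj[OF assms(2) hs_adj[OF assms(1)]]
    hsi_adj[of "adj Z" "adj Y"] assms hs_adj hs_clinear
  by (simp add: tr_prod)

section \<open>Summability along orthogonal families\<close>

lemma has_sum_sum:
  fixes f :: "'b \<Rightarrow> 'c \<Rightarrow> 'd::{topological_comm_monoid_add, t2_space}"
  assumes "finite F" "\<And>i. (f i has_sum s i) A"
  shows "((\<lambda>e. \<Sum>i\<in>F. f i e) has_sum (\<Sum>i\<in>F. s i)) A"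
  using assms(1) by (induction F rule: finite_induct) (auto intro: has_sum_add assms(2))

text \<open>Expanding each \<open>W (v i)\<close> in the basis and exchanging sums, Bessel for
  \<open>adj W e\<close> bounds every finite partial sum by the squared Hilbert-Schmidt
  norm.\<close>

lemma hs_ortho_family_summable:
  assumes v: "ortho_family I v" and W: "hs W"
  shows "(\<lambda>i. (norm (W (v i)))\<^sup>2) summable_on I"
proof (rule nonneg_bdd_above_summable_on)
  have "(\<Sum>i\<in>F. (norm (W (v i)))\<^sup>2) \<le> (hsn W)\<^sup>2" if F: "finite F" "F \<subseteq> I" for F
  proof -
    have "((\<lambda>e. \<Sum>i\<in>F. (cmod (cinner (W (v i)) e))\<^sup>2) has_sum (\<Sum>i\<in>F. (norm (W (v i)))\<^sup>2)) E"
      using F(1) parseval_norm[OF onb] by (intro has_sum_sum)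
    moreover have "((\<lambda>e. (norm (adj W e))\<^sup>2) has_sum (hsn W)\<^sup>2) E"
      using hsn_sq[OF hs_adj[OF W]] by (simp add: hsn_adj[OF W])
    ultimately show ?thesis
    proof (rule has_sum_mono)
      fix e
      show "(\<Sum>i\<in>F. (cmod (cinner (W (v i)) e))\<^sup>2) \<le> (norm (adj W e))\<^sup>2"
        using bessel_finite[OF v F, of "adj W e"] by (simp add: cinner_adj hs_clinear[OF W])
    qed
  qed
  then show "bdd_above (sum (\<lambda>i. (norm (W (v i)))\<^sup>2) ` {F. F \<subseteq> I \<and> finite F})"
    by (auto intro!: bdd_aboveI)
qed auto

text \<open>For a suitable pair of families this sum is the trace norm; see
  \<open>nuc_trace_class\<close>.\<close>

lemma nuc_ortho_family_summable:
  assumes v: "ortho_family I v" and w: "ortho_family I w" and "nuc T b"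
  shows "(\<lambda>i. norm (cinner (T (v i)) (w i))) summable_on I"
  using assms(3)
proof (induction rule: nuc.induct)
  case (prod Y Z b)
  show ?case
  proof (rule summable_on_comparison_test)
    show "(\<lambda>i. (norm (Z (v i)))\<^sup>2 + (norm (adj Y (w i)))\<^sup>2) summable_on I"
      using prod by (intro summable_on_add hs_ortho_family_summable v w hs_adj)
    fix i
    have "cmod (cinner ((Y o\<^sub>L Z) (v i)) (w i)) \<le> norm (Z (v i)) * norm (adj Y (w i))"
      using norm_cinner_le[of "Z (v i)" "adj Y (w i)"] prod by (simp add: cinner_adj hs_clinear)
    also have "\<dots> \<le> (norm (Z (v i)))\<^sup>2 + (norm (adj Y (w i)))\<^sup>2"
      by (simp add: mult_le_sum_squares)
    finally show "cmod (cinner ((Y o\<^sub>L Z) (v i)) (w i)) \<le> (norm (Z (v i)))\<^sup>2 + (norm (adj Y (w i)))\<^sup>2" .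
  qed auto
next
  case (add S a T b)
  show ?case
  proof (rule summable_on_comparison_test)
    show "(\<lambda>i. cmod (cinner (S (v i)) (w i)) + cmod (cinner (T (v i)) (w i))) summable_on I"
      by (rule summable_on_add[OF add.IH])
  qed (auto simp: blinfun.add_left cinner_simps norm_triangle_ineq)
qed

end

section \<open>The absolute value of a Hilbert--Schmidt operator\<close>

text \<open>Supplies the compact set that contains the image of the unit ball under a finite rank
  truncation.\<close>

lemma compact_bounded_combinations:
  fixes w :: "'b \<Rightarrow> 'a::chilbert_space"
  assumes "finite F"
  shows "\<exists>K. compact K \<and> (\<forall>c. (\<forall>e. cmod (c e) \<le> r) \<longrightarrow> (\<Sum>e\<in>F. c e *\<^sub>C w e) \<in> K)"
  using assms
proof (induction F rule: finite_induct)
  case empty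
  then show ?case by (auto intro!: exI[of _ "{0}"])
next
  case (insert e F)
  then obtain K where K: "compact K" "\<And>c. (\<And>e. cmod (c e) \<le> r) \<Longrightarrow> (\<Sum>e\<in>F. c e *\<^sub>C w e) \<in> K"
    by blast
  define K' where "K' = (\<lambda>(c, x). c *\<^sub>C w e + x) ` (cball 0 r \<times> K)"
  have "compact K'"
    unfolding K'_def case_prod_unfold
    by (intro compact_continuous_image compact_Times K compact_cball continuous_on_add
        scaleC.continuous_on continuous_intros)
  moreover have "(\<Sum>e'\<in>insert e F. c e' *\<^sub>C w e') \<in> K'" if "\<And>e. cmod (c e) \<le> r" for c
  proof -
    have "(c e, \<Sum>e'\<in>F. c e' *\<^sub>C w e') \<in> cball 0 r \<times> K"
      using K(2)[OF that] that[of e] by simp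
    then show ?thesis
      unfolding K'_def using insert by (auto intro!: image_eqI)
  qed
  ultimately show ?case by blast
qed

lemma onb_norm: "is_onb E \<Longrightarrow> e \<in> E \<Longrightarrow> norm e = 1"
  by (simp add: is_onb_def norm_eq_sqrt_inner inner_eq_Re_cinner)

context hilbert_basis
begin

section \<open>Finite rank truncations and compactness\<close>

definition proj :: "'a set \<Rightarrow> 'a \<Rightarrow>\<^sub>L 'a" where
  "proj F = Blinfun (\<lambda>x. \<Sum>e\<in>F. cinner x e *\<^sub>C e)"

lemma proj_apply: "proj F x = (\<Sum>e\<in>F. cinner x e *\<^sub>C e)"
proof -
  have "bounded_linear (\<lambda>x. \<Sum>e\<in>F. cinner x e *\<^sub>C e)"
    by (intro bounded_linear_sum bounded_linear_compose[OF scaleC.bounded_linear_left]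
        cinner.bounded_linear_left)
  then show ?thesis by (simp add: proj_def bounded_linear_Blinfun_apply)
qed

lemma clinear_proj: "clinear_op (proj F)"
  by (simp add: clinear_op_def proj_apply cinner_simps cvec.scale_sum_right)

lemma proj_onb:
  assumes "F \<subseteq> E" "finite F" "e \<in> E"
  shows "proj F e = (if e \<in> F then e else 0)"
proof -
  have "proj F e = (\<Sum>f\<in>F. if e = f then e else 0)"
    unfolding proj_apply using assms cinner_onb[OF onb]
    by (intro sum.cong) (auto simp: scaleC_one)
  then show ?thesis using assms by simp
qed

text \<open>On the basis the error is 0 inside F and \<open>T e\<close> outside, so its squared norm
  is exactly the tail of the series for \<open>hsn T\<close>.\<close>

lemma hs_finite_rank_approx:
  assumes T: "hs T" and "\<epsilon> > 0"
  shows "\<exists>F. finite F \<and> F \<subseteq> E \<and> hsn (T - (T o\<^sub>L proj F)) < \<epsilon>"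
proof -
  have "(sum (\<lambda>e. (norm (T e))\<^sup>2) \<longlongrightarrow> (hsn T)\<^sup>2) (finite_subsets_at_top E)"
    using hsn_sq[OF T] by (simp add: has_sum_def)
  then have "\<forall>\<^sub>F F in finite_subsets_at_top E. dist (\<Sum>e\<in>F. (norm (T e))\<^sup>2) ((hsn T)\<^sup>2) < \<epsilon>\<^sup>2"
    using assms(2) by (intro tendstoD) auto
  then obtain F where F: "finite F" "F \<subseteq> E" "dist (\<Sum>e\<in>F. (norm (T e))\<^sup>2) ((hsn T)\<^sup>2) < \<epsilon>\<^sup>2"
    unfolding eventually_finite_subsets_at_top by blast
  define D where "D = T - (T o\<^sub>L proj F)"
  have D: "hs D" unfolding D_def using T by (intro hs_diff hs_compose_right clinear_proj)
  have De: "norm (D e) = (if e \<in> F then 0 else norm (T e))" if "e \<in> E" for e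
    unfolding D_def blinfun.diff_left blinfun_apply_blinfun_compose proj_onb[OF F(2,1) that]
    by simp
  have "((\<lambda>e. (norm (D e))\<^sup>2 + (if e \<in> F then (norm (T e))\<^sup>2 else 0)) has_sum
      ((hsn D)\<^sup>2 + (\<Sum>e\<in>F. (norm (T e))\<^sup>2))) E"
    by (intro has_sum_add hsn_sq[OF D] has_sum_finite_neutralI[of F]) (use F in auto)
  moreover have "((\<lambda>e. (norm (D e))\<^sup>2 + (if e \<in> F then (norm (T e))\<^sup>2 else 0)) has_sum (hsn T)\<^sup>2) E"
    using hsn_sq[OF T] by (rule has_sum_cong[THEN iffD1, rotated]) (simp add: De)
  ultimately have "(hsn D)\<^sup>2 + (\<Sum>e\<in>F. (norm (T e))\<^sup>2) = (hsn T)\<^sup>2"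
    by (rule has_sum_unique)
  then have "(hsn D)\<^sup>2 < \<epsilon>\<^sup>2" using F(3) by (simp add: dist_real_def)
  then have "hsn D < \<epsilon>" by (rule power2_less_imp_less) (use assms in simp)
  then show ?thesis using F D_def by blast
qed

text \<open>The operator norm is dominated by the Hilbert-Schmidt norm, so T is a norm limit of
  finite rank truncations, and total boundedness survives such limits.\<close>

lemma hs_compact:
  assumes T: "hs T"
  shows "compact (closure (T ` cball 0 1))"
  unfolding compact_eq_totally_bounded
proof safe
  show "complete (closure (T ` cball 0 1))"
    by (simp add: complete_eq_closed)
next
  fix \<epsilon> :: real assume "\<epsilon> > 0"
  then obtain F where F: "finite F" "F \<subseteq> E" and small: "hsn (T - (T o\<^sub>L proj F)) < \<epsilon> / 3"
    using hs_finite_rank_approx[OF T, of "\<epsilon> / 3"] by auto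
  obtain K where K: "compact K"
    "\<And>c. (\<And>e. cmod (c e) \<le> 1) \<Longrightarrow> (\<Sum>e\<in>F. c e *\<^sub>C T e) \<in> K"
    using compact_bounded_combinations[OF F(1), of 1 "\<lambda>e. T e"] by blast
  obtain k where k: "finite k" "K \<subseteq> (\<Union>x\<in>k. ball x (\<epsilon> / 3))"
    using K(1) \<open>\<epsilon> > 0\<close> unfolding compact_eq_totally_bounded by (meson divide_pos_pos zero_less_numeral)
  \<comment> \<open>Closed balls, so that the cover passes to the closure; radius 2/3 keeps them
    inside open balls of radius \<epsilon>.\<close>
  have "T ` cball 0 1 \<subseteq> (\<Union>x\<in>k. cball x (2 * \<epsilon> / 3))"
  proof safe
    fix x :: 'a assume x: "x \<in> cball 0 1"
    define c where "c e = (if e \<in> F then cinner x e else 0)" for e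
    have "cmod (c e) \<le> 1" for e
      using norm_cinner_le[of x e] x F onb_norm[OF onb, of e] by (auto simp: c_def)
    then have "(\<Sum>e\<in>F. c e *\<^sub>C T e) \<in> K" by (rule K(2))
    moreover have "(\<Sum>e\<in>F. c e *\<^sub>C T e) = (T o\<^sub>L proj F) x"
      by (simp add: proj_apply c_def blinfun.sum_right clinear_opD[OF hs_clinear[OF T]])
    ultimately have "(T o\<^sub>L proj F) x \<in> K" by simp
    from subsetD[OF k(2) this] obtain y where y: "y \<in> k" "dist y ((T o\<^sub>L proj F) x) < \<epsilon> / 3"
      by (auto simp del: blinfun_apply_blinfun_compose)
    have "dist (T x) ((T o\<^sub>L proj F) x) \<le> norm (T - (T o\<^sub>L proj F)) * norm x"
      using norm_blinfun[of "T - (T o\<^sub>L proj F)" x] by (simp add: dist_norm blinfun.diff_left)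
    also have "\<dots> \<le> hsn (T - (T o\<^sub>L proj F)) * 1"
      using x by (intro mult_mono norm_le_hsn hs_diff T hs_compose_right clinear_proj) auto
    finally have "dist y (T x) \<le> 2 * \<epsilon> / 3"
      using y(2) small dist_triangle[of y "T x" "(T o\<^sub>L proj F) x"] by (simp add: dist_commute)
    then show "T x \<in> (\<Union>x\<in>k. cball x (2 * \<epsilon> / 3))" using y(1) by auto
  qed
  then have "closure (T ` cball 0 1) \<subseteq> (\<Union>x\<in>k. cball x (2 * \<epsilon> / 3))"
    using k(1) by (intro closure_minimal closed_UN) auto
  also have "\<dots> \<subseteq> (\<Union>x\<in>k. ball x \<epsilon>)"
    using \<open>\<epsilon> > 0\<close> by (intro UN_mono) auto
  finally show "\<exists>k. finite k \<and> closure (T ` cball 0 1) \<subseteq> (\<Union>x\<in>k. ball x \<epsilon>)"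
    using k(1) by blast
qed

section \<open>Diagonalisation of \<open>adj T o\<^sub>L T\<close> and its positive square
  root\<close>

lemma cinner_gram: "clinear_op T \<Longrightarrow> cinner ((adj T o\<^sub>L T) x) y = cinner (T x) (T (y::'a))"
  by (simp add: cinner_adj')

text \<open>The eigenvector is a limit of vectors that maximise \<open>norm (T x)\<close> on the unit sphere of \<open>M\<close>.\<close>

lemma gram_eigenvector:
  assumes T: "hs T" and M: "subspace M" "closed M" and inv: "\<And>x. x \<in> M \<Longrightarrow> (adj T o\<^sub>L T) x \<in> M"
    and ne: "x0 \<in> M" "x0 \<noteq> 0"
  shows "\<exists>x\<in>M. norm x = 1 \<and> (\<exists>\<mu>::real. (adj T o\<^sub>L T) x = \<mu> *\<^sub>R x)"
proof -
  note cT = hs_clinear[OF T]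
  define G where "G = adj T o\<^sub>L T"
  define S where "S = (\<lambda>x. norm (T x)) ` {x \<in> M. norm x = 1}"
  define s where "s = Sup S"
  have u0: "x0 /\<^sub>R norm x0 \<in> {x \<in> M. norm x = 1}"
    using ne M(1) by (auto intro: subspace_scale)
  then have Sne: "S \<noteq> {}" by (auto simp: S_def)
  have "bdd_above S"
  proof (rule bdd_aboveI)
    fix t assume "t \<in> S"
    then obtain x where "t = norm (T x)" "norm x = 1" by (auto simp: S_def)
    then show "t \<le> norm T" using norm_blinfun[of T x] by simp
  qed
  then have leS: "norm (T x) \<le> s" if "x \<in> M" "norm x = 1" for x
    unfolding s_def using that by (intro cSup_upper) (auto simp: S_def)
  have s0: "s \<ge> 0" using leS[of "x0 /\<^sub>R norm x0"] u0 norm_ge_zero order_trans by blast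
  have le: "norm (T x) \<le> s * norm x" if "x \<in> M" for x
  proof (cases "x = 0")
    case False
    then have "norm (T (x /\<^sub>R norm x)) \<le> s"
      using that M(1) by (intro leS) (auto intro: subspace_scale)
    with False show ?thesis by (simp add: blinfun.scaleR_right field_simps)
  qed (use s0 in auto)
  have leG: "norm (G x) \<le> s\<^sup>2" if "x \<in> M" "norm x = 1" for x
  proof -
    have "(norm (G x))\<^sup>2 = cmod (cinner (T x) (T (G x)))"
      using arg_cong[OF cinner_gram[OF cT, of x "G x"], of cmod]
      by (simp add: G_def[symmetric] cinner_self del: of_real_power blinfun_apply_blinfun_compose)
    also have "\<dots> \<le> norm (T x) * norm (T (G x))" by (rule norm_cinner_le)
    also have "\<dots> \<le> s * (s * norm (G x))"
      using leS[OF that] le[OF inv[OF that(1)]] s0 by (intro mult_mono) (auto simp: G_def)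
    finally show ?thesis by (cases "G x = 0") (auto simp: power2_eq_square)
  qed
  \<comment> \<open>Expanding the square shows that unit vectors almost maximising
    \<open>norm (T x)\<close> are almost eigenvectors for s^2.\<close>
  have GT: "(norm (G x - s\<^sup>2 *\<^sub>R x))\<^sup>2 \<le> 2 * s\<^sup>2 * (s\<^sup>2 - (norm (T x))\<^sup>2)" if "x \<in> M" "norm x = 1" for x
  proof -
    have "Re (cinner (G x) (s\<^sup>2 *\<^sub>R x)) = s\<^sup>2 * (norm (T x))\<^sup>2"
      using cinner_gram[OF cT, of x x] by (simp add: G_def[symmetric] cinner_self cinner_simps flip: of_real_power of_real_mult)
    moreover have "(norm (G x))\<^sup>2 \<le> (s\<^sup>2)\<^sup>2"
      using leG[OF that] by (intro power_mono) auto
    ultimately show ?thesis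
      unfolding norm_diff_sq using that(2) by (simp add: power2_eq_square algebra_simps)
  qed
  show ?thesis
  proof (cases "s = 0")
    case True
    have "T x = 0" if "x \<in> M" for x using le[OF that] True by simp
    then show ?thesis using u0 by (intro bexI[of _ "x0 /\<^sub>R norm x0"]) (auto intro!: exI[of _ 0])
  next
    case False
    then have "s > 0" using s0 by simp
    have "\<exists>x. x \<in> M \<and> norm x = 1 \<and> s - 1 / real (Suc n) < norm (T x)" for n
      using less_cSupD[OF Sne, of "s - 1 / real (Suc n)"] unfolding s_def S_def by auto
    then obtain x where x: "\<And>n. x n \<in> M" "\<And>n. norm (x n) = 1"
      and xs: "\<And>n. s - 1 / real (Suc n) < norm (T (x n))" by metis
    have lim: "(\<lambda>n. s - 1 / real (Suc n)) \<longlonglongrightarrow> s - 0"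
      by (intro tendsto_intros LIMSEQ_Suc[OF lim_1_over_n])
    have "(\<lambda>n. norm (T (x n))) \<longlonglongrightarrow> s"
      by (rule tendsto_sandwich[of "\<lambda>n. s - 1 / real (Suc n)" _ _ "\<lambda>_. s"])
        (use xs leS x lim in \<open>auto simp: less_imp_le\<close>)
    then have lim2: "(\<lambda>n. 2 * s\<^sup>2 * (s\<^sup>2 - (norm (T (x n)))\<^sup>2)) \<longlonglongrightarrow> 2 * s\<^sup>2 * (s\<^sup>2 - s\<^sup>2)"
      by (intro tendsto_intros)
    have "(\<lambda>n. (norm (G (x n) - s\<^sup>2 *\<^sub>R x n))\<^sup>2) \<longlonglongrightarrow> 0"
      by (rule tendsto_sandwich[of "\<lambda>n. 0" "\<lambda>n. (norm (G (x n) - s\<^sup>2 *\<^sub>R x n))\<^sup>2"])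
        (use GT x lim2 in auto)
    then have "(\<lambda>n. sqrt ((norm (G (x n) - s\<^sup>2 *\<^sub>R x n))\<^sup>2)) \<longlonglongrightarrow> sqrt 0"
      by (rule tendsto_real_sqrt)
    then have dif: "(\<lambda>n. G (x n) - s\<^sup>2 *\<^sub>R x n) \<longlonglongrightarrow> 0"
      by (simp add: tendsto_norm_zero_iff)
    have "T (x n) \<in> closure (T ` cball 0 1)" for n
      using x(2)[of n] by (intro closure_subset[THEN subsetD] imageI) simp
    then obtain y r where r: "strict_mono (r :: nat \<Rightarrow> nat)" "((\<lambda>n. T (x n)) \<circ> r) \<longlonglongrightarrow> y"
      using hs_compact[OF T] unfolding compact_def by metis
    \<comment> \<open>Compactness gives convergence of \<open>T (x n)\<close> only, hence of
      \<open>G (x n)\<close> along the subsequence; since G x - s^2 x tends to 0 and s > 0, the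
      vectors themselves converge, to this z.\<close>
    define z where "z = adj T y /\<^sub>R s\<^sup>2"
    have Gx: "(\<lambda>n. G (x (r n))) \<longlonglongrightarrow> adj T y"
      using r(2) unfolding G_def by (auto simp: o_def intro!: tendsto_intros)
    have "(\<lambda>n. (G (x (r n)) - (G (x (r n)) - s\<^sup>2 *\<^sub>R x (r n))) /\<^sub>R s\<^sup>2) \<longlonglongrightarrow> (adj T y - 0) /\<^sub>R s\<^sup>2"
      by (intro tendsto_intros Gx LIMSEQ_subseq_LIMSEQ[OF dif r(1), unfolded o_def])
    then have xz: "(\<lambda>n. x (r n)) \<longlonglongrightarrow> z"
      using \<open>s > 0\<close> by (simp add: z_def)
    have "z \<in> M" by (rule closed_sequentially[OF M(2) x(1) xz])
    moreover have "norm z = 1"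
      using LIMSEQ_unique[OF tendsto_norm[OF xz, unfolded x(2)] tendsto_const] by simp
    moreover have "G z = s\<^sup>2 *\<^sub>R z"
    proof -
      have "(\<lambda>n. G (x (r n))) \<longlonglongrightarrow> G z" by (intro tendsto_intros xz)
      then have "G z = adj T y" using Gx LIMSEQ_unique by blast
      then show ?thesis using \<open>s > 0\<close> by (simp add: z_def)
    qed
    ultimately show ?thesis unfolding G_def by blast
  qed
qed

text \<open>Zorn's lemma on orthonormal sets of eigenvectors. The orthogonal complement of a maximal
  one is closed and invariant, the eigenvalues being real and G symmetric; were it nonzero,
  \<open>gram_eigenvector\<close> would enlarge the set. The kernel is included, with eigenvalue
  0.\<close>

lemma gram_eigenbasis:
  assumes T: "hs T"
  shows "\<exists>B. is_onb B \<and> (\<forall>b\<in>B. (adj T o\<^sub>L T) b = (norm (T b))\<^sup>2 *\<^sub>R b)"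
proof -
  note cT = hs_clinear[OF T]
  define G where "G = adj T o\<^sub>L T"
  define \<A> where "\<A> = {B. (\<forall>e\<in>B. \<forall>f\<in>B. cinner e f = (if e = f then 1 else 0)) \<and>
    (\<forall>b\<in>B. \<exists>\<mu>::real. G b = \<mu> *\<^sub>R b)}"
  have "\<exists>B\<in>\<A>. \<forall>X\<in>\<A>. B \<subseteq> X \<longrightarrow> X = B"
  proof (rule subset_Zorn')
    fix C assume C: "subset.chain \<A> C"
    have "cinner e f = (if e = f then 1 else 0)" if "e \<in> \<Union>C" "f \<in> \<Union>C" for e f
    proof -
      from that obtain X Y where XY: "X \<in> C" "e \<in> X" "Y \<in> C" "f \<in> Y" by auto
      with C have "X \<subseteq> Y \<or> Y \<subseteq> X" and "X \<in> \<A>" "Y \<in> \<A>"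
        by (auto simp: subset.chain_def)
      then show ?thesis using XY unfolding \<A>_def by blast
    qed
    moreover have "\<exists>\<mu>::real. G b = \<mu> *\<^sub>R b" if "b \<in> \<Union>C" for b
      using that C unfolding subset.chain_def \<A>_def by blast
    ultimately show "\<Union>C \<in> \<A>" unfolding \<A>_def by blast
  qed
  then obtain B where B: "B \<in> \<A>" and max: "\<And>X. X \<in> \<A> \<Longrightarrow> B \<subseteq> X \<Longrightarrow> X = B" by blast
  have orth: "\<forall>e\<in>B. \<forall>f\<in>B. cinner e f = (if e = f then 1 else 0)"
    and eig: "\<And>b. b \<in> B \<Longrightarrow> \<exists>\<mu>::real. G b = \<mu> *\<^sub>R b"
    using B by (auto simp: \<A>_def)
  define M where "M = {x. \<forall>b\<in>B. cinner x b = 0}"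
  have sub: "subspace M"
    by (auto simp: subspace_def M_def cinner_simps)
  have "M = (\<Inter>b\<in>B. {x. cinner x b = 0})" by (auto simp: M_def)
  then have cl: "closed M"
    by (auto intro!: closed_INT closed_Collect_eq cinner.continuous_on continuous_intros)
  have inv: "G x \<in> M" if "x \<in> M" for x
  proof -
    have "cinner (G x) b = 0" if b: "b \<in> B" for b
    proof -
      obtain l :: real where "G b = l *\<^sub>R b" using eig[OF b] by blast
      moreover have "cinner (G x) b = cinner x (G b)"
        using cT by (simp add: G_def cinner_adj cinner_adj')
      ultimately show ?thesis using \<open>x \<in> M\<close> b by (simp add: M_def cinner_simps)
    qed
    then show ?thesis by (simp add: M_def)
  qed
  have "x = 0" if "\<And>b. b \<in> B \<Longrightarrow> cinner x b = 0" for x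
  proof (rule ccontr)
    assume "x \<noteq> 0"
    moreover have "x \<in> M" using that by (simp add: M_def)
    ultimately obtain z where z: "z \<in> M" "norm z = 1" "\<exists>\<mu>::real. G z = \<mu> *\<^sub>R z"
      using gram_eigenvector[OF T sub cl inv[unfolded G_def]] unfolding G_def by blast
    have zb: "cinner z b = 0" "cinner b z = 0" if "b \<in> B" for b
      using z(1) that cinner_commute[of b z] by (auto simp: M_def)
    have zz: "cinner z z = 1" using z(2) by (simp add: cinner_self)
    then have zB: "z \<notin> B" using zb(1)[of z] by auto
    have "\<forall>e\<in>insert z B. \<forall>f\<in>insert z B. cinner e f = (if e = f then 1 else 0)"
      using orth zb zz zB by auto
    then have "insert z B \<in> \<A>"
      using eig z(3) unfolding \<A>_def by blast
    then show False using max[of "insert z B"] zB by blast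
  qed
  then have "is_onb B" by (rule ortho_complement_trivial_imp_onb[OF orth])
  moreover have "G b = (norm (T b))\<^sup>2 *\<^sub>R b" if b: "b \<in> B" for b
  proof -
    obtain l :: real where l: "G b = l *\<^sub>R b" using eig[OF b] by blast
    have "complex_of_real l = cinner (G b) b" using orth b by (simp add: l cinner_simps)
    also have "\<dots> = of_real ((norm (T b))\<^sup>2)"
      unfolding G_def cinner_gram[OF cT] by (rule cinner_self)
    finally show ?thesis using l by (simp only: of_real_eq_iff)
  qed
  ultimately show ?thesis unfolding G_def by blast
qed

text \<open>This yields uniqueness of the positive square root: on an eigenvector of the square, a
  positive root has no choice.\<close>

lemma positive_sqrt_eigenvector:
  assumes Q: "positive_op Q" and eq: "Q (Q b) = s\<^sup>2 *\<^sub>R b" and s: "0 \<le> s"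
  shows "Q b = s *\<^sub>R (b::'a)"
proof (cases "s = 0")
  case True
  define v where "v = Q b"
  have Qv: "Q v = 0" using eq True by (simp add: v_def)
  \<comment> \<open>For v \<noteq> 0 this t makes Re (cinner v b) - t * |v|^2 at most -1, against
    positivity at b - t v.\<close>
  define t where "t = (\<bar>Re (cinner v b)\<bar> + 1) / (norm v)\<^sup>2"
  have "cinner (Q (b - t *\<^sub>R v)) (b - t *\<^sub>R v) \<in> \<real>\<^sub>\<ge>\<^sub>0"
    using Q by (simp add: positive_op_def)
  then have "0 \<le> Re (cinner v b) - t * (norm v)\<^sup>2"
    by (simp add: blinfun.bilinear_simps Qv flip: v_def)
      (simp add: cinner_simps cinner_self complex_nonneg_Reals_iff del: of_real_power)
  then have "v = 0" unfolding t_def by (cases "v = 0") auto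
  then show ?thesis using True by (simp add: v_def)
next
  case False
  \<comment> \<open>Q^2 - s^2 factors, so v is annihilated by Q + s; positivity of Q excludes the
    eigenvalue -s.\<close>
  define v where "v = Q b - s *\<^sub>R b"
  have "Q v = - s *\<^sub>R v"
    by (simp add: v_def blinfun.bilinear_simps eq power2_eq_square scaleR_diff_right)
  then have "cinner (- s *\<^sub>R v) v \<in> \<real>\<^sub>\<ge>\<^sub>0"
    using Q unfolding positive_op_def by metis
  then have "s * (norm v)\<^sup>2 \<le> 0"
    by (simp add: cinner_simps cinner_self complex_nonneg_Reals_iff)
  then have "v = 0" using s False by (simp add: mult_le_0_iff)
  then show ?thesis by (simp add: v_def)
qed

text \<open>The root is constructed as a diagonal operator from its coordinates. As
  \<open>abs_op\<close> is a definite description, its value is known only after uniqueness has been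
  proved as well.\<close>

lemma abs_op_eigenbasis:
  assumes T: "clinear_op T" and B: "is_onb (B::'a set)"
    and eig: "\<And>b. b \<in> B \<Longrightarrow> (adj T o\<^sub>L T) b = (norm (T b))\<^sup>2 *\<^sub>R b"
  shows "\<forall>b\<in>B. abs_op T b = norm (T b) *\<^sub>R b"
proof -
  note o = onb_ortho_family[OF B]
  have nB: "norm b = 1" if "b \<in> B" for b
    using cinner_onb[OF B that that] by (simp add: norm_eq_sqrt_inner inner_eq_Re_cinner)
  have eqB: "u = v" if "\<And>b. b \<in> B \<Longrightarrow> cinner u b = cinner v b" for u v
    using onb_complement_trivial[OF B, of "u - v"] that by (simp add: cinner_simps)
  have sq: "(cmod (of_real (norm (T b)) * cinner x b))\<^sup>2 \<le> (norm T)\<^sup>2 * (cmod (cinner x b))\<^sup>2"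
    if "b \<in> B" for b x
    using norm_blinfun[of T b] nB[OF that]
    by (intro square_le_mult_square) (auto simp: norm_mult intro: mult_right_mono)
  have "\<exists>y. \<forall>b\<in>B. cinner y b = of_real (norm (T b)) * cinner x b" for x
  proof -
    have "(\<lambda>b. (norm T)\<^sup>2 * (cmod (cinner x b))\<^sup>2) summable_on B"
      using parseval_norm[OF B, of x] by (intro summable_on_cmult_right) (auto simp: has_sum_iff)
    then have "(\<lambda>b. (cmod (of_real (norm (T b)) * cinner x b))\<^sup>2) summable_on B"
      by (rule summable_on_comparison_test) (use sq in auto)
    from ortho_family_summable[OF o this]
    obtain y where y: "((\<lambda>b. (of_real (norm (T b)) * cinner x b) *\<^sub>C b) has_sum y) B"
      using summable_on_def by blast
    have "cinner y b = of_real (norm (T b)) * cinner x b" if "b \<in> B" for b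
      using orthonormal_coefficient[OF _ y that] B by (simp add: is_onb_def)
    then show ?thesis by blast
  qed
  then obtain P where P: "\<And>x b. b \<in> B \<Longrightarrow> cinner (P x) b = of_real (norm (T b)) * cinner x b"
    by metis
  have Padd: "P (x + y) = P x + P y" and PscC: "P (c *\<^sub>C x) = c *\<^sub>C P x" for x y c
    by (rule eqB; simp add: P cinner_simps distrib_left)+
  have "bounded_linear P"
  proof (rule bounded_linear_intro[of _ "norm T"])
    show "P (r *\<^sub>R x) = r *\<^sub>R P x" for r x by (simp add: scaleR_scaleC PscC)
    fix x
    have "(norm (P x))\<^sup>2 \<le> (norm T)\<^sup>2 * (norm x)\<^sup>2"
      by (rule has_sum_mono[OF parseval_norm[OF B] has_sum_cmult_right[OF parseval_norm[OF B]]])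
        (use sq P in simp)
    then show "norm (P x) \<le> norm x * norm T"
      by (intro power2_le_imp_le[of "norm (P x)"]) (auto simp: power_mult_distrib mult.commute)
  qed (rule Padd)
  define Q where "Q = Blinfun P"
  have QP: "Q x = P x" for x
    by (simp add: Q_def bounded_linear_Blinfun_apply[OF \<open>bounded_linear P\<close>])
  have cQ: "clinear_op Q" by (simp add: clinear_op_def QP PscC)
  have Qb: "Q b = norm (T b) *\<^sub>R b" if "b \<in> B" for b
    by (rule eqB) (use that cinner_onb[OF B that] in \<open>auto simp: QP P cinner_simps\<close>)
  have "positive_op Q"
    unfolding positive_op_def
  proof safe
    fix x
    have "((\<lambda>b. of_real (norm (T b) * (cmod (cinner x b))\<^sup>2)) has_sum cinner (Q x) x) B"
    proof (rule has_sum_cong[THEN iffD1, OF _ parseval[OF B]])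
      fix b assume b: "b \<in> B"
      show "cinner (Q x) b * cinner b x = of_real (norm (T b) * (cmod (cinner x b))\<^sup>2)"
        unfolding QP P[OF b] of_real_mult complex_norm_square cinner_commute[of b x]
        by (simp add: mult.assoc)
    qed
    from has_sum_Re[OF this] has_sum_Im[OF this]
    have re: "((\<lambda>b. norm (T b) * (cmod (cinner x b))\<^sup>2) has_sum Re (cinner (Q x) x)) B"
      and im: "((\<lambda>b. 0) has_sum Im (cinner (Q x) x)) B"
      unfolding Re_complex_of_real Im_complex_of_real by auto
    have "0 \<le> Re (cinner (Q x) x)" by (rule has_sum_nonneg[OF re]) simp
    moreover have "Im (cinner (Q x) x) = 0" using has_sum_unique[OF im] by simp
    ultimately show "cinner (Q x) x \<in> \<real>\<^sub>\<ge>\<^sub>0" by (simp add: complex_nonneg_Reals_iff)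
  qed (rule cQ)
  moreover have "Q o\<^sub>L Q = adj T o\<^sub>L T"
    by (rule cspan_closure_eqI[of B])
      (use B cQ T eig Qb in
        \<open>auto simp: is_onb_def blinfun.scaleR_right power2_eq_square clinear_opD\<close>)
  \<comment> \<open>Uniqueness: R is determined on each eigenvector by its square, and a bounded
    operator by its values on the basis.\<close>
  moreover have "R = Q" if "positive_op R \<and> R o\<^sub>L R = adj T o\<^sub>L T" for R
  proof (rule cspan_closure_eqI[of B])
    fix b assume b: "b \<in> B"
    have "R (R b) = (norm (T b))\<^sup>2 *\<^sub>R b"
      using arg_cong[OF conjunct2[OF that], of "\<lambda>S. blinfun_apply S b"] eig[OF b] by simp
    then have "R b = norm (T b) *\<^sub>R b"
      by (rule positive_sqrt_eigenvector[OF conjunct1[OF that]]) simp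
    then show "R b = Q b" by (simp only: Qb[OF b])
  qed (use B cQ that in \<open>auto simp: is_onb_def clinear_opD positive_op_def\<close>)
  ultimately have "abs_op T = Q"
    unfolding abs_op_def by (intro the_equality[where a = Q] conjI)
  then show ?thesis by (simp add: Qb)
qed

lemma nuc_hs: "nuc T b \<Longrightarrow> hs T"
  by (induction rule: nuc.induct) (simp_all add: hs_compose_left hs_clinear hs_add)

text \<open>The vectors \<open>w b\<close> play the part of the partial isometry in the polar
  decomposition: the pairing of \<open>T b\<close> with \<open>w b\<close> is
  \<open>norm (T b)\<close>, the eigenvalue of \<open>abs_op T\<close> at b. They are mutually
  orthogonal because B diagonalises \<open>adj T o\<^sub>L T\<close>.\<close>

lemma nuc_trace_class:
  assumes "nuc T b"
  shows "trace_class T"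
proof -
  have T: "hs T" using assms by (rule nuc_hs)
  note cT = hs_clinear[OF T]
  obtain B where B: "is_onb B" and eig: "\<And>b. b \<in> B \<Longrightarrow> (adj T o\<^sub>L T) b = (norm (T b))\<^sup>2 *\<^sub>R b"
    using gram_eigenbasis[OF T] by blast
  define w where "w b = T b /\<^sub>R norm (T b)" for b
  have "cinner (T e) (T f) = 0" if "e \<in> B" "f \<in> B" "e \<noteq> f" for e f
    using cinner_gram[OF cT, of e f] eig[OF that(1)] cinner_onb[OF B that(1,2)] that(3)
    by (simp add: cinner_simps del: blinfun_apply_blinfun_compose)
  moreover have "w b = 0 \<or> norm (w b) = 1" for b
    by (cases "T b = 0") (simp_all add: w_def)
  ultimately have w: "ortho_family B w"
    by (simp add: ortho_family_def w_def cinner_simps)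
  have "(\<lambda>b. norm (cinner (T b) (w b))) summable_on B"
    by (rule nuc_ortho_family_summable[OF onb_ortho_family[OF B] w assms])
  moreover have "norm (cinner (T b) (w b)) = norm (T b)" for b
    unfolding w_def cinner_simps cinner_self norm_mult norm_of_real
    by (cases "T b = 0") (simp_all add: power2_eq_square)
  ultimately have "(\<lambda>b. complex_of_real (norm (T b))) summable_on B"
    by (intro summable_on_of_real) simp
  moreover have "cinner (abs_op T b) b = of_real (norm (T b))" if "b \<in> B" for b
    using abs_op_eigenbasis[OF cT B eig] that cinner_onb[OF B that that] by (simp add: cinner_simps)
  ultimately have "(\<lambda>b. cinner (abs_op T b) b) summable_on B"
    using summable_on_cong[of B "\<lambda>b. cinner (abs_op T b) b" "\<lambda>b. complex_of_real (norm (T b))"]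
    by simp
  then show ?thesis unfolding trace_class_def using cT B by blast
qed

end

section \<open>Moment sequences of integrable functions on the circle\<close>

text \<open>Up to the factor 2 \<pi> this is the Fourier coefficient of index - n; the sign is that
  of the test functions \<open>cis (n * t)\<close> coming from polynomials.\<close>

definition mom :: "(real \<Rightarrow> complex) \<Rightarrow> nat \<Rightarrow> complex" where
  "mom f n = (LINT t:{0..2*pi}|lebesgue. cis (real n * t) * f t)"

text \<open>Extension by zero, which turns set integrals into integrals over the line.\<close>

definition cut :: "(real \<Rightarrow> complex) \<Rightarrow> real \<Rightarrow> complex" where
  "cut f t = indicator {0..2*pi} t *\<^sub>R f t"

lemma L1_circle_cut: "f \<in> L1_circle \<longleftrightarrow> integrable lebesgue (cut f)"
  by (simp add: L1_circle_def set_integrable_def cut_def[abs_def])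

lemma L1_norm_cut: "L1_norm f = (LINT t|lebesgue. norm (cut f t))"
  unfolding L1_norm_def set_lebesgue_integral_def cut_def
  by (intro Bochner_Integration.integral_cong) auto

lemma mom_cut: "mom f n = (LINT t|lebesgue. cis (real n * t) * cut f t)"
  unfolding mom_def set_lebesgue_integral_def cut_def
  by (intro Bochner_Integration.integral_cong) (auto simp: scaleR_conv_of_real)

lemma cis_measurable: "(\<lambda>t. cis (a * t)) \<in> borel_measurable lebesgue"
proof -
  have "(\<lambda>t. cis (a * t)) \<in> borel_measurable borel"
    by (intro borel_measurable_continuous_onI continuous_intros)
  then show ?thesis by (intro measurable_completion) simp
qed

lemma integrable_cis:
  assumes "integrable lebesgue g"
  shows "integrable lebesgue (\<lambda>t. cis (a * t) * g t)"
proof (rule Bochner_Integration.integrable_bound[OF assms])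
  show "(\<lambda>t. cis (a * t) * g t) \<in> borel_measurable lebesgue"
    using assms by (intro borel_measurable_times cis_measurable) auto
qed (simp add: norm_mult)

lemma L1_norm_nonneg: "0 \<le> L1_norm f"
  by (simp add: L1_norm_cut)

lemma L1_circle_add: "f \<in> L1_circle \<Longrightarrow> g \<in> L1_circle \<Longrightarrow> (\<lambda>t. f t + g t) \<in> L1_circle"
  by (auto simp: L1_circle_def)

lemma L1_circle_diff: "f \<in> L1_circle \<Longrightarrow> g \<in> L1_circle \<Longrightarrow> (\<lambda>t. f t - g t) \<in> L1_circle"
  by (auto simp: L1_circle_def)

lemma L1_circle_cmult: "f \<in> L1_circle \<Longrightarrow> (\<lambda>t. a * f t) \<in> L1_circle"
  by (auto simp: L1_circle_def)

lemma mom_integrable: "f \<in> L1_circle \<Longrightarrow> set_integrable lebesgue {0..2*pi} (\<lambda>t. cis (real n * t) * f t)"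
  using integrable_cis[of "cut f" "real n"]
  by (simp add: L1_circle_cut set_integrable_def) (simp add: cut_def mult_scaleR_right)

lemma mom_add:
  assumes "f \<in> L1_circle" "g \<in> L1_circle"
  shows "mom (\<lambda>t. f t + g t) n = mom f n + mom g n"
  unfolding mom_def distrib_left using assms by (intro set_integral_add mom_integrable)

lemma mom_diff:
  assumes "f \<in> L1_circle" "g \<in> L1_circle"
  shows "mom (\<lambda>t. f t - g t) n = mom f n - mom g n"
  unfolding mom_def right_diff_distrib using assms by (intro set_integral_diff mom_integrable)

lemma mom_cmult: "mom (\<lambda>t. a * f t) n = a * mom f n"
  unfolding mom_def by (simp add: mult.left_commute[of _ a])

lemma L1_norm_add_le:
  assumes "f \<in> L1_circle" "g \<in> L1_circle"
  shows "L1_norm (\<lambda>t. f t + g t) \<le> L1_norm f + L1_norm g"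
proof -
  have i: "integrable lebesgue (cut f)" "integrable lebesgue (cut g)"
    using assms by (auto simp: L1_circle_cut)
  have "L1_norm (\<lambda>t. f t + g t) \<le> (LINT t|lebesgue. norm (cut f t) + norm (cut g t))"
    unfolding L1_norm_cut
  proof (rule integral_mono)
    have "cut (\<lambda>t. f t + g t) = (\<lambda>t. cut f t + cut g t)"
      by (auto simp: cut_def scaleR_add_right)
    then show "integrable lebesgue (\<lambda>t. norm (cut (\<lambda>t. f t + g t) t))"
      using i by simp
    show "norm (cut (\<lambda>t. f t + g t) t) \<le> norm (cut f t) + norm (cut g t)" for t
      unfolding cut_def scaleR_add_right by (rule norm_triangle_ineq)
  qed (use i in auto)
  also have "\<dots> = L1_norm f + L1_norm g"
    unfolding L1_norm_cut using i by simp
  finally show ?thesis .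
qed

lemma L1_norm_cmult: "L1_norm (\<lambda>t. a * f t) = cmod a * L1_norm f"
  unfolding L1_norm_def by (simp add: norm_mult)

text \<open>Completeness of L1 in the form used below: monotone convergence gives absolute
  summability almost everywhere, and dominated convergence passes norm and moments to the
  sum.\<close>

lemma L1_circle_series:
  assumes f: "\<And>k. f k \<in> L1_circle" and le: "\<And>k. L1_norm (f k) \<le> a k" and a: "summable a"
  shows "\<exists>g\<in>L1_circle. L1_norm g \<le> suminf a \<and> (\<forall>n. (\<lambda>k. mom (f k) n) sums mom g n)"
proof -
  define h where "h k = cut (f k)" for k
  have h: "integrable lebesgue (h k)" for k using f by (simp add: h_def L1_circle_cut)
  have hN: "(LINT t|lebesgue. norm (h k t)) = L1_norm (f k)" for k by (simp add: h_def L1_norm_cut)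
  have sums: "summable (\<lambda>k. LINT t|lebesgue. norm (h k t))"
    unfolding hN by (rule summable_comparison_test'[OF a, of 0]) (simp add: L1_norm_nonneg le)
  have "(\<integral>\<^sup>+t. (\<Sum>k. ennreal (norm (h k t))) \<partial>lebesgue) = (\<Sum>k. \<integral>\<^sup>+t. ennreal (norm (h k t)) \<partial>lebesgue)"
    using h by (intro nn_integral_suminf) auto
  also have "\<dots> = (\<Sum>k. ennreal (LINT t|lebesgue. norm (h k t)))"
    using h by (intro suminf_cong nn_integral_eq_integral) auto
  also have "\<dots> \<noteq> \<infinity>" using sums by (simp add: suminf_ennreal2)
  finally have "AE t in lebesgue. (\<Sum>k. ennreal (norm (h k t))) \<noteq> \<infinity>"
    using h by (intro nn_integral_PInf_AE) auto
  then have AE: "AE t in lebesgue. summable (\<lambda>k. norm (h k t))"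
    by eventually_elim (rule summable_suminf_not_top, auto)
  define g where "g t = (\<Sum>k. h k t)" for t
  have cg: "cut g = g"
    by (auto simp: g_def cut_def h_def fun_eq_iff indicator_def)
  have ig: "integrable lebesgue g"
    unfolding g_def by (rule integrable_suminf[OF h AE sums])
  have "L1_norm g = (LINT t|lebesgue. norm (g t))" by (simp add: L1_norm_cut cg)
  also have "\<dots> \<le> (LINT t|lebesgue. (\<Sum>k. norm (h k t)))"
  proof (rule integral_mono_AE)
    show "integrable lebesgue (\<lambda>t. \<Sum>k. norm (h k t))"
      using h AE sums by (intro integrable_suminf) auto
    show "AE t in lebesgue. norm (g t) \<le> (\<Sum>k. norm (h k t))"
      using AE by eventually_elim (simp add: g_def summable_norm)
  qed (use ig in auto)
  also have "\<dots> = (\<Sum>k. L1_norm (f k))"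
    unfolding hN[symmetric] using h AE sums by (intro integral_suminf) auto
  also have "\<dots> \<le> suminf a"
    using sums a le by (intro suminf_le) (auto simp: hN)
  finally have "L1_norm g \<le> suminf a" .
  moreover have "(\<lambda>k. mom (f k) n) sums mom g n" for n
  proof -
    have "(\<lambda>k. LINT t|lebesgue. cis (real n * t) * h k t) sums (LINT t|lebesgue. (\<Sum>k. cis (real n * t) * h k t))"
      using AE sums by (intro sums_integral integrable_cis h) (auto simp: norm_mult)
    also have "(LINT t|lebesgue. (\<Sum>k. cis (real n * t) * h k t)) = (LINT t|lebesgue. cis (real n * t) * g t)"
    proof (rule integral_cong_AE)
      have ic: "integrable lebesgue (\<lambda>t. \<Sum>k. cis (real n * t) * h k t)"
        using AE sums by (intro integrable_suminf integrable_cis h) (auto simp: norm_mult)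
      show "(\<lambda>t. \<Sum>k. cis (real n * t) * h k t) \<in> borel_measurable lebesgue"
        using ic by (rule borel_measurable_integrable)
      show "(\<lambda>t. cis (real n * t) * g t) \<in> borel_measurable lebesgue"
        using integrable_cis[OF ig] by (rule borel_measurable_integrable)
      show "AE t in lebesgue. (\<Sum>k. cis (real n * t) * h k t) = cis (real n * t) * g t"
        using AE by eventually_elim (simp add: g_def suminf_mult summable_norm_cancel)
    qed
    finally show ?thesis by (simp add: mom_cut cg flip: h_def)
  qed
  moreover have "g \<in> L1_circle" using ig by (simp add: L1_circle_cut cg)
  ultimately show ?thesis by blast
qed

text \<open>
  The bound is on the norm of the function modulo functions in the Hardy space: the moments with
  positive index determine the function up to such functions.
\<close>

definition rep :: "(nat \<Rightarrow> complex) \<Rightarrow> real \<Rightarrow> bool" where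
  "rep c M \<longleftrightarrow> (\<forall>\<epsilon>>0. \<exists>f\<in>L1_circle. (\<forall>n\<ge>1. mom f n = c n) \<and> L1_norm f \<le> M + \<epsilon>)"

section \<open>Calculus of moment bounds\<close>

lemma repI: "f \<in> L1_circle \<Longrightarrow> (\<And>n. n \<ge> 1 \<Longrightarrow> mom f n = c n) \<Longrightarrow> L1_norm f \<le> M \<Longrightarrow> rep c M"
  unfolding rep_def by (metis add.commute add_increasing less_imp_le)

lemma rep_mono: "rep c M \<Longrightarrow> M \<le> M' \<Longrightarrow> rep c M'"
  unfolding rep_def by (meson add_right_mono order_trans)

lemma rep_cong: "rep c M \<Longrightarrow> (\<And>n. n \<ge> 1 \<Longrightarrow> d n = c n) \<Longrightarrow> rep d M"
  unfolding rep_def by metis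

lemma rep_limit_bound: "(\<And>\<epsilon>. \<epsilon> > 0 \<Longrightarrow> rep c (M + \<epsilon>)) \<Longrightarrow> rep c M"
  unfolding rep_def
proof (intro allI impI)
  fix \<epsilon> :: real assume *: "\<And>\<epsilon>. \<epsilon> > 0 \<Longrightarrow>
    \<forall>\<epsilon>'>0. \<exists>f\<in>L1_circle. (\<forall>n\<ge>1. mom f n = c n) \<and> L1_norm f \<le> M + \<epsilon> + \<epsilon>'" and "\<epsilon> > 0"
  from *[of "\<epsilon> / 2"] this(2) show "\<exists>f\<in>L1_circle. (\<forall>n\<ge>1. mom f n = c n) \<and> L1_norm f \<le> M + \<epsilon>"
    by (auto dest!: spec[of _ "\<epsilon> / 2"])
qed

lemma rep_add:
  assumes "rep c M" "rep d M'"
  shows "rep (\<lambda>n. c n + d n) (M + M')"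
  unfolding rep_def
proof (intro allI impI)
  fix \<epsilon> :: real assume "\<epsilon> > 0"
  then obtain f g where "f \<in> L1_circle" "\<And>n. n \<ge> 1 \<Longrightarrow> mom f n = c n" "L1_norm f \<le> M + \<epsilon> / 2"
    "g \<in> L1_circle" "\<And>n. n \<ge> 1 \<Longrightarrow> mom g n = d n" "L1_norm g \<le> M' + \<epsilon> / 2"
    using assms unfolding rep_def by (metis half_gt_zero)
  then show "\<exists>f\<in>L1_circle. (\<forall>n\<ge>1. mom f n = c n + d n) \<and> L1_norm f \<le> M + M' + \<epsilon>"
    using L1_norm_add_le[of f g] by (intro bexI[of _ "\<lambda>t. f t + g t"]) (auto simp: mom_add L1_circle_add)
qed

lemma rep_cmult:
  assumes "rep c M" shows "rep (\<lambda>n. a * c n) (cmod a * M)"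
proof (rule rep_limit_bound)
  fix \<epsilon> :: real assume "\<epsilon> > 0"
  \<comment> \<open>The added 1 covers a = 0.\<close>
  define e where "e = \<epsilon> / (cmod a + 1)"
  have "cmod a + 1 > 0" by (simp add: add_nonneg_pos)
  then have e: "e > 0" "cmod a * e \<le> \<epsilon>"
    using \<open>\<epsilon> > 0\<close> by (auto simp: e_def field_simps)
  obtain f where f: "f \<in> L1_circle" "\<And>n. n \<ge> 1 \<Longrightarrow> mom f n = c n" "L1_norm f \<le> M + e"
    using assms e(1) unfolding rep_def by metis
  have "cmod a * L1_norm f \<le> cmod a * (M + e)" using f(3) by (intro mult_left_mono) auto
  then show "rep (\<lambda>n. a * c n) (cmod a * M + \<epsilon>)"
    using f e(2) by (intro repI[of "\<lambda>t. a * f t"])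
      (auto simp: L1_circle_cmult mom_cmult L1_norm_cmult distrib_left)
qed

lemma rep_zero: "rep (\<lambda>n. 0) 0"
  by (rule repI[of "\<lambda>t. 0"]) (auto simp: L1_circle_def mom_def L1_norm_def set_integrable_def)

lemma rep_sum: "finite I \<Longrightarrow> (\<And>i. i \<in> I \<Longrightarrow> rep (c i) (M i)) \<Longrightarrow> rep (\<lambda>n. \<Sum>i\<in>I. c i n) (\<Sum>i\<in>I. M i)"
  by (induction I rule: finite_induct) (simp_all add: rep_zero rep_add)

text \<open>Completeness of the quotient of L1 by the Hardy space. The slack is spread geometrically
  over the summands, with total \<epsilon>.\<close>

lemma rep_sums:
  assumes r: "\<And>k. rep (c k) (M k)" and M: "summable M"
    and s: "\<And>n. n \<ge> 1 \<Longrightarrow> (\<lambda>k. c k n) sums d n"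
  shows "rep d (suminf M)"
  unfolding rep_def
proof (intro allI impI)
  fix \<epsilon> :: real assume e: "\<epsilon> > 0"
  have "\<exists>f\<in>L1_circle. (\<forall>n\<ge>1. mom f n = c k n) \<and> L1_norm f \<le> M k + \<epsilon> * (1/2) ^ Suc k" for k
    using r[of k] e unfolding rep_def by simp
  then obtain f where f: "\<And>k. f k \<in> L1_circle" "\<And>k n. n \<ge> 1 \<Longrightarrow> mom (f k) n = c k n"
    and fM: "\<And>k. L1_norm (f k) \<le> M k + \<epsilon> * (1/2) ^ Suc k" by metis
  have "(\<lambda>k. M k + \<epsilon> * (1/2) ^ Suc k) sums (suminf M + \<epsilon> * 1)"
    using M by (intro sums_add sums_mult power_half_series) auto
  then obtain g where g: "g \<in> L1_circle" "L1_norm g \<le> suminf M + \<epsilon>"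
    "\<And>n. (\<lambda>k. mom (f k) n) sums mom g n"
    using L1_circle_series[of f "\<lambda>k. M k + \<epsilon> * (1/2) ^ Suc k"] f(1) fM
    by (auto simp only: sums_iff mult_1_right)
  have "mom g n = d n" if "n \<ge> 1" for n
    using g(3)[of n] s[OF that] f(2)[OF that] sums_unique2 by simp
  then show "\<exists>f\<in>L1_circle. (\<forall>n\<ge>1. mom f n = d n) \<and> L1_norm f \<le> suminf M + \<epsilon>"
    using g by blast
qed

text \<open>The form in which completeness is applied, to finite rank approximations of
  \<open>Z\<close> and to dyadic Riemann sums: the limit is the first term plus the
  increments.\<close>

lemma rep_telescope:
  assumes r0: "rep (r 0) M" and step: "\<And>k. rep (\<lambda>n. r (Suc k) n - r k n) (e k)"
    and e: "e sums s" and lim: "\<And>n. n \<ge> 1 \<Longrightarrow> (\<lambda>k. r k n) \<longlonglongrightarrow> c n"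
  shows "rep c (M + s)"
proof -
  define d where "d k = (case k of 0 \<Rightarrow> r 0 | Suc k \<Rightarrow> (\<lambda>n. r (Suc k) n - r k n))" for k
  define b where "b k = (case k of 0 \<Rightarrow> M | Suc k \<Rightarrow> e k)" for k
  have b: "b sums (M + s)"
    using e sums_Suc_iff[of b s] by (simp add: b_def add.commute)
  have part: "(\<Sum>k<Suc m. d k n) = r m n" for m n
    by (induction m) (simp_all add: d_def)
  have "rep c (suminf b)"
  proof (rule rep_sums)
    show "rep (d k) (b k)" for k
      using r0 step by (cases k) (simp_all add: d_def b_def)
    show "summable b" using b by (rule sums_summable)
    fix n :: nat assume "n \<ge> 1"
    from lim[OF this] have "(\<lambda>m. \<Sum>k<Suc m. d k n) \<longlonglongrightarrow> c n" by (simp only: part)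
    then show "(\<lambda>k. d k n) sums c n" unfolding sums_def by (rule LIMSEQ_imp_Suc)
  qed
  then show ?thesis using b by (simp add: sums_iff)
qed

section \<open>Trigonometric polynomials\<close>

lemma has_integral_cis:
  "((\<lambda>t. cis (of_int m * t)) has_integral (if m = 0 then of_real (2 * pi) else 0)) {0..2*pi}"
proof (cases "m = 0")
  case True
  then show ?thesis using has_integral_const_real[of "1::complex" 0 "2*pi"] by (simp add: scaleR_conv_of_real)
next
  case False
  have "((\<lambda>t. cis (of_int m * t)) has_integral
      (cis (of_int m * (2*pi)) / (\<i> * of_int m) - cis (of_int m * 0) / (\<i> * of_int m))) {0..2*pi}"
  proof (rule fundamental_theorem_of_calculus)
    fix t :: real
    have cis: "cis (of_int m * x) = exp (\<i> * of_int m * of_real x)" for x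
      by (simp add: cis_conv_exp mult.assoc)
    have "((\<lambda>z. exp (\<i> * of_int m * z) / (\<i> * of_int m)) has_field_derivative
        exp (\<i> * of_int m * of_real t)) (at (of_real t))"
      using False by (auto intro!: derivative_eq_intros)
    from has_vector_derivative_real_field[OF this]
    show "((\<lambda>t. cis (of_int m * t) / (\<i> * of_int m)) has_vector_derivative cis (of_int m * t)) (at t within {0..2*pi})"
      unfolding cis by (rule has_vector_derivative_at_within)
  qed simp
  moreover have "cis (of_int m * (2*pi)) = 1"
    using cis_multiple_2pi[of "of_int m"] by (simp add: mult.commute)
  ultimately show ?thesis using False by simp
qed

lemma L1_circle_continuous: "continuous_on {0..2*pi} f \<Longrightarrow> f \<in> L1_circle"
  unfolding L1_circle_def by (simp add: absolutely_integrable_continuous_real)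

lemma LINT_circle_eqI:
  fixes f :: "real \<Rightarrow> 'b::euclidean_space"
  assumes "continuous_on {0..2*pi} f" "(f has_integral I) {0..2*pi}"
  shows "(LINT t:{0..2*pi}|lebesgue. f t) = I"
  using set_lebesgue_integral_eq_integral(2)[OF absolutely_integrable_continuous_real[OF assms(1)]]
    assms(2) by (simp add: integral_unique)

lemma trig_poly_mom:
  fixes a :: "int \<Rightarrow> complex"
  assumes "finite I"
  shows "mom (\<lambda>t. \<Sum>m\<in>I. a m * cis (of_int m * t)) n = (if - int n \<in> I then 2 * pi * a (- int n) else 0)"
proof -
  have eq: "cis (real n * t) * (\<Sum>m\<in>I. a m * cis (of_int m * t)) = (\<Sum>m\<in>I. a m * cis (of_int (m + int n) * t))" for t
    by (simp add: sum_distrib_left cis_mult algebra_simps)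
  have "mom (\<lambda>t. \<Sum>m\<in>I. a m * cis (of_int m * t)) n = (\<Sum>m\<in>I. a m * (if m + int n = 0 then of_real (2 * pi) else 0))"
    unfolding mom_def eq
    by (intro LINT_circle_eqI has_integral_sum assms has_integral_mult_right has_integral_cis continuous_intros)
  also have "\<dots> = (\<Sum>m\<in>I. if m = - int n then a m * of_real (2 * pi) else 0)"
    by (intro sum.cong) auto
  finally show ?thesis using assms by (simp add: mult.commute)
qed

text \<open>Parseval combined with the bound of the L1 norm by sqrt (2 \<pi>) times the L2
  norm.\<close>

lemma trig_poly_L1_norm:
  fixes a :: "nat \<Rightarrow> complex"
  assumes "finite I"
  shows "L1_norm (\<lambda>t. \<Sum>n\<in>I. a n * cis (- real n * t)) \<le> 2 * pi * sqrt (\<Sum>n\<in>I. (cmod (a n))\<^sup>2)"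
proof -
  define f where "f t = (\<Sum>n\<in>I. a n * cis (- real n * t))" for t
  define S where "S = (\<Sum>n\<in>I. (cmod (a n))\<^sup>2)"
  have "S \<ge> 0" by (simp add: S_def sum_nonneg)
  have cont: "continuous_on {0..2*pi} f" unfolding f_def by (intro continuous_intros)
  have "((\<lambda>t. \<Sum>m\<in>I. \<Sum>n\<in>I. a m * cnj (a n) * cis (of_int (int n - int m) * t)) has_integral
      (\<Sum>m\<in>I. \<Sum>n\<in>I. a m * cnj (a n) * (if int n - int m = 0 then of_real (2 * pi) else 0))) {0..2*pi}"
    by (intro has_integral_sum assms has_integral_mult_right has_integral_cis)
  also have "(\<lambda>t. \<Sum>m\<in>I. \<Sum>n\<in>I. a m * cnj (a n) * cis (of_int (int n - int m) * t)) = (\<lambda>t. of_real ((cmod (f t))\<^sup>2))"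
  proof
    fix t
    have "of_real ((cmod (f t))\<^sup>2) = (\<Sum>m\<in>I. \<Sum>n\<in>I. (a m * cis (- real m * t)) * (cnj (a n) * cis (real n * t)))"
      unfolding complex_norm_square f_def by (simp add: sum_product cis_cnj)
    also have "\<dots> = (\<Sum>m\<in>I. \<Sum>n\<in>I. a m * cnj (a n) * (cis (- real m * t) * cis (real n * t)))"
      by (intro sum.cong refl) (simp add: mult_ac)
    finally show "(\<Sum>m\<in>I. \<Sum>n\<in>I. a m * cnj (a n) * cis (of_int (int n - int m) * t)) = of_real ((cmod (f t))\<^sup>2)"
      by (simp add: cis_mult algebra_simps)
  qed
  also have "(\<Sum>m\<in>I. \<Sum>n\<in>I. a m * cnj (a n) * (if int n - int m = 0 then of_real (2 * pi) else 0)) = of_real (2 * pi * S)"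
  proof -
    have "(\<Sum>n\<in>I. a m * cnj (a n) * (if int n - int m = 0 then of_real (2 * pi) else 0)) = of_real (2 * pi * (cmod (a m))\<^sup>2)"
      if "m \<in> I" for m
    proof -
      have "(\<Sum>n\<in>I. a m * cnj (a n) * (if int n - int m = 0 then of_real (2 * pi) else 0))
          = (\<Sum>n\<in>I. if n = m then a m * cnj (a m) * of_real (2 * pi) else 0)"
        by (intro sum.cong) auto
      then show ?thesis using assms that unfolding of_real_mult[of _ "(cmod (a m))\<^sup>2"] complex_norm_square
        by (simp add: mult.commute)
    qed
    then show ?thesis by (simp add: S_def sum_distrib_left)
  qed
  finally have "((\<lambda>t. Re (of_real ((cmod (f t))\<^sup>2))) has_integral Re (of_real (2 * pi * S))) {0..2*pi}"
    by (rule has_integral_Re)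
  then have sq: "((\<lambda>t. (cmod (f t))\<^sup>2) has_integral 2 * pi * S) {0..2*pi}" by simp
  show ?thesis
  proof (cases "S = 0")
    case True
    then have "a n = 0" if "n \<in> I" for n using that assms by (auto simp: S_def sum_nonneg_eq_0_iff)
    then show ?thesis using \<open>S \<ge> 0\<close> by (simp add: L1_norm_def S_def[symmetric])
  next
    case False
    define s where "s = sqrt S"
    have s: "s > 0" "s\<^sup>2 = S" using False \<open>S \<ge> 0\<close> by (auto simp: s_def)
    \<comment> \<open>A pointwise arithmetic-geometric mean inequality with weight s, the root mean
      square of f, gives the sharp Cauchy-Schwarz constant.\<close>
    have "(LINT t:{0..2*pi}|lebesgue. cmod (f t)) \<le> (LINT t:{0..2*pi}|lebesgue. s / 2 + (cmod (f t))\<^sup>2 / (2 * s))"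
    proof (rule set_integral_mono)
      fix t
      have "0 \<le> (s - cmod (f t))\<^sup>2" by simp
      then show "cmod (f t) \<le> s / 2 + (cmod (f t))\<^sup>2 / (2 * s)"
        using s(1) by (simp add: field_simps power2_eq_square)
    qed (use s in \<open>auto intro!: absolutely_integrable_continuous_real continuous_intros cont\<close>)
    also have "\<dots> = (2 * pi) *\<^sub>R (s / 2) + (2 * pi * S) / (2 * s)"
      using has_integral_const_real[of "s / 2" 0 "2 * pi"] s
      by (intro LINT_circle_eqI has_integral_add has_integral_divide[OF sq])
        (auto intro!: continuous_intros cont)
    also have "\<dots> = 2 * pi * s" using s by (simp add: field_simps power2_eq_square flip: s(2))
    finally show ?thesis unfolding L1_norm_def f_def[symmetric] S_def[symmetric] s_def .
  qed
qed

text \<open>The coefficient for the moment n sits at frequency - n and is divided by 2 \<pi>, which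
  cancels the constant of the L1 bound.\<close>

lemma rep_finite:
  assumes "finite I" "\<And>n. n \<ge> 1 \<Longrightarrow> n \<notin> I \<Longrightarrow> c n = 0"
  shows "rep c (sqrt (\<Sum>n\<in>I. (cmod (c n))\<^sup>2))"
proof (rule repI[of "\<lambda>t. \<Sum>n\<in>I. (c n / (2 * pi)) * cis (- real n * t)"])
  show "(\<lambda>t. \<Sum>n\<in>I. (c n / (2 * pi)) * cis (- real n * t)) \<in> L1_circle"
    by (intro L1_circle_continuous continuous_intros)
  fix n :: nat assume "n \<ge> 1"
  define a where "a m = c (nat (- m)) / (2 * pi)" for m :: int
  have "(\<lambda>t. \<Sum>n\<in>I. (c n / (2 * pi)) * cis (- real n * t)) = (\<lambda>t. \<Sum>m\<in>(\<lambda>n. - int n) ` I. a m * cis (of_int m * t))"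
    by (subst sum.reindex) (auto simp: inj_on_def a_def)
  then have "mom (\<lambda>t. \<Sum>n\<in>I. (c n / (2 * pi)) * cis (- real n * t)) n = (if n \<in> I then 2 * pi * a (- int n) else 0)"
    using assms(1) by (simp add: trig_poly_mom image_iff)
  then show "mom (\<lambda>t. \<Sum>n\<in>I. (c n / (2 * pi)) * cis (- real n * t)) n = c n"
    using assms(2)[OF \<open>n \<ge> 1\<close>] by (simp add: a_def)
next
  have "L1_norm (\<lambda>t. \<Sum>n\<in>I. (c n / (2 * pi)) * cis (- real n * t)) \<le> 2 * pi * sqrt (\<Sum>n\<in>I. (cmod (c n / (2 * pi)))\<^sup>2)"
    by (rule trig_poly_L1_norm) fact
  also have "(\<Sum>n\<in>I. (cmod (c n / (2 * pi)))\<^sup>2) = (\<Sum>n\<in>I. (cmod (c n))\<^sup>2) / (2 * pi)\<^sup>2"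
    by (simp add: norm_divide power_divide sum_divide_distrib norm_mult)
  also have "2 * pi * sqrt ((\<Sum>n\<in>I. (cmod (c n))\<^sup>2) / (2 * pi)\<^sup>2) = sqrt (\<Sum>n\<in>I. (cmod (c n))\<^sup>2)"
    unfolding real_sqrt_divide real_sqrt_abs by simp
  finally show "L1_norm (\<lambda>t. \<Sum>n\<in>I. (c n / (2 * pi)) * cis (- real n * t)) \<le> sqrt (\<Sum>n\<in>I. (cmod (c n))\<^sup>2)" .
qed

text \<open>
  Each dyadic block of moments is realised by a trigonometric polynomial, whose norm is bounded
  by Parseval's identity; the bounds decay geometrically in the block.
\<close>

lemma rep_tail:
  assumes le: "\<And>n. n \<ge> 1 \<Longrightarrow> cmod (c n) \<le> C / real n" and z: "\<And>n. n < 2 ^ K \<Longrightarrow> c n = 0"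
  shows "rep c (C * (\<Sum>k. sqrt (1/2) ^ k) * sqrt (1/2) ^ K)"
proof -
  define q where "q = sqrt (1/2 :: real)"
  have q: "0 \<le> q" "q < 1" "q\<^sup>2 = 1/2" by (auto simp: q_def)
  have q2: "(q ^ j)\<^sup>2 = (1/2) ^ j" for j
    by (metis power_mult mult.commute q(3))
  have C: "0 \<le> C" using le[of 1] norm_ge_zero[of "c 1"] by (simp del: norm_ge_zero)
  \<comment> \<open>This block has 2^(K+k) indices with entries at most C / 2^(K+k), so its l2 norm
    is at most C * q^(K+k).\<close>
  define J where "J k = {(2::nat) ^ (K + k) ..< 2 ^ (K + k + 1)}" for k
  have "rep (\<lambda>n. if n \<in> J k then c n else 0) (C * q ^ K * q ^ k)" for k
  proof (rule rep_mono[OF rep_finite[of "J k"]])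
    have "(\<Sum>n\<in>J k. (cmod (if n \<in> J k then c n else 0))\<^sup>2) \<le> (\<Sum>n\<in>J k. (C / 2 ^ (K + k))\<^sup>2)"
    proof (rule sum_mono)
      fix n assume n: "n \<in> J k"
      then have n1: "real n \<ge> 2 ^ (K + k)" unfolding J_def
        by (metis atLeastLessThan_iff of_nat_le_iff of_nat_numeral of_nat_power)
      from less_le_trans[OF _ this, of 0] have "n \<ge> 1" by simp
      have "cmod (c n) \<le> C / 2 ^ (K + k)"
        using n1 C \<open>n \<ge> 1\<close> by (intro order_trans[OF le[OF \<open>n \<ge> 1\<close>]] divide_left_mono mult_pos_pos) auto
      then have "(cmod (c n))\<^sup>2 \<le> (C / 2 ^ (K + k))\<^sup>2" by (intro power_mono) auto
      then show "(cmod (if n \<in> J k then c n else 0))\<^sup>2 \<le> (C / 2 ^ (K + k))\<^sup>2"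
        using n by simp
    qed
    also have "\<dots> = C\<^sup>2 * ((1/2) ^ K * (1/2) ^ k)"
      by (simp add: J_def power2_eq_square power_add power_divide field_simps)
    also have "\<dots> = (C * q ^ K * q ^ k)\<^sup>2"
      by (simp only: power_mult_distrib q2 mult.assoc)
    finally show "sqrt (\<Sum>n\<in>J k. (cmod (if n \<in> J k then c n else 0))\<^sup>2) \<le> C * q ^ K * q ^ k"
      using C q by (intro real_le_lsqrt) (auto simp: sum_nonneg)
  qed (auto simp: J_def)
  moreover have sq: "summable (\<lambda>k. q ^ k)" using q by (intro summable_geometric) auto
  moreover have "(\<lambda>k. if n \<in> J k then c n else 0) sums c n" if n1: "n \<ge> 1" for n
  proof (cases "n < 2 ^ K")
    case True
    then have "c n = 0" by (rule z)
    then show ?thesis by (simp cong: if_cong)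
  next
    case False
    obtain j where j: "2 ^ j \<le> n" "n < 2 ^ (j + 1)" using ex_power_ivl1[of 2 n] n1 by auto
    have uniq: "n \<in> J k \<longleftrightarrow> K + k = j" for k
    proof
      assume "n \<in> J k"
      then have *: "2 ^ (K + k) \<le> n" "n < 2 ^ (K + k + 1)" by (auto simp: J_def)
      have "(2::nat) ^ (K + k) < 2 ^ (j + 1)" "(2::nat) ^ j < 2 ^ (K + k + 1)"
        using * j by linarith+
      then have "K + k < j + 1" "j < K + k + 1"
        using power_less_imp_less_exp[of 2 "K + k" "j + 1"] power_less_imp_less_exp[of 2 j "K + k + 1"] by auto
      then show "K + k = j" by simp
    qed (use j in \<open>auto simp: J_def\<close>)
    have "(2::nat) ^ K < 2 ^ (j + 1)" using False j by linarith
    then have "K < j + 1" by (rule power_less_imp_less_exp[rotated]) simp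
    then have "n \<in> J k \<longleftrightarrow> k = j - K" for k using uniq[of k] by auto
    then show ?thesis using sums_single[of "j - K" "\<lambda>_. c n"] by simp
  qed
  ultimately have "rep c (\<Sum>k. C * q ^ K * q ^ k)"
    by (intro rep_sums[where c = "\<lambda>k n. if n \<in> J k then c n else 0"] summable_mult) auto
  also have "(\<Sum>k. C * q ^ K * q ^ k) = C * (\<Sum>k. q ^ k) * q ^ K"
    using suminf_mult[OF sq, of "C * q ^ K"] by (simp add: mult_ac)
  finally show ?thesis by (simp add: q_def)
qed

text \<open>A weak limit that stays a function. The error splits in two: finitely many low moments,
  small by approximation, and a tail, small uniformly in d by the common 1/n decay.\<close>

lemma rep_limit:
  assumes c: "\<And>n. n \<ge> 1 \<Longrightarrow> cmod (c n) \<le> C / real n"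
    and approx: "\<And>N \<delta>. \<delta> > 0 \<Longrightarrow> \<exists>d. rep d M \<and> (\<forall>n\<ge>1. cmod (d n) \<le> C / real n) \<and>
      (\<forall>n. 1 \<le> n \<and> n < N \<longrightarrow> cmod (c n - d n) \<le> \<delta>)"
  shows "rep c M"
proof (rule rep_limit_bound)
  fix \<epsilon> :: real assume e: "\<epsilon> > 0"
  define q where "q = sqrt (1/2 :: real)"
  have q: "0 \<le> q" "q < 1" by (auto simp: q_def)
  have "(\<lambda>K. (2 * C) * (\<Sum>k. q ^ k) * q ^ K) \<longlonglongrightarrow> (2 * C) * (\<Sum>k. q ^ k) * 0"
    using q by (intro tendsto_intros LIMSEQ_realpow_zero) auto
  then have "\<forall>\<^sub>F K in sequentially. (2 * C) * (\<Sum>k. q ^ k) * q ^ K < \<epsilon> / 2"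
    using e by (intro order_tendstoD) auto
  then obtain K where K: "(2 * C) * (\<Sum>k. q ^ k) * q ^ K < \<epsilon> / 2"
    by (meson eventually_happens sequentially_bot)
  \<comment> \<open>Fewer than 2^K entries of size \<delta> have l2 norm at most 2^K * \<delta>, a
    crude bound that suffices.\<close>
  define \<delta> where "\<delta> = \<epsilon> / 2 / 2 ^ K"
  have "\<delta> > 0" using e by (simp add: \<delta>_def)
  obtain d where d: "rep d M" "\<And>n. n \<ge> 1 \<Longrightarrow> cmod (d n) \<le> C / real n"
    "\<And>n. 1 \<le> n \<Longrightarrow> n < 2 ^ K \<Longrightarrow> cmod (c n - d n) \<le> \<delta>"
    using approx[OF \<open>\<delta> > 0\<close>, of "2 ^ K"] by blast
  define lo where "lo n = (if n < 2 ^ K then c n - d n else 0)" for n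
  define hi where "hi n = (if n < 2 ^ K then 0 else c n - d n)" for n
  have "rep lo (\<epsilon> / 2)"
  proof (rule rep_mono[OF rep_finite[of "{1..<2 ^ K}"]])
    have "(\<Sum>n\<in>{1..<2 ^ K}. (cmod (lo n))\<^sup>2) \<le> (\<Sum>n\<in>{1..<(2::nat) ^ K}. \<delta>\<^sup>2)"
      using d(3) by (intro sum_mono power_mono) (auto simp: lo_def)
    also have "\<dots> \<le> 2 ^ K * \<delta>\<^sup>2" by (simp add: mult_right_mono)
    also have "\<dots> \<le> (2 ^ K)\<^sup>2 * \<delta>\<^sup>2"
      by (intro mult_right_mono self_le_power) auto
    also have "\<dots> = (\<epsilon> / 2)\<^sup>2" by (simp add: \<delta>_def power_divide power_mult_distrib)
    finally show "sqrt (\<Sum>n\<in>{1..<2 ^ K}. (cmod (lo n))\<^sup>2) \<le> \<epsilon> / 2"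
      using e by (intro real_le_lsqrt) (auto simp: sum_nonneg)
  qed (auto simp: lo_def)
  moreover have "rep hi (\<epsilon> / 2)"
  proof (rule rep_mono[OF rep_tail[of hi "2 * C" K]])
    fix n :: nat assume "n \<ge> 1"
    have "cmod (hi n) \<le> cmod (c n - d n)" by (simp add: hi_def)
    also have "\<dots> \<le> C / real n + C / real n"
      using norm_triangle_ineq4[of "c n" "d n"] c[OF \<open>n \<ge> 1\<close>] d(2)[OF \<open>n \<ge> 1\<close>] by linarith
    finally show "cmod (hi n) \<le> 2 * C / real n" by simp
  qed (use K in \<open>auto simp: hi_def q_def\<close>)
  ultimately have "rep (\<lambda>n. d n + (lo n + hi n)) (M + (\<epsilon> / 2 + \<epsilon> / 2))"
    by (intro rep_add d(1))
  then have "rep (\<lambda>n. d n + (lo n + hi n)) (M + \<epsilon>)" by simp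
  then show "rep c (M + \<epsilon>)" by (rule rep_cong) (simp add: lo_def hi_def)
qed

section \<open>A positive kernel for divided differences\<close>

text \<open>For |w| = 1 this is the Fejer kernel, the squared modulus of a geometric sum; inside the
  disc a nonnegative multiple of 1 - |w|^2 is added.\<close>

lemma fejer_nonneg:
  fixes w :: complex
  assumes "cmod w \<le> 1" 
  shows "0 \<le> real N + 2 * (\<Sum>m=1..<N. real (N - m) * Re (w ^ m))"
proof -
  define s where "s k = (\<Sum>a<k. w ^ a)" for k
  have "real N + 2 * (\<Sum>m=1..<N. real (N - m) * Re (w ^ m))
      = (cmod (s N))\<^sup>2 + (1 - (cmod w)\<^sup>2) * (\<Sum>k<N. (cmod (s k))\<^sup>2)" for N
  proof (induction N)
    case (Suc N)
    \<comment> \<open>The recursion expresses |w|^2 |s N|^2 through s (Suc N), which makes the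
      identity telescope.\<close>
    have "s (Suc N) = 1 + w * s N"
      unfolding s_def sum.lessThan_Suc_shift by (simp add: sum_distrib_left)
    then have "cmod w * cmod (s N) = cmod (s (Suc N) - 1)" by (simp flip: norm_mult)
    then have "(cmod w)\<^sup>2 * (cmod (s N))\<^sup>2 = (cmod (s (Suc N) - 1))\<^sup>2"
      by (simp flip: power_mult_distrib)
    also have "\<dots> = (cmod (s (Suc N)))\<^sup>2 - 2 * Re (s (Suc N)) + 1"
      unfolding cmod_power2 by (simp add: power2_eq_square algebra_simps)
    finally have 1: "(cmod w)\<^sup>2 * (cmod (s N))\<^sup>2 = (cmod (s (Suc N)))\<^sup>2 - 2 * Re (s (Suc N)) + 1" .
    have "Re (s (Suc N)) = 1 + (\<Sum>m=1..<Suc N. Re (w ^ m))"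
      unfolding s_def lessThan_atLeast0 by (subst sum.atLeast_Suc_lessThan) (auto simp: Re_sum)
    moreover have "(\<Sum>m=1..<Suc N. real (Suc N - m) * Re (w ^ m))
        = (\<Sum>m=1..<N. real (N - m) * Re (w ^ m)) + (\<Sum>m=1..<Suc N. Re (w ^ m))"
    proof -
      have "(\<Sum>m=1..<Suc N. real (Suc N - m) * Re (w ^ m))
          = (\<Sum>m=1..<Suc N. real (N - m) * Re (w ^ m) + Re (w ^ m))"
        by (intro sum.cong) (auto simp: of_nat_diff algebra_simps)
      also have "(\<Sum>m=1..<Suc N. real (N - m) * Re (w ^ m)) = (\<Sum>m=1..<N. real (N - m) * Re (w ^ m))"
        by (intro sum.mono_neutral_right) auto
      ultimately show ?thesis by (simp add: sum.distrib)
    qed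
    ultimately show ?case using Suc 1 by (simp add: algebra_simps)
  qed (simp add: s_def)
  then show ?thesis using assms
    by (simp add: sum_nonneg power_le_one abs_square_le_1)
qed

text \<open>For u \<noteq> v this is (u^(m+1) - v^(m+1)) / ((m+1) (u - v)); the sum also covers the
  diagonal.\<close>

definition divdiff :: "complex \<Rightarrow> complex \<Rightarrow> nat \<Rightarrow> complex" where
  "divdiff u v m = (\<Sum>j\<le>m. u ^ j * v ^ (m - j)) / of_nat (Suc m)"

lemma divdiff_has_integral:
  "((\<lambda>r. (of_real r * u + of_real (1 - r) * v) ^ m) has_integral divdiff u v m) {0..1}"
proof (cases "u = v")
  case True
  have "(\<Sum>j\<le>m. v ^ j * v ^ (m - j)) = (\<Sum>j\<le>m. v ^ m)"
    by (intro sum.cong) (auto simp: power_add[symmetric])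
  moreover have "of_real r * v + of_real (1 - r) * v = v" for r :: real
    by (simp add: algebra_simps)
  ultimately show ?thesis using has_integral_const_real[of "v ^ m" 0 1] True
    by (simp add: divdiff_def del: of_nat_Suc)
next
  case False
  define F where "F r = (of_real r * u + of_real (1 - r) * v) ^ Suc m / (of_nat (Suc m) * (u - v))" for r :: real
  have "((\<lambda>r. (of_real r * u + of_real (1 - r) * v) ^ m) has_integral F 1 - F 0) {0..1}"
  proof (rule fundamental_theorem_of_calculus)
    fix r :: real
    have "((\<lambda>x. (x * u + (1 - x) * v) ^ Suc m / (of_nat (Suc m) * (u - v))) has_field_derivative
        (of_real r * u + (1 - of_real r) * v) ^ m) (at (of_real r))"
      using False by (auto intro!: derivative_eq_intros simp del: power_Suc of_nat_Suc)
    then have "(F has_vector_derivative (of_real r * u + (1 - of_real r) * v) ^ m) (at r)"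
      unfolding F_def of_real_diff of_real_1
      by (rule has_vector_derivative_real_field)
    then show "(F has_vector_derivative (of_real r * u + of_real (1 - r) * v) ^ m) (at r within {0..1})"
      by (simp add: has_vector_derivative_at_within)
  qed simp
  moreover have "F 1 - F 0 = (u ^ Suc m - v ^ Suc m) / (of_nat (Suc m) * (u - v))"
    by (simp add: F_def diff_divide_distrib)
  moreover have "u ^ Suc m - v ^ Suc m = (u - v) * (\<Sum>j\<le>m. u ^ j * v ^ (m - j))"
    unfolding power_diff_sumr2 lessThan_Suc_atMost by (simp add: mult.commute)
  ultimately show ?thesis using False by (simp add: divdiff_def del: of_nat_Suc power_Suc)
qed

text \<open>\<open>Q\<close> is the Fejer mean of the Poisson kernels of the points of the chord
  from v to u, averaged along the chord. The chord stays in the disc, so \<open>Q\<close> is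
  nonnegative and its L1 norm equals its zeroth moment, 1.\<close>

lemma rep_divdiff:
  assumes u: "cmod u = 1" and v: "cmod v = 1" and N: "N \<ge> 1"
  shows "rep (\<lambda>n. of_real (real (N - (n - 1)) / real N) * divdiff u v (n - 1)) 1"
proof -
  define \<kappa> where "\<kappa> = divdiff u v"
  \<comment> \<open>\<open>mom\<close> of index n reads the coefficient at - n, hence \<kappa> on
    negative indices; the conjugates on positive ones make \<open>Q\<close> real.\<close>
  define b where "b m = of_real (real (N - nat \<bar>m\<bar>) / real N / (2 * pi)) *
    (if m \<le> 0 then \<kappa> (nat (- m)) else cnj (\<kappa> (nat m)))" for m :: int
  define I where "I = {- int (N - 1) .. int (N - 1)}"
  define Q where "Q t = (real N + 2 * (\<Sum>m=1..<N. real (N - m) * Re (cis (- real m * t) * \<kappa> m))) / (2 * pi * real N)" for t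
  have nn: "0 \<le> Q t" for t
  proof -
    define x where "x r = of_real r * u + of_real (1 - r) * v" for r :: real
    have "((\<lambda>r. Re (cis (- real m * t) * x r ^ m)) has_integral Re (cis (- real m * t) * \<kappa> m)) {0..1}" for m
      unfolding \<kappa>_def x_def by (intro has_integral_Re has_integral_mult_right divdiff_has_integral)
    then have "((\<lambda>r. real N + 2 * (\<Sum>m=1..<N. real (N - m) * Re (cis (- real m * t) * x r ^ m))) has_integral
        (1 - 0) *\<^sub>R real N + 2 * (\<Sum>m=1..<N. real (N - m) * Re (cis (- real m * t) * \<kappa> m))) {0..1}"
      by (intro has_integral_add has_integral_mult_right has_integral_sum)
        (use has_integral_const_real[of "real N" 0 1] in auto)
    then have "0 \<le> (1 - 0) *\<^sub>R real N + 2 * (\<Sum>m=1..<N. real (N - m) * Re (cis (- real m * t) * \<kappa> m))"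
    proof (rule has_integral_nonneg)
      fix r :: real assume r: "r \<in> {0..1}"
      have "cmod (x r) \<le> r * 1 + (1 - r) * 1"
        unfolding x_def by (rule order_trans[OF norm_triangle_ineq]) (use r u v in \<open>simp add: norm_mult del: of_real_diff\<close>)
      then have "cmod (cis (- t) * x r) \<le> 1" by (simp add: norm_mult)
      have "(cis (- t) * x r) ^ m = cis (- real m * t) * x r ^ m" for m
        by (simp add: power_mult_distrib Complex.DeMoivre)
      with fejer_nonneg[OF \<open>cmod (cis (- t) * x r) \<le> 1\<close>, of N]
      show "0 \<le> real N + 2 * (\<Sum>m=1..<N. real (N - m) * Re (cis (- real m * t) * x r ^ m))"
        by simp
    qed
    then show ?thesis unfolding Q_def using N by (intro divide_nonneg_nonneg) auto
  qed
  have Q: "of_real (Q t) = (\<Sum>m\<in>I. b m * cis (of_int m * t))" for t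
  proof -
    have I: "I = insert 0 ((\<lambda>m. - int m) ` {1..<N} \<union> int ` {1..<N})"
    proof -
      have "m \<in> (\<lambda>m. - int m) ` {1..<N}" if "m \<in> I" "m < 0" for m
        using that by (intro image_eqI[of _ _ "nat (- m)"]) (auto simp: I_def)
      moreover have "m \<in> int ` {1..<N}" if "m \<in> I" "m > 0" for m
        using that by (intro image_eqI[of _ _ "nat m"]) (auto simp: I_def)
      ultimately show ?thesis using N unfolding I_def by (fastforce simp: of_nat_diff)
    qed
    have "(\<Sum>m\<in>I. b m * cis (of_int m * t)) = b 0 + ((\<Sum>m\<in>(\<lambda>m. - int m) ` {1..<N}. b m * cis (of_int m * t))
        + (\<Sum>m\<in>int ` {1..<N}. b m * cis (of_int m * t)))"
      unfolding I by (subst sum.insert, simp, force, subst sum.union_disjoint) auto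
    also have "(\<Sum>m\<in>(\<lambda>m. - int m) ` {1..<N}. b m * cis (of_int m * t)) = (\<Sum>m=1..<N. b (- int m) * cis (- real m * t))"
      by (subst sum.reindex) (auto simp: inj_on_def)
    also have "(\<Sum>m\<in>int ` {1..<N}. b m * cis (of_int m * t)) = (\<Sum>m=1..<N. b (int m) * cis (real m * t))"
      by (subst sum.reindex) (auto simp: inj_on_def)
    also have "(\<Sum>m=1..<N. b (- int m) * cis (- real m * t)) + (\<Sum>m=1..<N. b (int m) * cis (real m * t))
        = (\<Sum>m=1..<N. of_real (real (N - m) / real N / (2 * pi) * (2 * Re (cis (- real m * t) * \<kappa> m))))"
      unfolding sum.distrib[symmetric]
    proof (rule sum.cong[OF refl])
      fix m assume m: "m \<in> {1..<N}"
      have "b (- int m) * cis (- real m * t) + b (int m) * cis (real m * t)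
          = of_real (real (N - m) / real N / (2 * pi)) *
            (cis (- real m * t) * \<kappa> m + cnj (cis (- real m * t) * \<kappa> m))"
        using m by (simp add: b_def cis_cnj algebra_simps)
      then show "b (- int m) * cis (- real m * t) + b (int m) * cis (real m * t) =
          of_real (real (N - m) / real N / (2 * pi) * (2 * Re (cis (- real m * t) * \<kappa> m)))"
        unfolding complex_add_cnj by simp
    qed
    also have "b 0 = of_real (1 / (2 * pi))" using N by (simp add: b_def \<kappa>_def divdiff_def)
    finally have "(\<Sum>m\<in>I. b m * cis (of_int m * t)) = of_real (1 / (2 * pi) +
        (\<Sum>m=1..<N. real (N - m) / real N / (2 * pi) * (2 * Re (cis (- real m * t) * \<kappa> m))))"
      by simp
    also have "1 / (2 * pi) + (\<Sum>m=1..<N. real (N - m) / real N / (2 * pi) * (2 * Re (cis (- real m * t) * \<kappa> m))) = Q t"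
    proof -
      have "(\<Sum>m=1..<N. real (N - m) / real N / (2 * pi) * (2 * Re (cis (- real m * t) * \<kappa> m)))
          = (\<Sum>m=1..<N. real (N - m) * Re (cis (- real m * t) * \<kappa> m)) * (2 / (2 * pi * real N))"
        unfolding sum_distrib_right by (intro sum.cong refl) (simp del: times_complex.sel)
      then show ?thesis
        using N unfolding Q_def by (simp add: add_divide_distrib del: times_complex.sel)
    qed
    finally show ?thesis ..
  qed
  have momQ: "mom (\<lambda>t. of_real (Q t)) n = of_real (real (N - n) / real N) * \<kappa> n" for n
  proof -
    have "mom (\<lambda>t. of_real (Q t)) n = (if - int n \<in> I then 2 * pi * b (- int n) else 0)"
      unfolding Q by (rule trig_poly_mom) (simp add: I_def)
    also have "\<dots> = of_real (real (N - n) / real N) * \<kappa> n"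
      using N by (auto simp: I_def b_def)
    finally show ?thesis .
  qed
  have contQ: "continuous_on {0..2*pi} Q" unfolding Q_def using N by (intro continuous_intros) auto
  \<comment> \<open>The unimodular factor shifts the moments by one, so that the zeroth moment of
    \<open>Q\<close> becomes the first of f.\<close>
  define f where "f t = cis (- t) * of_real (Q t)" for t
  have "L1_norm f = (LINT t:{0..2*pi}|lebesgue. Q t)"
    unfolding L1_norm_def f_def using nn by (simp add: norm_mult)
  also have "complex_of_real \<dots> = mom (\<lambda>t. of_real (Q t)) 0"
    unfolding mom_def by (simp add: set_integral_complex_of_real)
  also have "\<dots> = 1" unfolding momQ using N by (simp add: \<kappa>_def divdiff_def)
  finally have "L1_norm f = 1" by (simp only: of_real_eq_1_iff)
  moreover have "f \<in> L1_circle"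
    unfolding f_def using contQ by (intro L1_circle_continuous continuous_intros)
  moreover have "mom f n = of_real (real (N - (n - 1)) / real N) * divdiff u v (n - 1)" if "n \<ge> 1" for n
  proof -
    have "mom f n = mom (\<lambda>t. of_real (Q t)) (n - 1)"
      unfolding mom_def f_def using that
      by (simp add: of_nat_diff mult.assoc[symmetric] cis_mult left_diff_distrib)
    then show ?thesis by (simp add: momQ \<kappa>_def)
  qed
  ultimately show ?thesis by (intro repI[of f]) auto
qed

section \<open>Fejer means of sesquilinear forms\<close>

text \<open>The Fejer kernel, not normalised, with the powers of L in place of characters; negative
  powers are replaced by adjoints, that is, by L acting on the second argument.\<close>

definition fejer_form ::
    "nat \<Rightarrow> complex \<Rightarrow> ('v \<Rightarrow> 'v) \<Rightarrow> ('v \<Rightarrow> 'v \<Rightarrow> complex) \<Rightarrow> 'v \<Rightarrow> 'v \<Rightarrow> complex" where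
  "fejer_form M z L q x y = of_nat M * q x y +
     (\<Sum>m=1..<M. of_nat (M - m) * (cnj z ^ m * q ((L ^^ m) x) y + z ^ m * q x ((L ^^ m) y)))"

definition linear_map_on :: "'v::{real_vector,scaleC} set \<Rightarrow> ('v \<Rightarrow> 'v) \<Rightarrow> bool" where
  "linear_map_on V L \<longleftrightarrow> (\<forall>x\<in>V. L x \<in> V) \<and> (\<forall>x\<in>V. \<forall>y\<in>V. L (x + y) = L x + L y) \<and>
     (\<forall>c. \<forall>x\<in>V. L (c *\<^sub>C x) = c *\<^sub>C L x)"

lemma linear_map_on_funpow: "linear_map_on V L \<Longrightarrow> linear_map_on V (L ^^ m)"
  by (induction m) (auto simp: linear_map_on_def)

lemma linear_map_onD:
  assumes "linear_map_on V L"
  shows "x \<in> V \<Longrightarrow> L x \<in> V" "x \<in> V \<Longrightarrow> y \<in> V \<Longrightarrow> L (x + y) = L x + L y"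
    "x \<in> V \<Longrightarrow> L (c *\<^sub>C x) = c *\<^sub>C L x"
  using assms by (auto simp: linear_map_on_def)

text \<open>
  Positivity comes from the identity that equates the Fejer mean with a sum of the squares
  \<open>q (s k) (s k) - q (z * L (s k)) (z * L (s k))\<close>, where \<open>s k\<close> are the geometric sums.
\<close>

lemma fejer_form_nonneg:
  assumes q: "psd_form V q" and V: "csub V" and L: "linear_map_on V L"
    and contr: "\<And>x. x \<in> V \<Longrightarrow> Re (q (L x) (L x)) \<le> Re (q x x)"
    and z: "cmod z = 1" and x: "x \<in> V"
  shows "0 \<le> Re (fejer_form M z L q x x)"
proof -
  define K where "K y = cnj z *\<^sub>C L y" for y
  define s where "s = rec_nat x (\<lambda>_ y. x + K y)"
  have s_simps: "s 0 = x" "s (Suc N) = x + K (s N)" for N by (simp_all add: s_def)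
  have KV: "K y \<in> V" if "y \<in> V" for y
    unfolding K_def using that by (intro csubD(2)[OF V] linear_map_onD(1)[OF L])
  have sV: "s N \<in> V" for N
    by (induction N) (simp_all add: s_simps x csubD(1)[OF V] KV)
  have Kc: "Re (q (K y) (K y)) \<le> Re (q y y)" if "y \<in> V" for y
  proof -
    have Ly: "L y \<in> V" using that by (rule linear_map_onD(1)[OF L])
    have "q (K y) (K y) = (z * cnj z) * q (L y) (L y)"
      unfolding K_def
      by (simp add: psd_formD(2)[OF q] psd_form_right(2)[OF q V] csubD(2)[OF V] Ly)
    then show ?thesis
      using contr[OF that] z by (simp add: complex_norm_square[symmetric])
  qed
  define a where "a m = Re (cnj z ^ m * q ((L ^^ m) x) x)" for m
  have Lm: "(L ^^ m) x \<in> V" for m using linear_map_onD(1)[OF linear_map_on_funpow[OF L]] x by blast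
  have qs: "Re (cnj z ^ k * q ((L ^^ k) (s N)) x) = (\<Sum>m=k..N + k. a m)" for N k
  proof (induction N arbitrary: k)
    case 0
    then show ?case by (simp add: s_simps a_def)
  next
    case (Suc N)
    note Lk = linear_map_on_funpow[OF L, of k]
    have "q ((L ^^ k) (s (Suc N))) x = q ((L ^^ k) x) x + cnj z * q ((L ^^ Suc k) (s N)) x"
    proof -
      have Ls: "L (s N) \<in> V" by (rule linear_map_onD(1)[OF L sV])
      have mem: "(L ^^ k) x \<in> V" "(L ^^ k) (L (s N)) \<in> V"
        using linear_map_onD(1)[OF Lk] x Ls by auto
      have "(L ^^ k) (s (Suc N)) = (L ^^ k) x + cnj z *\<^sub>C (L ^^ k) (L (s N))"
        unfolding s_simps using linear_map_onD(2)[OF Lk x KV[OF sV]] linear_map_onD(3)[OF Lk Ls]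
        by (simp add: K_def)
      then show ?thesis
        using psd_formD(1)[OF q mem(1) csubD(2)[OF V mem(2)] x] psd_formD(2)[OF q mem(2) x]
        by (simp add: funpow_swap1)
    qed
    then have "Re (cnj z ^ k * q ((L ^^ k) (s (Suc N))) x)
        = a k + Re (cnj z ^ Suc k * q ((L ^^ Suc k) (s N)) x)"
      by (simp add: a_def algebra_simps del: funpow.simps times_complex.sel)
    also have "\<dots> = a k + (\<Sum>m=Suc k..N + Suc k. a m)" by (simp only: Suc.IH)
    also have "\<dots> = (\<Sum>m=k..Suc N + k. a m)" by (subst (2) sum.atLeast_Suc_atMost) auto
    finally show ?case .
  qed
  have id: "real N * a 0 + 2 * (\<Sum>m=1..<N. real (N - m) * a m) =
      (if N = 0 then 0 else Re (q (s (N - 1)) (s (N - 1)))) +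
      (\<Sum>k<N - 1. Re (q (s k) (s k)) - Re (q (K (s k)) (K (s k))))" for N
  proof (induction N)
    case (Suc N)
    show ?case
    proof (cases N)
      case 0
      then show ?thesis by (simp add: a_def s_simps)
    next
      case (Suc N')
      define y where "y = s N'"
      have y: "y \<in> V" "K y \<in> V" using sV KV by (auto simp: y_def)
      have "q (s N) (s N) = q (K y) (K y) + q x (s N) + q (s N) x - q x x"
        unfolding Suc s_simps y_def[symmetric] using x y csubD(1)[OF V x y(2)]
        by (simp add: psd_formD(1)[OF q] psd_form_right(1)[OF q V])
      then have 1: "Re (q (s N) (s N)) = Re (q (K y) (K y)) + 2 * Re (q (s N) x) - Re (q x x)"
        using psd_formD(3)[OF q x sV[of N]] by simp
      have 2: "Re (q (s N) x) = a 0 + (\<Sum>m=1..N. a m)"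
        using qs[of 0 N] by (simp add: sum.atLeast_Suc_atMost)
      have "(\<Sum>m=1..<Suc N. real (Suc N - m) * a m) = (\<Sum>m=1..<Suc N. real (N - m) * a m + a m)"
        by (intro sum.cong) (auto simp: of_nat_diff algebra_simps)
      also have "\<dots> = (\<Sum>m=1..<N. real (N - m) * a m) + (\<Sum>m=1..N. a m)"
        by (simp add: sum.distrib atLeastLessThanSuc_atLeastAtMost Suc sum.atLeastLessThan_Suc)
      finally have "real (Suc N) * a 0 + 2 * (\<Sum>m=1..<Suc N. real (Suc N - m) * a m)
          = (real N * a 0 + 2 * (\<Sum>m=1..<N. real (N - m) * a m)) + a 0 + 2 * (\<Sum>m=1..N. a m)"
        by (simp add: algebra_simps)
      also have "\<dots> = Re (q y y) + (\<Sum>k<N'. Re (q (s k) (s k)) - Re (q (K (s k)) (K (s k)))) +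
          a 0 + 2 * (\<Sum>m=1..N. a m)"
        unfolding Suc.IH by (simp add: Suc y_def)
      also have "\<dots> = Re (q (s N) (s N)) + (\<Sum>k<N. Re (q (s k) (s k)) - Re (q (K (s k)) (K (s k))))"
        using 1 2 by (simp add: Suc a_def y_def)
      finally show ?thesis by simp
    qed
  qed simp
  have "Re (fejer_form M z L q x x) = real M * a 0 + 2 * (\<Sum>m=1..<M. real (M - m) * a m)"
  proof -
    have conj: "z ^ m * q x ((L ^^ m) x) = cnj (cnj z ^ m * q ((L ^^ m) x) x)" for m
      using psd_formD(3)[OF q Lm[of m] x] by simp
    have re: "Re (of_nat k * (w + cnj w)) = 2 * (real k * Re w)" for k and w :: complex
      by simp
    have "Re (fejer_form M z L q x x) = real M * Re (q x x) + (\<Sum>m=1..<M. 2 * (real (M - m) * a m))"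
      unfolding fejer_form_def conj plus_complex.sel Re_sum re a_def by simp
    then show ?thesis by (simp add: sum_distrib_left a_def)
  qed
  also have "\<dots> \<ge> 0"
    unfolding id using psd_formD(4)[OF q sV] Kc[OF sV] by (auto intro!: add_nonneg_nonneg sum_nonneg)
  finally show ?thesis .
qed

text \<open>Closure under the construction allows the mean for right multiplication to be formed on
  top of the one for left multiplication.\<close>

lemma psd_fejer_form:
  assumes q: "psd_form V q" and V: "csub V" and L: "linear_map_on V L"
    and contr: "\<And>x. x \<in> V \<Longrightarrow> Re (q (L x) (L x)) \<le> Re (q x x)"
    and z: "cmod z = 1"
  shows "psd_form V (fejer_form M z L q)"
  unfolding psd_form_def
proof (intro conjI ballI allI)
  note Lm = linear_map_onD[OF linear_map_on_funpow[OF L]]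
  fix x y w c assume x: "x \<in> V" and y: "y \<in> V"
  show "fejer_form M z L q (c *\<^sub>C x) y = c * fejer_form M z L q x y"
    unfolding fejer_form_def using x y
    by (simp add: Lm psd_formD(2)[OF q] distrib_left sum_distrib_left mult_ac)
  have "q y ((L ^^ m) x) = cnj (q ((L ^^ m) x) y)" "q ((L ^^ m) y) x = cnj (q x ((L ^^ m) y))" for m
    using Lm(1) x y psd_formD(3)[OF q] by blast+
  then show "fejer_form M z L q y x = cnj (fejer_form M z L q x y)"
    unfolding fejer_form_def using psd_formD(3)[OF q x y] by (simp add: add.commute)
  assume w: "w \<in> V"
  show "fejer_form M z L q (x + y) w = fejer_form M z L q x w + fejer_form M z L q y w"
    unfolding fejer_form_def using x y w
    by (simp add: Lm psd_formD(1)[OF q] distrib_left sum.distrib)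
qed (rule fejer_form_nonneg[OF assms])

section \<open>Discrete Fourier inversion at roots of unity\<close>

definition unity_root :: "nat \<Rightarrow> nat \<Rightarrow> complex" where
  "unity_root P x = cis (2 * pi * real x / real P)"

lemma unity_root_sum:
  assumes "n < P"
  shows "(\<Sum>x<P. unity_root P x ^ n) = (if n = 0 then of_nat P else 0)"
proof (cases "n = 0")
  case False
  define w where "w = cis (2 * pi * real n / real P)"
  have pw: "unity_root P x ^ n = w ^ x" for x
    by (simp add: unity_root_def w_def Complex.DeMoivre mult.commute mult.left_commute)
  have "w \<noteq> 1"
  proof
    assume "w = 1"
    then have "cos (2 * pi * real n / real P) = 1"
      by (simp add: w_def complex_eq_iff)
    then obtain k :: int where "2 * pi * real n / real P = of_int k * 2 * pi"
      using cos_one_2pi_int by blast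
    then have "real n = of_int k * real P" using assms by (simp add: field_simps)
    then have "int n = k * int P" by (metis of_int_eq_iff of_int_mult of_int_of_nat_eq)
    moreover have "0 < int n" "int n < int P" using False assms by auto
    ultimately show False
      using mult_nonpos_nonneg[of k "int P"] mult_right_mono[of 1 k "int P"] by linarith
  qed
  moreover have "w ^ P = 1"
  proof -
    have "real P * (2 * pi * real n / real P) = 2 * pi * real n" using assms by simp
    then show ?thesis
      using cis_multiple_2pi[of "real n"] by (simp only: w_def Complex.DeMoivre) simp
  qed
  ultimately show ?thesis using False unfolding pw by (simp add: geometric_sum)
qed simp

lemma unity_root_norm: "cmod (unity_root P x) = 1"
  by (simp add: unity_root_def)

lemma unity_root_sum_cnj:
  assumes "k < P" "m < P"
  shows "(\<Sum>x<P. unity_root P x ^ k * cnj (unity_root P x) ^ m) = (if k = m then of_nat P else 0)"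
proof -
  have inv: "unity_root P x * cnj (unity_root P x) = 1" for x
    using complex_norm_square[of "unity_root P x"] by (simp add: unity_root_norm)
  show ?thesis
  proof (cases "m \<le> k")
    case True
    have "unity_root P x ^ k * cnj (unity_root P x) ^ m = unity_root P x ^ (k - m)" for x
    proof -
      have "unity_root P x ^ k = unity_root P x ^ (k - m) * unity_root P x ^ m"
        using True by (simp flip: power_add)
      then show ?thesis by (simp only: mult.assoc inv power_one mult_1_right flip: power_mult_distrib)
    qed
    then show ?thesis using assms True unity_root_sum[of "k - m" P] by auto
  next
    case False
    have "unity_root P x ^ k * cnj (unity_root P x) ^ m = cnj (unity_root P x ^ (m - k))" for x
    proof -
      have "cnj (unity_root P x) ^ m = cnj (unity_root P x) ^ k * cnj (unity_root P x) ^ (m - k)"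
        using False by (simp flip: power_add)
      then show ?thesis
        by (simp only: mult.assoc[symmetric] inv power_one mult_1_left complex_cnj_power
            flip: power_mult_distrib)
    qed
    then show ?thesis using assms False arg_cong[OF unity_root_sum[of "m - k" P], of cnj] by simp
  qed
qed

lemma sum_swap3: "(\<Sum>x\<in>X. \<Sum>y\<in>Y. \<Sum>j\<in>J. f x y j) = (\<Sum>j\<in>J. \<Sum>x\<in>X. \<Sum>y\<in>Y. f x y j)"
proof -
  have "(\<Sum>x\<in>X. \<Sum>y\<in>Y. \<Sum>j\<in>J. f x y j) = (\<Sum>x\<in>X. \<Sum>j\<in>J. \<Sum>y\<in>Y. f x y j)"
    by (intro sum.cong refl sum.swap)
  also have "\<dots> = (\<Sum>j\<in>J. \<Sum>x\<in>X. \<Sum>y\<in>Y. f x y j)" by (rule sum.swap)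
  finally show ?thesis .
qed

text \<open>Orthogonality of characters isolates the k-th power. The order 2M exceeds k + m for all
  k, m < M, so the adjoint terms, with exponent k + m \<ge> 1, average to zero; order M would let
  them alias.\<close>

lemma fejer_form_average:
  assumes "k < M"
  shows "(\<Sum>x<2*M. unity_root (2*M) x ^ k * fejer_form M (unity_root (2*M) x) L q u v)
    = of_nat (2 * M) * of_nat (M - k) * q ((L ^^ k) u) v"
proof -
  define r where "r = unity_root (2 * M)"
  have "r x ^ k * fejer_form M (r x) L q u v = r x ^ k * (of_nat M * q u v) +
      (\<Sum>m=1..<M. of_nat (M - m) * (r x ^ k * cnj (r x) ^ m * q ((L ^^ m) u) v + r x ^ (k + m) * q u ((L ^^ m) v)))" for x
    unfolding fejer_form_def distrib_left sum_distrib_left power_add by (simp add: mult_ac)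
  then have "(\<Sum>x<2*M. r x ^ k * fejer_form M (r x) L q u v)
      = (\<Sum>x<2*M. r x ^ k) * (of_nat M * q u v) +
        (\<Sum>x<2*M. \<Sum>m=1..<M. of_nat (M - m) * (r x ^ k * cnj (r x) ^ m * q ((L ^^ m) u) v + r x ^ (k + m) * q u ((L ^^ m) v)))"
    by (simp only: sum.distrib sum_distrib_right)
  also have "(\<Sum>x<2*M. \<Sum>m=1..<M. of_nat (M - m) * (r x ^ k * cnj (r x) ^ m * q ((L ^^ m) u) v + r x ^ (k + m) * q u ((L ^^ m) v)))
      = (\<Sum>m=1..<M. of_nat (M - m) * ((\<Sum>x<2*M. r x ^ k * cnj (r x) ^ m) * q ((L ^^ m) u) v +
           (\<Sum>x<2*M. r x ^ (k + m)) * q u ((L ^^ m) v)))"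
    by (subst sum.swap) (simp only: sum_distrib_left sum_distrib_right sum.distrib distrib_left)
  finally have "(\<Sum>x<2*M. r x ^ k * fejer_form M (r x) L q u v)
      = (\<Sum>x<2*M. r x ^ k) * (of_nat M * q u v) +
        (\<Sum>m=1..<M. of_nat (M - m) * ((\<Sum>x<2*M. r x ^ k * cnj (r x) ^ m) * q ((L ^^ m) u) v +
           (\<Sum>x<2*M. r x ^ (k + m)) * q u ((L ^^ m) v)))" .
  also have "\<dots> = (if k = 0 then of_nat (2 * M) else 0) * (of_nat M * q u v) +
        (\<Sum>m=1..<M. if m = k then of_nat (M - k) * of_nat (2 * M) * q ((L ^^ k) u) v else 0)"
    unfolding r_def using assms unity_root_sum[of k "2 * M"]
    by (intro arg_cong2[of _ _ _ _ "(+)"] sum.cong)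
      (auto simp: unity_root_sum_cnj unity_root_sum)
  also have "\<dots> = of_nat (2 * M) * of_nat (M - k) * q ((L ^^ k) u) v"
    using assms by (cases "k = 0") auto
  finally show ?thesis by (simp add: r_def)
qed

text \<open>
  Iterating the Cauchy--Schwarz inequality gives
  \<open>q (G x) x ^ (2 ^ n) \<le> q x x ^ (2 ^ n - 1) * q ((G ^^ (2 ^ n)) x) x\<close> for \<open>G = R' \<circ> R\<close>.
\<close>

lemma psd_form_contractionI:
  assumes q: "psd_form V q" and V: "csub V"
    and R: "\<And>x. x \<in> V \<Longrightarrow> R x \<in> V" and R': "\<And>x. x \<in> V \<Longrightarrow> R' x \<in> V"
    and adj: "\<And>x y. x \<in> V \<Longrightarrow> y \<in> V \<Longrightarrow> q (R x) y = q x (R' y)"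
    and x: "x \<in> V" and bnd: "\<And>k. Re (q (((\<lambda>y. R' (R y)) ^^ k) x) x) \<le> C"
  shows "Re (q (R x) (R x)) \<le> Re (q x x)"
proof -
  define G where "G y = R' (R y)" for y
  define g where "g k = (G ^^ k) x" for k
  define a where "a k = Re (q (g k) x)" for k
  have GV: "G y \<in> V" if "y \<in> V" for y using R R' that by (simp add: G_def)
  have gV: "g k \<in> V" for k unfolding g_def by (induction k) (auto simp: x GV)
  have sym: "q (G u) v = q u (G v)" if "u \<in> V" "v \<in> V" for u v
  proof -
    have "q (G u) v = cnj (q v (R' (R u)))"
      unfolding G_def using that R R' psd_formD(3)[OF q] by blast
    also have "\<dots> = cnj (q (R v) (R u))" using adj[of v "R u"] that R by simp
    also have "\<dots> = q (R u) (R v)" using that R psd_formD(3)[OF q, of "R v" "R u"] by simp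
    also have "\<dots> = q u (G v)" using adj[of u "R v"] that R by (simp add: G_def)
    finally show ?thesis .
  qed
  have symk: "q (g (k + l)) x = q (g l) (g k)" for k l
  proof (induction k arbitrary: l)
    case (Suc k)
    have "q (g (Suc k + l)) x = q (g (Suc l)) (g k)" using Suc[of "Suc l"] by simp
    also have "\<dots> = q (g l) (g (Suc k))" using sym[OF gV gV, of l k] by (simp add: g_def)
    finally show ?case .
  qed (simp add: g_def)
  have sq: "(a k)\<^sup>2 \<le> a 0 * a (2 * k)" for k
  proof -
    have "(a k)\<^sup>2 \<le> (cmod (q (g k) x))\<^sup>2"
      unfolding a_def by (rule abs_le_square_iff[THEN iffD1]) (simp add: abs_Re_le_cmod)
    also have "\<dots> \<le> Re (q (g k) (g k)) * Re (q x x)"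
      by (rule psd_form_cauchy_schwarz[OF q V gV x])
    also have "q (g k) (g k) = q (g (2 * k)) x" using symk[of k k] by (simp add: mult_2)
    finally show ?thesis by (simp add: a_def g_def mult.commute)
  qed
  have a0: "a 0 \<ge> 0" using psd_formD(4)[OF q x] by (simp add: a_def g_def)
  have a1: "a 1 = Re (q (R x) (R x))"
    using sym[OF x x] adj[OF x R[OF x]] by (simp add: a_def g_def G_def)
  have a1nn: "a 1 \<ge> 0" unfolding a1 using psd_formD(4)[OF q R[OF x]] .
  have iter: "a 1 ^ (2 ^ n) \<le> a 0 ^ (2 ^ n - 1) * a (2 ^ n)" for n
  proof (induction n)
    case (Suc n)
    have "a 1 ^ (2 ^ Suc n) = (a 1 ^ (2 ^ n))\<^sup>2" by (simp add: power_mult mult.commute flip: power_mult)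
    also have "\<dots> \<le> (a 0 ^ (2 ^ n - 1) * a (2 ^ n))\<^sup>2"
      using Suc a1nn by (intro power_mono) auto
    also have "\<dots> = a 0 ^ (2 * (2 ^ n - 1)) * (a (2 ^ n))\<^sup>2"
      by (simp add: power_mult_distrib power_mult mult.commute flip: power_mult)
    also have "\<dots> \<le> a 0 ^ (2 * (2 ^ n - 1)) * (a 0 * a (2 ^ Suc n))"
      using sq[of "2 ^ n"] a0 by (intro mult_left_mono) auto
    also have "\<dots> = a 0 ^ Suc (2 * (2 ^ n - 1)) * a (2 ^ Suc n)" by simp
    also have "Suc (2 * (2 ^ n - 1)) = 2 ^ Suc n - 1"
    proof -
      have "(1::nat) \<le> 2 ^ n" by simp
      then show ?thesis unfolding power_Suc by linarith
    qed
    finally show ?case .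
  qed simp
  have "a 1 \<le> a 0"
  proof (rule ccontr)
    assume "\<not> a 1 \<le> a 0"
    then have lt: "a 0 < a 1" by simp
    have "a 0 \<noteq> 0"
    proof
      assume "a 0 = 0"
      then have "(a 1)\<^sup>2 \<le> 0" using sq[of 1] by simp
      then show False using lt \<open>a 0 = 0\<close> by simp
    qed
    with a0 have a0p: "a 0 > 0" by simp
    \<comment> \<open>A ratio above 1 would have unbounded powers, against the bound C on the
      iterates.\<close>
    obtain n where n: "C / a 0 < (a 1 / a 0) ^ n"
      using real_arch_pow[of "a 1 / a 0" "C / a 0"] lt a0p by auto
    have "n \<le> 2 ^ n" by (simp add: less_imp_le)
    then have "(a 1 / a 0) ^ n \<le> (a 1 / a 0) ^ (2 ^ n)"
      using lt a0p by (intro power_increasing) auto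
    also have "\<dots> = a 1 ^ (2 ^ n) / a 0 ^ (2 ^ n)" by (simp add: power_divide)
    also have "\<dots> \<le> a 0 ^ (2 ^ n - 1) * a (2 ^ n) / a 0 ^ (2 ^ n)"
      using iter a0p by (intro divide_right_mono) auto
    also have "a 0 ^ (2 ^ n) = a 0 ^ (2 ^ n - 1) * a 0"
      by (metis power_minus_mult zero_less_numeral zero_less_power)
    also have "a 0 ^ (2 ^ n - 1) * a (2 ^ n) / (a 0 ^ (2 ^ n - 1) * a 0) = a (2 ^ n) / a 0"
      using a0p by simp
    also have "\<dots> \<le> C / a 0"
      using bnd[of "2 ^ n"] a0p by (intro divide_right_mono) (auto simp: a_def g_def G_def[abs_def])
    finally show False using n by simp
  qed
  then show ?thesis unfolding a1 by (simp add: a_def g_def)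
qed

section \<open>Hilbert--Schmidt Lipschitz estimate for contractions\<close>

lemma pow_op_simps [simp]: "pow_op T 0 = id_blinfun" "pow_op T (Suc n) = T o\<^sub>L pow_op T n"
  by (simp_all add: pow_op_def)

lemma pow_op_Suc_right: "pow_op T (Suc n) = pow_op T n o\<^sub>L T"
proof (induction n)
  case (Suc n)
  have "pow_op T (Suc (Suc n)) = T o\<^sub>L (pow_op T n o\<^sub>L T)" using Suc by simp
  also have "\<dots> = pow_op T (Suc n) o\<^sub>L T" by (simp add: compose_assoc)
  finally show ?case .
qed simp

lemma pow_op_add: "pow_op T (m + n) = pow_op T m o\<^sub>L pow_op T n"
  by (induction m) (simp_all add: compose_assoc)

lemma clinear_pow_op [simp, intro]: "clinear_op T \<Longrightarrow> clinear_op (pow_op T n)"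
  by (induction n) auto

lemma norm_pow_op_le: "norm (pow_op T n) \<le> norm T ^ n"
proof (induction n)
  case (Suc n)
  then show ?case
    using norm_blinfun_compose[of T "pow_op T n"] mult_left_mono[OF Suc, of "norm T"] by simp
qed (simp add: norm_blinfun_id_le)

lemma contraction_pow: "contraction_op T \<Longrightarrow> contraction_op (pow_op T n)"
  unfolding contraction_op_def using norm_pow_op_le[of T n] power_le_one[of "norm T" n] by auto

lemma funpow_compose_left: "((\<lambda>Y. T o\<^sub>L Y) ^^ m) Y = pow_op T m o\<^sub>L Y"
  by (induction m) (simp_all add: compose_assoc)

lemma funpow_compose_right: "((\<lambda>Y. Y o\<^sub>L S) ^^ m) Y = Y o\<^sub>L pow_op S m"
proof (induction m)
  case (Suc m)
  then show ?case by (simp only: funpow.simps o_apply pow_op_Suc_right compose_assoc)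
qed simp

lemma pow_op_diff:
  "pow_op T n - pow_op S n = (\<Sum>j<n. pow_op T j o\<^sub>L (T - S) o\<^sub>L pow_op S (n - 1 - j))"
proof (induction n)
  case (Suc n)
  have "pow_op T (Suc n) - pow_op S (Suc n)
      = (pow_op T n o\<^sub>L (T - S)) + ((pow_op T n - pow_op S n) o\<^sub>L S)"
    unfolding pow_op_Suc_right by (simp add: compose_simps)
  also have "(pow_op T n - pow_op S n) o\<^sub>L S
      = (\<Sum>j<n. pow_op T j o\<^sub>L (T - S) o\<^sub>L pow_op S (n - 1 - j) o\<^sub>L S)"
    unfolding Suc
    by (rule bounded_bilinear.sum_left[OF bounded_bilinear_blinfun_compose])
  also have "\<dots> = (\<Sum>j<n. pow_op T j o\<^sub>L (T - S) o\<^sub>L pow_op S (n - j))"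
  proof (rule sum.cong[OF refl])
    fix j assume "j \<in> {..<n}"
    then have "n - j = Suc (n - 1 - j)" by auto
    then show "pow_op T j o\<^sub>L (T - S) o\<^sub>L pow_op S (n - 1 - j) o\<^sub>L S = pow_op T j o\<^sub>L (T - S) o\<^sub>L pow_op S (n - j)"
      by (simp only: pow_op_Suc_right compose_assoc)
  qed
  finally show ?case by simp
qed simp

context hilbert_basis
begin

lemma contraction_hsn:
  assumes "contraction_op T" "hs Y"
  shows "hs (T o\<^sub>L Y)" "hsn (T o\<^sub>L Y) \<le> hsn Y" "hs (Y o\<^sub>L T)" "hsn (Y o\<^sub>L T) \<le> hsn Y"
  using assms hsn_compose_left[of T Y] hsn_compose_right[of T Y]
    mult_right_mono[of "norm T" 1 "hsn Y"] mult_left_mono[of "norm T" 1 "hsn Y"]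
  by (auto simp: contraction_op_def hs_compose_left hs_compose_right)

lemma contraction_adj: "contraction_op T \<Longrightarrow> contraction_op (adj (T :: 'a \<Rightarrow>\<^sub>L 'a))"
  by (simp add: contraction_op_def norm_adj)

lemma linear_map_compose_left: "clinear_op T \<Longrightarrow> linear_map_on (Collect hs) (\<lambda>Y. T o\<^sub>L Y)"
  by (auto simp: linear_map_on_def hs_compose_left compose_simps compose_scaleC)

lemma linear_map_compose_right: "clinear_op S \<Longrightarrow> linear_map_on (Collect hs) (\<lambda>Y. Y o\<^sub>L S)"
  by (auto simp: linear_map_on_def hs_compose_right compose_simps compose_scaleC)

section \<open>Fejer forms of left and right multiplication\<close>

definition left_form :: "nat \<Rightarrow> complex \<Rightarrow> ('a \<Rightarrow>\<^sub>L 'a) \<Rightarrow> ('a \<Rightarrow>\<^sub>L 'a) \<Rightarrow> ('a \<Rightarrow>\<^sub>L 'a) \<Rightarrow> complex" where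
  "left_form M z T = fejer_form M z (\<lambda>Y. T o\<^sub>L Y) hsi"

definition two_sided_form ::
    "nat \<Rightarrow> complex \<Rightarrow> complex \<Rightarrow> ('a \<Rightarrow>\<^sub>L 'a) \<Rightarrow> ('a \<Rightarrow>\<^sub>L 'a) \<Rightarrow> ('a \<Rightarrow>\<^sub>L 'a) \<Rightarrow> ('a \<Rightarrow>\<^sub>L 'a) \<Rightarrow> complex" where
  "two_sided_form M z w T S = fejer_form M w (\<lambda>Y. Y o\<^sub>L S) (left_form M z T)"

lemma Re_hsi_self: "hs Y \<Longrightarrow> Re (hsi Y Y) = (hsn Y)\<^sup>2"
  by (simp add: hsi_self)

lemma psd_left_form:
  assumes T: "contraction_op T" and z: "cmod z = 1"
  shows "psd_form (Collect hs) (left_form M z T)"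
  unfolding left_form_def
proof (rule psd_fejer_form[OF psd_hsi csub_hs _ _ z])
  show "linear_map_on (Collect hs) (\<lambda>Y. T o\<^sub>L Y)"
    using T by (intro linear_map_compose_left) (simp add: contraction_op_def)
  fix Y assume "Y \<in> Collect hs"
  then show "Re (hsi (T o\<^sub>L Y) (T o\<^sub>L Y)) \<le> Re (hsi Y Y)"
    using contraction_hsn[OF T] by (simp add: Re_hsi_self power_mono)
qed

text \<open>Left multiplication by T commutes with right multiplication by S, so the Hilbert-Schmidt
  adjoint of the latter is also its adjoint for this form.\<close>

lemma left_form_adj:
  assumes T: "clinear_op T" and S: "clinear_op S" and Y: "hs Y" and Z: "hs Z"
  shows "left_form M z T (Y o\<^sub>L S) Z = left_form M z T Y (Z o\<^sub>L adj S)"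
proof -
  have "hsi (pow_op T m o\<^sub>L (Y o\<^sub>L S)) Z = hsi (pow_op T m o\<^sub>L Y) (Z o\<^sub>L adj S)" for m
    using hsi_compose_right[of S "pow_op T m o\<^sub>L Y" Z] assms by (simp add: compose_assoc hs_compose_left)
  moreover have "hsi (Y o\<^sub>L S) (pow_op T m o\<^sub>L Z) = hsi Y (pow_op T m o\<^sub>L (Z o\<^sub>L adj S))" for m
    using hsi_compose_right[of S Y "pow_op T m o\<^sub>L Z"] assms by (simp add: compose_assoc hs_compose_left)
  ultimately show ?thesis
    using hsi_compose_right[OF S Y Z] by (simp add: left_form_def fejer_form_def funpow_compose_left)
qed

text \<open>The size of the constant is immaterial: it serves only as the bound, uniform in the
  iterate, that \<open>psd_form_contractionI\<close> asks for.\<close>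

lemma norm_left_form_le:
  assumes T: "contraction_op T" and z: "cmod z = 1" and Y: "hs Y" and Z: "hs Z"
  shows "cmod (left_form M z T Y Z) \<le> (real M + (\<Sum>m=1..<M. real (M - m) * 2)) * (hsn Y * hsn Z)"
proof -
  note Tm = contraction_hsn[OF contraction_pow[OF T]]
  have le: "cmod (hsi U W) \<le> hsn Y * hsn Z" if "hs U" "hs W" "hsn U \<le> hsn Y" "hsn W \<le> hsn Z" for U W
    using norm_hsi_le[OF that(1,2)] mult_mono[OF that(3,4)] by simp
  have "cmod (left_form M z T Y Z) \<le> cmod (of_nat M * hsi Y Z) +
      (\<Sum>m=1..<M. cmod (of_nat (M - m) * (cnj z ^ m * hsi (pow_op T m o\<^sub>L Y) Z + z ^ m * hsi Y (pow_op T m o\<^sub>L Z))))"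
    unfolding left_form_def fejer_form_def funpow_compose_left
    by (rule order_trans[OF norm_triangle_ineq]) (intro add_left_mono norm_sum)
  also have "\<dots> \<le> real M * (hsn Y * hsn Z) + (\<Sum>m=1..<M. real (M - m) * (2 * (hsn Y * hsn Z)))"
  proof (intro add_mono sum_mono)
    show "cmod (of_nat M * hsi Y Z) \<le> real M * (hsn Y * hsn Z)"
      using le[OF Y Z] by (simp add: norm_mult mult_left_mono)
    fix m
    have "cmod (cnj z ^ m * hsi (pow_op T m o\<^sub>L Y) Z + z ^ m * hsi Y (pow_op T m o\<^sub>L Z))
        \<le> 1 * (hsn Y * hsn Z) + 1 * (hsn Y * hsn Z)"
      by (rule order_trans[OF norm_triangle_ineq])
        (intro add_mono; simp add: norm_mult norm_power z le Tm[OF Y] Tm[OF Z] Y Z)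
    then show "cmod (of_nat (M - m) * (cnj z ^ m * hsi (pow_op T m o\<^sub>L Y) Z + z ^ m * hsi Y (pow_op T m o\<^sub>L Z)))
        \<le> real (M - m) * (2 * (hsn Y * hsn Z))"
      unfolding norm_mult norm_of_nat by (intro mult_left_mono) auto
  qed
  also have "\<dots> = (real M + (\<Sum>m=1..<M. real (M - m) * 2)) * (hsn Y * hsn Z)"
    by (simp only: distrib_right sum_distrib_right mult.assoc)
  finally show ?thesis .
qed

text \<open>Right multiplication by S must be contractive for \<open>left_form\<close>, not just for
  the Hilbert-Schmidt norm. It has an adjoint for that form, and bounded iterates of the product
  with this adjoint suffice.\<close>

lemma psd_two_sided_form:
  assumes T: "contraction_op T" and S: "contraction_op S" and z: "cmod z = 1" and w: "cmod w = 1"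
  shows "psd_form (Collect hs) (two_sided_form M z w T S)"
  unfolding two_sided_form_def
proof (rule psd_fejer_form[OF psd_left_form[OF T z] csub_hs _ _ w])
  have cT: "clinear_op T" and cS: "clinear_op S" using T S by (auto simp: contraction_op_def)
  show "linear_map_on (Collect hs) (\<lambda>Y. Y o\<^sub>L S)"
    using cS by (rule linear_map_compose_right)
  fix Y assume "Y \<in> Collect hs"
  then have Y: "hs Y" by simp
  show "Re (left_form M z T (Y o\<^sub>L S) (Y o\<^sub>L S)) \<le> Re (left_form M z T Y Y)"
  proof (rule psd_form_contractionI[OF psd_left_form[OF T z] csub_hs, where R' = "\<lambda>Y. Y o\<^sub>L adj S"])
    fix k
    \<comment> \<open>The iterates do not grow in Hilbert-Schmidt norm, and this norm controls
      \<open>left_form\<close>.\<close>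
    have it: "hs (((\<lambda>y. y o\<^sub>L S o\<^sub>L adj S) ^^ k) Y) \<and> hsn (((\<lambda>y. y o\<^sub>L S o\<^sub>L adj S) ^^ k) Y) \<le> hsn Y"
    proof (induction k)
      case (Suc k)
      define W where "W = ((\<lambda>y. y o\<^sub>L S o\<^sub>L adj S) ^^ k) Y"
      have W: "hs W" "hsn W \<le> hsn Y" using Suc by (auto simp: W_def)
      have "hs (W o\<^sub>L S)" "hsn (W o\<^sub>L S) \<le> hsn W" using contraction_hsn[OF S W(1)] by auto
      moreover have "hs (W o\<^sub>L S o\<^sub>L adj S)" "hsn (W o\<^sub>L S o\<^sub>L adj S) \<le> hsn (W o\<^sub>L S)"
        using contraction_hsn[OF contraction_adj[OF S] \<open>hs (W o\<^sub>L S)\<close>] by auto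
      ultimately show ?case using W(2) by (simp add: W_def[symmetric])
    qed (simp add: Y)
    define W where "W = ((\<lambda>y. y o\<^sub>L S o\<^sub>L adj S) ^^ k) Y"
    have "Re (left_form M z T W Y) \<le> (real M + (\<Sum>m=1..<M. real (M - m) * 2)) * (hsn W * hsn Y)"
      using norm_left_form_le[OF T z, of W Y M] it Y complex_Re_le_cmod order_trans
      unfolding W_def by blast
    also have "\<dots> \<le> (real M + (\<Sum>m=1..<M. real (M - m) * 2)) * (hsn Y * hsn Y)"
      using it unfolding W_def[symmetric] by (intro mult_left_mono mult_right_mono add_nonneg_nonneg sum_nonneg) auto
    finally show "Re (left_form M z T (((\<lambda>y. y o\<^sub>L S o\<^sub>L adj S) ^^ k) Y) Y) \<le>
        (real M + (\<Sum>m=1..<M. real (M - m) * 2)) * (hsn Y * hsn Y)" by (simp add: W_def)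
  qed (use Y cT cS in \<open>auto simp: left_form_adj hs_compose_right\<close>)
qed

lemma two_sided_form_average:
  assumes "j < M" "k < M"
  shows "(\<Sum>x<2*M. \<Sum>y<2*M. unity_root (2*M) x ^ j * unity_root (2*M) y ^ k *
      two_sided_form M (unity_root (2*M) x) (unity_root (2*M) y) T S D Z)
    = (of_nat (2 * M))\<^sup>2 * of_nat (M - j) * of_nat (M - k) * hsi (pow_op T j o\<^sub>L D o\<^sub>L pow_op S k) Z"
proof -
  define r where "r = unity_root (2 * M)"
  have "(\<Sum>x<2*M. \<Sum>y<2*M. r x ^ j * r y ^ k * two_sided_form M (r x) (r y) T S D Z)
      = (\<Sum>x<2*M. r x ^ j * (of_nat (2 * M) * of_nat (M - k) * left_form M (r x) T (D o\<^sub>L pow_op S k) Z))"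
    unfolding two_sided_form_def mult.assoc sum_distrib_left[symmetric] r_def
    using assms(2) by (simp only: fejer_form_average funpow_compose_right mult.assoc)
  also have "\<dots> = of_nat (2 * M) * of_nat (M - k) * (\<Sum>x<2*M. r x ^ j * left_form M (r x) T (D o\<^sub>L pow_op S k) Z)"
    unfolding sum_distrib_left by (intro sum.cong refl) (simp add: mult_ac)
  also have "\<dots> = of_nat (2 * M) * of_nat (M - k) * (of_nat (2 * M) * of_nat (M - j) * hsi (pow_op T j o\<^sub>L (D o\<^sub>L pow_op S k)) Z)"
    unfolding left_form_def r_def using assms(1) by (simp only: fejer_form_average funpow_compose_left)
  finally show ?thesis by (simp add: r_def power2_eq_square compose_assoc mult_ac)
qed

text \<open>\<open>divdiff\<close> of degree n - 1 with u and v replaced by left multiplication by T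
  and right multiplication by S, applied to D and paired with Z. The weights \<alpha> absorb the
  damping of the discrete averages; \<alpha> = 1 is the quantity of interest.\<close>

definition dd :: "('a \<Rightarrow>\<^sub>L 'a) \<Rightarrow> ('a \<Rightarrow>\<^sub>L 'a) \<Rightarrow> (nat \<Rightarrow> nat \<Rightarrow> complex) \<Rightarrow> ('a \<Rightarrow>\<^sub>L 'a) \<Rightarrow> ('a \<Rightarrow>\<^sub>L 'a) \<Rightarrow> nat \<Rightarrow> complex" where
  "dd T S \<alpha> D Z n = (\<Sum>j<n. \<alpha> j (n - 1 - j) * hsi (pow_op T j o\<^sub>L D o\<^sub>L pow_op S (n - 1 - j)) Z) / of_nat n"

text \<open>The argument is n - 1 because of the shift of moments by one: the weight is 1 at n = 1
  (for N > 0) and 0 for n > N.\<close>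

definition fejer_weight :: "nat \<Rightarrow> nat \<Rightarrow> complex" where
  "fejer_weight N n = of_real (real (N - (n - 1)) / real N)"

lemma fejer_weight_le: "cmod (fejer_weight N n) \<le> 1"
  by (cases "N = 0") (auto simp: fejer_weight_def norm_divide)

text \<open>\<open>q x y D Z / A\<close> is the mass that a discrete product of semispectral
  measures puts on the node (r x, r y). Each node contributes a kernel of norm at most 1, and the
  masses are summable because the quadratic forms add up to A times the squared norm.\<close>

lemma rep_dd_discrete:
  assumes T: "contraction_op T" and S: "contraction_op S" and D: "hs D" and Z: "hs Z"
    and N: "1 \<le> N" "N \<le> M"
  shows "rep (\<lambda>n. fejer_weight N n * dd T S (\<lambda>j k. of_real (real (M - j) / real M * (real (M - k) / real M))) D Z n)
    (((hsn D)\<^sup>2 + (hsn Z)\<^sup>2) / 2)"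
proof -
  define r where "r = unity_root (2 * M)"
  define q where "q x y = two_sided_form M (r x) (r y) T S" for x y
  \<comment> \<open>The normalising factor of \<open>two_sided_form_average\<close> at j = k = 0:
    (2M)^2 nodes and a factor M from each Fejer mean.\<close>
  define A where "A = (2 * real M * real M)\<^sup>2"
  have M: "M > 0" using N by simp
  then have A: "A > 0" by (simp add: A_def)
  have psd: "psd_form (Collect hs) (q x y)" for x y
    unfolding q_def r_def by (intro psd_two_sided_form T S unity_root_norm)
  have tot: "(\<Sum>x<2*M. \<Sum>y<2*M. Re (q x y Y Y)) = A * (hsn Y)\<^sup>2" if Y: "hs Y" for Y
  proof -
    have "(\<Sum>x<2*M. \<Sum>y<2*M. q x y Y Y) = (of_nat (2 * M))\<^sup>2 * of_nat M * of_nat M * hsi Y Y"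
      using two_sided_form_average[of 0 M 0 T S Y Y] M by (simp add: q_def r_def)
    also have "\<dots> = of_real (A * (hsn Y)\<^sup>2)"
      by (simp add: hsi_self[OF Y] A_def power2_eq_square)
    finally show ?thesis by (simp flip: Re_sum)
  qed
  have "rep (\<lambda>n. \<Sum>x<2*M. \<Sum>y<2*M. (q x y D Z / A) * (fejer_weight N n * divdiff (r x) (r y) (n - 1)))
      (\<Sum>x<2*M. \<Sum>y<2*M. cmod (q x y D Z / A) * 1)"
    unfolding fejer_weight_def r_def
    by (intro rep_sum rep_cmult rep_divdiff unity_root_norm N) auto
  moreover have "(\<Sum>x<2*M. \<Sum>y<2*M. cmod (q x y D Z / A) * 1) \<le> ((hsn D)\<^sup>2 + (hsn Z)\<^sup>2) / 2"
  proof -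
    have "(\<Sum>x<2*M. \<Sum>y<2*M. cmod (q x y D Z / A) * 1) \<le>
        (\<Sum>x<2*M. \<Sum>y<2*M. (Re (q x y D D) + Re (q x y Z Z)) / 2 / A)"
    proof (intro sum_mono)
      fix x y
      have "cmod (q x y D Z) \<le> (Re (q x y D D) + Re (q x y Z Z)) / 2"
        using psd_form_am_gm[OF psd csub_hs, of D Z] D Z by simp
      from divide_right_mono[OF this less_imp_le[OF A]]
      show "cmod (q x y D Z / A) * 1 \<le> (Re (q x y D D) + Re (q x y Z Z)) / 2 / A"
        using A by (simp only: norm_divide norm_of_real abs_of_pos mult_1_right)
    qed
    also have "\<dots> = ((\<Sum>x<2*M. \<Sum>y<2*M. Re (q x y D D)) + (\<Sum>x<2*M. \<Sum>y<2*M. Re (q x y Z Z))) / 2 / A"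
      by (simp add: sum_divide_distrib sum.distrib add_divide_distrib)
    also have "\<dots> = ((hsn D)\<^sup>2 + (hsn Z)\<^sup>2) / 2"
      unfolding tot[OF D] tot[OF Z] using A by (simp add: field_simps)
    finally show ?thesis .
  qed
  ultimately have R: "rep (\<lambda>n. \<Sum>x<2*M. \<Sum>y<2*M. (q x y D Z / A) * (fejer_weight N n * divdiff (r x) (r y) (n - 1)))
      (((hsn D)\<^sup>2 + (hsn Z)\<^sup>2) / 2)"
    by (rule rep_mono)
  show ?thesis
  proof (rule rep_cong[OF R])
    fix n :: nat assume n: "n \<ge> 1"
    show "fejer_weight N n * dd T S (\<lambda>j k. of_real (real (M - j) / real M * (real (M - k) / real M))) D Z n
      = (\<Sum>x<2*M. \<Sum>y<2*M. (q x y D Z / A) * (fejer_weight N n * divdiff (r x) (r y) (n - 1)))"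
    proof (cases "n \<le> N")
      case False
      then have "fejer_weight N n = 0" by (simp add: fejer_weight_def)
      then show ?thesis by simp
    next
      case True
      have "(\<Sum>x<2*M. \<Sum>y<2*M. q x y D Z * divdiff (r x) (r y) (n - 1))
          = (\<Sum>x<2*M. \<Sum>y<2*M. \<Sum>j<n. (r x ^ j * r y ^ (n - 1 - j) * q x y D Z) / of_nat n)"
      proof (intro sum.cong refl)
        fix x y
        have "{..n - 1} = {..<n}" "Suc (n - 1) = n" using n by auto
        then show "q x y D Z * divdiff (r x) (r y) (n - 1) = (\<Sum>j<n. (r x ^ j * r y ^ (n - 1 - j) * q x y D Z) / of_nat n)"
          by (simp only: divdiff_def sum_distrib_left sum_divide_distrib times_divide_eq_right mult_ac)
      qed
      also have "\<dots> = (\<Sum>j<n. (\<Sum>x<2*M. \<Sum>y<2*M. r x ^ j * r y ^ (n - 1 - j) * q x y D Z) / of_nat n)"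
        unfolding sum_divide_distrib by (rule sum_swap3)
      \<comment> \<open>Since n \<le> N \<le> M, both exponents lie below M, as the averaging
        requires.\<close>
      also have "\<dots> = (\<Sum>j<n. ((of_nat (2 * M))\<^sup>2 * of_nat (M - j) * of_nat (M - (n - 1 - j)) *
          hsi (pow_op T j o\<^sub>L D o\<^sub>L pow_op S (n - 1 - j)) Z) / of_nat n)"
        unfolding q_def r_def using True N n by (intro sum.cong refl) (subst two_sided_form_average, auto)
      also have "\<dots> = of_real A * dd T S (\<lambda>j k. of_real (real (M - j) / real M * (real (M - k) / real M))) D Z n"
        unfolding dd_def sum_divide_distrib sum_distrib_left A_def using M
        by (intro sum.cong refl) (simp add: power2_eq_square field_simps)
      finally have eq: "(\<Sum>x<2*M. \<Sum>y<2*M. q x y D Z * divdiff (r x) (r y) (n - 1))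
          = of_real A * dd T S (\<lambda>j k. of_real (real (M - j) / real M * (real (M - k) / real M))) D Z n" .
      have "(\<Sum>x<2*M. \<Sum>y<2*M. (q x y D Z / A) * (fejer_weight N n * divdiff (r x) (r y) (n - 1)))
          = fejer_weight N n / of_real A * (\<Sum>x<2*M. \<Sum>y<2*M. q x y D Z * divdiff (r x) (r y) (n - 1))"
        unfolding sum_distrib_left by (intro sum.cong refl) simp
      also have "\<dots> = fejer_weight N n * dd T S (\<lambda>j k. of_real (real (M - j) / real M * (real (M - k) / real M))) D Z n"
        unfolding eq using A by simp
      finally show ?thesis by simp
    qed
  qed
qed

lemma norm_hsi_word_le:
  assumes "contraction_op T" "contraction_op S" "hs D" "hs Z"
  shows "hs (pow_op T j o\<^sub>L D o\<^sub>L pow_op S k)"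
    and "cmod (hsi (pow_op T j o\<^sub>L D o\<^sub>L pow_op S k) Z) \<le> hsn D * hsn Z"
proof -
  have W: "hs (pow_op T j o\<^sub>L D)" "hsn (pow_op T j o\<^sub>L D) \<le> hsn D"
    using contraction_hsn[OF contraction_pow[OF assms(1)] assms(3)] by auto
  then show W': "hs (pow_op T j o\<^sub>L D o\<^sub>L pow_op S k)"
    using contraction_hsn[OF contraction_pow[OF assms(2)]] by auto
  have "hsn (pow_op T j o\<^sub>L D o\<^sub>L pow_op S k) \<le> hsn D"
    using contraction_hsn(4)[OF contraction_pow[OF assms(2)] W(1)] W(2) by (rule order_trans)
  then show "cmod (hsi (pow_op T j o\<^sub>L D o\<^sub>L pow_op S k) Z) \<le> hsn D * hsn Z"
    using norm_hsi_le[OF W' assms(4)] mult_right_mono[of _ "hsn D" "hsn Z"] by (meson hsn_nonneg order_trans)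
qed

lemma norm_dd_le:
  assumes "contraction_op T" "contraction_op S" "hs D" "hs Z"
    and \<alpha>: "\<And>j k. j + k < n \<Longrightarrow> cmod (\<alpha> j k) \<le> c" and n: "n \<ge> 1"
  shows "cmod (dd T S \<alpha> D Z n) \<le> c * (hsn D * hsn Z)"
proof -
  have c: "0 \<le> c" using order_trans[OF norm_ge_zero \<alpha>[of 0 0]] n by simp
  have "cmod (\<Sum>j<n. \<alpha> j (n - 1 - j) * hsi (pow_op T j o\<^sub>L D o\<^sub>L pow_op S (n - 1 - j)) Z)
      \<le> (\<Sum>j<n. c * (hsn D * hsn Z))"
  proof (rule sum_norm_le)
    fix j assume "j \<in> {..<n}"
    then have "j + (n - 1 - j) < n" by auto
    then show "cmod (\<alpha> j (n - 1 - j) * hsi (pow_op T j o\<^sub>L D o\<^sub>L pow_op S (n - 1 - j)) Z) \<le> c * (hsn D * hsn Z)"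
      unfolding norm_mult using c by (intro mult_mono \<alpha> norm_hsi_word_le assms(1-4)) auto
  qed
  also have "\<dots> = real n * (c * (hsn D * hsn Z))" by simp
  finally show ?thesis using n by (simp add: dd_def norm_divide field_simps)
qed

lemma dd_diff_coeff:
  "dd T S \<alpha> D Z n - dd T S \<beta> D Z n = dd T S (\<lambda>j k. \<alpha> j k - \<beta> j k) D Z n"
  unfolding dd_def diff_divide_distrib[symmetric] sum_subtractf[symmetric] left_diff_distrib ..

text \<open>Invariance under opposite rescaling of the two arguments, used to turn the bound by a
  sum of squares into a product.\<close>

lemma dd_scale:
  assumes "contraction_op T" "contraction_op S" "hs D" "hs Z" "t \<noteq> 0"
  shows "dd T S \<alpha> (of_real t *\<^sub>C D) (of_real (1 / t) *\<^sub>C Z) n = dd T S \<alpha> D Z n"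
proof -
  have "hsi (pow_op T j o\<^sub>L (of_real t *\<^sub>C D) o\<^sub>L pow_op S k) (of_real (1 / t) *\<^sub>C Z)
      = hsi (pow_op T j o\<^sub>L D o\<^sub>L pow_op S k) Z" for j k
    using assms norm_hsi_word_le(1)[OF assms(1-4), of j k]
    by (simp add: compose_scaleC contraction_op_def hsi_scaleC_left hsi_scaleC_right hs_scaleC)
  then show ?thesis by (simp add: dd_def)
qed

text \<open>M tends to infinity with N fixed. Only n \<le> N contribute, which gives 1/n decay with
  constant \<open>B * N\<close>, and on these n the damping tends to 1 uniformly.\<close>

lemma rep_dd_finite:
  assumes T: "contraction_op T" and S: "contraction_op S" and D: "hs D" and Z: "hs Z" and N: "1 \<le> N"
  shows "rep (\<lambda>n. fejer_weight N n * dd T S (\<lambda>j k. 1) D Z n) (((hsn D)\<^sup>2 + (hsn Z)\<^sup>2) / 2)"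
proof -
  define B where "B = hsn D * hsn Z"
  have B: "B \<ge> 0" by (simp add: B_def)
  have bound: "cmod (fejer_weight N n * w) \<le> B * real N / real n" if "n \<ge> 1" "cmod w \<le> B" for n w
  proof (cases "n \<le> N")
    case True
    have "cmod (fejer_weight N n * w) \<le> 1 * B"
      unfolding norm_mult using that B by (intro mult_mono fejer_weight_le) auto
    also have "\<dots> \<le> B * (real N / real n)"
      using True that B mult_left_mono[of 1 "real N / real n" B] by simp
    finally show ?thesis by simp
  qed (use B in \<open>simp add: fejer_weight_def\<close>)
  show ?thesis
  proof (rule rep_limit)
    fix n :: nat assume n: "n \<ge> 1"
    show "cmod (fejer_weight N n * dd T S (\<lambda>j k. 1) D Z n) \<le> B * real N / real n"
      using norm_dd_le[OF T S D Z _ n, of "\<lambda>j k. 1" 1] by (intro bound n) (simp add: B_def)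
  next
    fix N' and \<delta> :: real assume "\<delta> > 0"
    obtain M0 :: nat where M0: "B * real N / \<delta> < real M0" using reals_Archimedean2 by blast
    define M where "M = max M0 N"
    have M: "M \<ge> N" "M > 0" "B * real N / \<delta> < real M" using M0 N by (auto simp: M_def)
    define \<alpha> :: "nat \<Rightarrow> nat \<Rightarrow> complex" where "\<alpha> j k = of_real (real (M - j) / real M * (real (M - k) / real M))" for j k
    have fr: "0 \<le> real (M - j) / real M" "real (M - j) / real M \<le> 1" for j
      using M(2) by auto
    have fr2: "0 \<le> real (M - j) / real M * (real (M - k) / real M)"
      "real (M - j) / real M * (real (M - k) / real M) \<le> 1" for j k
      by (rule mult_nonneg_nonneg[OF fr(1) fr(1)], rule mult_le_one[OF fr(2) fr(1) fr(2)])
    have \<alpha>1: "cmod (\<alpha> j k) \<le> 1" for j k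
      unfolding \<alpha>_def norm_of_real abs_of_nonneg[OF fr2(1)] by (rule fr2)
    \<comment> \<open>1 - (1 - j/M) (1 - k/M) is at most (j + k) / M.\<close>
    have \<alpha>2: "cmod (1 - \<alpha> j k) \<le> real N / real M" if "j + k < n" "n \<le> N" for j k n
    proof -
      have jk: "real (M - j) = real M - real j" "real (M - k) = real M - real k" "j + k \<le> N"
        using that M by (auto simp: of_nat_diff)
      have "1 - real (M - j) / real M * (real (M - k) / real M) = (real j + real k) / real M - real j * real k / (real M * real M)"
        unfolding jk using M(2) by (simp add: field_simps)
      also have "\<dots> \<le> real N / real M"
      proof -
        have "(real j + real k) / real M \<le> real N / real M"
          using jk(3) by (intro divide_right_mono) (auto simp flip: of_nat_add)
        moreover have "0 \<le> real j * real k / (real M * real M)" by simp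
        ultimately show ?thesis by linarith
      qed
      finally have "1 - real (M - j) / real M * (real (M - k) / real M) \<le> real N / real M" .
      moreover have "1 - \<alpha> j k = of_real (1 - real (M - j) / real M * (real (M - k) / real M))" by (simp add: \<alpha>_def)
      moreover have "0 \<le> 1 - real (M - j) / real M * (real (M - k) / real M)"
        using fr2(2)[of j k] by linarith
      ultimately show ?thesis by (simp only: norm_of_real abs_of_nonneg)
    qed
    show "\<exists>d. rep d (((hsn D)\<^sup>2 + (hsn Z)\<^sup>2) / 2) \<and> (\<forall>n\<ge>1. cmod (d n) \<le> B * real N / real n) \<and>
        (\<forall>n. 1 \<le> n \<and> n < N' \<longrightarrow> cmod (fejer_weight N n * dd T S (\<lambda>j k. 1) D Z n - d n) \<le> \<delta>)"
    proof (intro exI[of _ "\<lambda>n. fejer_weight N n * dd T S \<alpha> D Z n"] conjI allI impI)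
      show "rep (\<lambda>n. fejer_weight N n * dd T S \<alpha> D Z n) (((hsn D)\<^sup>2 + (hsn Z)\<^sup>2) / 2)"
        unfolding \<alpha>_def[abs_def] by (rule rep_dd_discrete[OF T S D Z N M(1)])
      fix n :: nat assume n: "1 \<le> n"
      show "cmod (fejer_weight N n * dd T S \<alpha> D Z n) \<le> B * real N / real n"
        using norm_dd_le[OF T S D Z \<alpha>1 n] by (intro bound n) (simp add: B_def)
    next
      fix n assume n: "1 \<le> n \<and> n < N'"
      show "cmod (fejer_weight N n * dd T S (\<lambda>j k. 1) D Z n - fejer_weight N n * dd T S \<alpha> D Z n) \<le> \<delta>"
      proof (cases "n \<le> N")
        case True
        have "cmod (fejer_weight N n * dd T S (\<lambda>j k. 1) D Z n - fejer_weight N n * dd T S \<alpha> D Z n)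
            = cmod (fejer_weight N n) * cmod (dd T S (\<lambda>j k. 1 - \<alpha> j k) D Z n)"
          by (simp add: dd_diff_coeff norm_mult flip: right_diff_distrib)
        also have "\<dots> \<le> 1 * (real N / real M * (hsn D * hsn Z))"
          using n True \<alpha>2 by (intro mult_mono fejer_weight_le norm_dd_le[OF T S D Z]) auto
        also have "\<dots> \<le> \<delta>"
          using M \<open>\<delta> > 0\<close> by (simp add: B_def[symmetric] field_simps)
        finally show ?thesis .
      qed (use \<open>\<delta> > 0\<close> in \<open>simp add: fejer_weight_def\<close>)
    qed
  qed
qed

text \<open>Optimising the sum of squares over rescalings of D and Z gives the product. If a norm
  vanishes no rescaling exists, but then the moments vanish too.\<close>

lemma rep_dd_finite_product:
  assumes T: "contraction_op T" and S: "contraction_op S" and D: "hs D" and Z: "hs Z" and N: "1 \<le> N"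
  shows "rep (\<lambda>n. fejer_weight N n * dd T S (\<lambda>j k. 1) D Z n) (hsn D * hsn Z)"
proof (cases "hsn D = 0 \<or> hsn Z = 0")
  case True
  have "dd T S (\<lambda>j k. 1) D Z n = 0" if "n \<ge> 1" for n
    using norm_dd_le[OF T S D Z _ that, of "\<lambda>j k. 1" 1] True by auto
  then show ?thesis using True by (intro rep_cong[OF rep_zero[THEN rep_mono]]) auto
next
  case False
  then have pos: "hsn D > 0" "hsn Z > 0" using hsn_nonneg[of D] hsn_nonneg[of Z] by linarith+
  \<comment> \<open>This t gives both rescaled operators the same norm.\<close>
  define t where "t = sqrt (hsn Z / hsn D)"
  have t: "t > 0" "t\<^sup>2 = hsn Z / hsn D" using pos by (auto simp: t_def)
  have R: "rep (\<lambda>n. fejer_weight N n * dd T S (\<lambda>j k. 1) (of_real t *\<^sub>C D) (of_real (1/t) *\<^sub>C Z) n)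
      (((hsn (of_real t *\<^sub>C D))\<^sup>2 + (hsn (of_real (1/t) *\<^sub>C Z))\<^sup>2) / 2)"
    by (intro rep_dd_finite T S N hs_scaleC D Z)
  have "(hsn (of_real t *\<^sub>C D))\<^sup>2 \<le> (t * hsn D)\<^sup>2"
    using hsn_scaleC[OF D, of "of_real t"] t by (intro power_mono) auto
  also have "\<dots> = hsn D * hsn Z"
    unfolding power_mult_distrib t(2) using pos by (simp add: power2_eq_square)
  finally have 1: "(hsn (of_real t *\<^sub>C D))\<^sup>2 \<le> hsn D * hsn Z" .
  have "(hsn (of_real (1/t) *\<^sub>C Z))\<^sup>2 \<le> (1/t * hsn Z)\<^sup>2"
    using hsn_scaleC[OF Z, of "of_real (1/t)"] t by (intro power_mono) (auto simp: norm_divide)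
  also have "\<dots> = hsn D * hsn Z"
    unfolding power_mult_distrib power_divide t(2) using pos by (simp add: power2_eq_square)
  finally have 2: "(hsn (of_real (1/t) *\<^sub>C Z))\<^sup>2 \<le> hsn D * hsn Z" .
  show ?thesis
    using rep_mono[OF R, of "hsn D * hsn Z"] 1 2 t dd_scale[OF T S D Z, of t] by simp
qed

text \<open>N tends to infinity. The Fejer weights are at most 1 and preserve the assumed decay, so
  \<open>rep_limit\<close> applies with a constant independent of N.\<close>

lemma rep_dd_bounded:
  assumes T: "contraction_op T" and S: "contraction_op S" and D: "hs D" and Z: "hs Z"
    and C: "\<And>n. n \<ge> 1 \<Longrightarrow> cmod (dd T S (\<lambda>j k. 1) D Z n) \<le> C / real n"
  shows "rep (dd T S (\<lambda>j k. 1) D Z) (hsn D * hsn Z)"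
proof (rule rep_limit[OF C])
  fix N' and \<delta> :: real assume "\<delta> > 0"
  define g where "g = dd T S (\<lambda>j k. 1) D Z"
  have "0 \<le> C" using C[of 1] norm_ge_zero[of "dd T S (\<lambda>j k. 1) D Z 1"] by linarith
  obtain N0 :: nat where N0: "C / \<delta> < real N0" using reals_Archimedean2 by blast
  define N where "N = max (max N0 N') 1"
  have N: "N \<ge> 1" "C / \<delta> < real N" "N' \<le> N" using N0 by (auto simp: N_def)
  show "\<exists>d. rep d (hsn D * hsn Z) \<and> (\<forall>n\<ge>1. cmod (d n) \<le> C / real n) \<and>
      (\<forall>n. 1 \<le> n \<and> n < N' \<longrightarrow> cmod (dd T S (\<lambda>j k. 1) D Z n - d n) \<le> \<delta>)"
  proof (intro exI[of _ "\<lambda>n. fejer_weight N n * dd T S (\<lambda>j k. 1) D Z n"] conjI allI impI)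
    show "rep (\<lambda>n. fejer_weight N n * dd T S (\<lambda>j k. 1) D Z n) (hsn D * hsn Z)"
      by (rule rep_dd_finite_product[OF T S D Z N(1)])
    fix n :: nat assume n: "1 \<le> n"
    show "cmod (fejer_weight N n * dd T S (\<lambda>j k. 1) D Z n) \<le> C / real n"
      unfolding norm_mult
      using mult_mono[OF fejer_weight_le C[OF n] zero_le_one norm_ge_zero] by simp
  next
    fix n assume n: "1 \<le> n \<and> n < N'"
    have w: "fejer_weight N n = of_real (1 - (real n - 1) / real N)"
      using n N by (simp add: fejer_weight_def of_nat_diff field_simps)
    have "g n - fejer_weight N n * g n = of_real ((real n - 1) / real N) * g n"
      unfolding w by (simp add: algebra_simps)
    then have "cmod (g n - fejer_weight N n * g n) = (real n - 1) / real N * cmod (g n)"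
      using n by (simp add: norm_mult norm_divide del: of_real_divide of_real_diff)
    \<comment> \<open>The defect of the weight grows with n exactly as fast as the moments decay,
      leaving C / N.\<close>
    also have "\<dots> \<le> real n / real N * (C / real n)"
      using n N C[of n] by (intro mult_mono divide_right_mono) (auto simp: g_def)
    also have "\<dots> \<le> \<delta>" using n N \<open>\<delta> > 0\<close> by (simp add: field_simps)
    finally show "cmod (dd T S (\<lambda>j k. 1) D Z n - fejer_weight N n * dd T S (\<lambda>j k. 1) D Z n) \<le> \<delta>"
      by (simp add: g_def)
  qed
qed

section \<open>From divided differences to differences of powers\<close>

lemma hs_pow_diff:
  assumes "contraction_op T" "contraction_op S" "hs (T - S)"
  shows "hs (pow_op T n - pow_op S n)"
  unfolding pow_op_diff using assms by (intro hs_sum norm_hsi_word_le(1)) (auto simp: hs_zero)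

lemma dd_diff:
  assumes "contraction_op T" "contraction_op S" "hs (T - S)" "hs Z"
  shows "dd T S (\<lambda>j k. 1) (T - S) Z n = hsi (pow_op T n - pow_op S n) Z / of_nat n"
proof -
  have "hsi (\<Sum>j\<in>I. pow_op T j o\<^sub>L (T - S) o\<^sub>L pow_op S (n - 1 - j)) Z
      = (\<Sum>j\<in>I. hsi (pow_op T j o\<^sub>L (T - S) o\<^sub>L pow_op S (n - 1 - j)) Z)" if "finite I" for I
    using that
  proof (induction I rule: finite_induct)
    case empty
    show ?case using hsi_scaleC_left[OF hs_zero assms(4), of 0] by (simp add: hsi_def cinner_simps)
  next
    case (insert j I)
    then show ?case
      using norm_hsi_word_le(1)[OF assms]
      by (simp add: hsi_add_left hs_sum assms(4))
  qed
  then show ?thesis by (simp add: dd_def pow_op_diff)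
qed

lemma hs_proj: "finite F \<Longrightarrow> F \<subseteq> E \<Longrightarrow> hs (proj F)"
  unfolding hs_def
proof
  assume F: "finite F" "F \<subseteq> E"
  show "(\<lambda>e. (norm (proj F e))\<^sup>2) summable_on E"
    by (rule finite_nonzero_values_imp_summable_on, rule finite_subset[OF _ F(1)])
      (use proj_onb[OF F(2,1)] in \<open>auto split: if_splits\<close>)
qed (rule clinear_proj)

text \<open>Uniformity in n comes from the operator norm of the power difference, at most 2; the
  projection supplies the Hilbert-Schmidt factor.\<close>

lemma hsi_finite_rank_bounded:
  assumes T: "contraction_op T" and S: "contraction_op S" and TS: "hs (T - S)" and Z: "hs Z"
    and F: "finite F" "F \<subseteq> E"
  shows "\<exists>C. \<forall>n. cmod (hsi (pow_op T n - pow_op S n) (Z o\<^sub>L proj F)) \<le> C"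
proof (intro exI allI)
  fix n
  define X where "X = pow_op T n - pow_op S n"
  have X: "hs X" unfolding X_def by (rule hs_pow_diff[OF T S TS])
  note P = hs_proj[OF F] hs_adj[OF hs_proj[OF F]]
  have "norm X \<le> 1 + 1"
    unfolding X_def using contraction_pow[OF T, of n] contraction_pow[OF S, of n]
    by (intro order_trans[OF norm_triangle_ineq4] add_mono) (auto simp: contraction_op_def)
  have "hsi X (Z o\<^sub>L proj F) = hsi (X o\<^sub>L adj (proj F)) Z"
    using hsi_compose_right[of "adj (proj F)" X Z] X Z by (simp add: clinear_proj)
  then have "cmod (hsi X (Z o\<^sub>L proj F)) \<le> hsn (X o\<^sub>L adj (proj F)) * hsn Z"
    using norm_hsi_le[OF hs_compose_left[OF hs_clinear[OF X] P(2)] Z] by simp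
  also have "\<dots> \<le> (norm X * hsn (adj (proj F))) * hsn Z"
    by (intro mult_right_mono hsn_compose_left hs_clinear[OF X] P) auto
  also have "\<dots> \<le> (2 * hsn (adj (proj F))) * hsn Z"
    using \<open>norm X \<le> 1 + 1\<close> by (intro mult_right_mono) auto
  finally show "cmod (hsi (pow_op T n - pow_op S n) (Z o\<^sub>L proj F)) \<le> (2 * hsn (adj (proj F))) * hsn Z"
    by (simp add: X_def)
qed

text \<open>
  Finite rank approximation of \<open>Z\<close> makes the moments decay like \<open>1 / n\<close>, so that they are
  the moments of an honest function and not merely of a measure.
\<close>

theorem rep_power_difference:
  assumes T: "contraction_op T" and S: "contraction_op S" and TS: "hs (T - S)" and Z: "hs Z"
  shows "rep (\<lambda>n. hsi (pow_op T n - pow_op S n) Z / of_nat n) (hsn (T - S) * hsn Z)"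
proof -
  define X where "X n = pow_op T n - pow_op S n" for n
  have X: "hs (X n)" for n unfolding X_def by (rule hs_pow_diff[OF T S TS])
  define d where "d = hsn (T - S)"
  define \<gamma> where "\<gamma> W n = hsi (X n) W / of_nat n" for W n
  have rep\<gamma>: "rep (\<gamma> W) (d * hsn W)" if W: "hs W" and C: "\<And>n. cmod (hsi (X n) W) \<le> C" for W C
  proof -
    have eq: "dd T S (\<lambda>j k. 1) (T - S) W = \<gamma> W"
      by (simp add: fun_eq_iff dd_diff[OF T S TS W] \<gamma>_def X_def)
    have "cmod (\<gamma> W n) \<le> C / real n" for n
      using C[of n] by (simp add: \<gamma>_def norm_divide divide_right_mono)
    then show ?thesis
      using rep_dd_bounded[OF T S TS W, of C] by (simp add: eq d_def)
  qed
  have "rep (\<gamma> Z) (d * hsn Z)"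
  proof (rule rep_limit_bound)
    fix \<epsilon> :: real assume "\<epsilon> > 0"
    \<comment> \<open>The first approximation costs d * \<epsilon>' beyond the target and the
      telescoped increments 4 * d * \<epsilon>'; the added 1 covers d = 0.\<close>
    define \<epsilon>' where "\<epsilon>' = \<epsilon> / (d * 5 + 1)"
    have d0: "0 \<le> d" by (simp add: d_def)
    have \<epsilon>': "\<epsilon>' > 0" "d * (5 * \<epsilon>') \<le> \<epsilon>"
      using \<open>\<epsilon> > 0\<close> d0 by (auto simp: \<epsilon>'_def field_simps add_pos_nonneg add_nonneg_pos)
    define e where "e k = \<epsilon>' * (1/2) ^ k" for k :: nat
    have e: "e k > 0" for k using \<epsilon>' by (simp add: e_def)
    have "\<forall>k. \<exists>F. finite F \<and> F \<subseteq> E \<and> hsn (Z - (Z o\<^sub>L proj F)) < e k"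
      using hs_finite_rank_approx[OF Z] e by blast
    then obtain F where F: "\<And>k. finite (F k)" "\<And>k. F k \<subseteq> E"
      and Fe: "\<And>k. hsn (Z - (Z o\<^sub>L proj (F k))) < e k" by metis
    define Y where "Y k = Z o\<^sub>L proj (F k)" for k
    have Y: "hs (Y k)" for k unfolding Y_def by (intro hs_compose_right clinear_proj Z)
    have minus_hsn: "hsn (P - Q) = hsn (Q - P)" for P Q
      unfolding hsn_def by (simp add: blinfun.diff_left norm_minus_commute)
    have YZ: "hsn (Y k - Z) \<le> e k" for k
      using Fe[of k] by (simp add: Y_def minus_hsn[of _ Z])
    have bnd: "\<exists>C. \<forall>n. cmod (hsi (X n) (Y k)) \<le> C" for k
      using hsi_finite_rank_bounded[OF T S TS Z F] by (simp add: Y_def X_def)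
    have "rep (\<gamma> Z) (d * (hsn Z + \<epsilon>') + d * (2 * \<epsilon>') * 2)"
    proof (rule rep_telescope[where r = "\<lambda>k. \<gamma> (Y k)"])
      have "hsn (Y 0) \<le> hsn Z + \<epsilon>'"
        using hsn_triangle[of Z "Y 0 - Z"] Z Y[of 0] YZ[of 0] by (simp add: hs_diff e_def)
      moreover obtain C where "\<And>n. cmod (hsi (X n) (Y 0)) \<le> C" using bnd[of 0] by blast
      ultimately show "rep (\<gamma> (Y 0)) (d * (hsn Z + \<epsilon>'))"
        using rep_mono[OF rep\<gamma>[OF Y] mult_left_mono[OF _ d0]] by blast
    next
      fix k
      have "hsn (Y (Suc k) - Y k) \<le> hsn (Y (Suc k) - Z) + hsn (Z - Y k)"
        using hsn_triangle[of "Y (Suc k) - Z" "Z - Y k"] Z Y by (simp add: hs_diff)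
      also have "\<dots> \<le> e k + e k"
        using YZ[of "Suc k"] YZ[of k] e[of k] by (simp add: minus_hsn[of Z] e_def)
      finally have le: "hsn (Y (Suc k) - Y k) \<le> 2 * e k" by simp
      obtain C1 C2 where C: "\<And>n. cmod (hsi (X n) (Y (Suc k))) \<le> C1" "\<And>n. cmod (hsi (X n) (Y k)) \<le> C2"
        using bnd by metis
      have "cmod (hsi (X n) (Y (Suc k) - Y k)) \<le> C1 + C2" for n
        using C[of n] norm_triangle_ineq4[of "hsi (X n) (Y (Suc k))" "hsi (X n) (Y k)"]
        by (simp add: hsi_diff_right X Y)
      from rep_mono[OF rep\<gamma>[OF hs_diff[OF Y Y] this] mult_left_mono[OF le d0]]
      show "rep (\<lambda>n. \<gamma> (Y (Suc k)) n - \<gamma> (Y k) n) (d * (2 * \<epsilon>') * (1/2) ^ k)"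
        by (simp add: \<gamma>_def[abs_def] e_def hsi_diff_right X Y diff_divide_distrib mult_ac)
    next
      show "(\<lambda>k. d * (2 * \<epsilon>') * (1/2) ^ k) sums (d * (2 * \<epsilon>') * 2)"
        using geometric_sums[of "1/2::real"] by (intro sums_mult) simp
      fix n :: nat assume n: "n \<ge> 1"
      show "(\<lambda>m. \<gamma> (Y m) n) \<longlonglongrightarrow> \<gamma> Z n"
      proof (rule LIM_zero_cancel, rule tendsto_norm_zero_cancel)
        have "(\<lambda>m. hsn (X n) * e m) \<longlonglongrightarrow> hsn (X n) * (\<epsilon>' * 0)"
          unfolding e_def by (intro tendsto_intros LIMSEQ_realpow_zero) auto
        then have lim: "(\<lambda>m. hsn (X n) * e m) \<longlonglongrightarrow> 0" by simp
        show "(\<lambda>m. cmod (\<gamma> (Y m) n - \<gamma> Z n)) \<longlonglongrightarrow> 0"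
        proof (rule tendsto_sandwich[OF _ _ tendsto_const lim])
          have "cmod (\<gamma> (Y m) n - \<gamma> Z n) \<le> hsn (X n) * e m" for m
          proof -
            have "cmod (\<gamma> (Y m) n - \<gamma> Z n) = cmod (hsi (X n) (Y m - Z)) / real n"
              by (simp add: \<gamma>_def hsi_diff_right X Y Z norm_divide flip: diff_divide_distrib)
            also have "\<dots> \<le> cmod (hsi (X n) (Y m - Z)) / 1"
              using n by (intro divide_left_mono) auto
            also have "\<dots> \<le> hsn (X n) * hsn (Y m - Z)"
              using norm_hsi_le[OF X hs_diff[OF Y Z]] by simp
            also have "\<dots> \<le> hsn (X n) * e m"
              using YZ[of m] by (intro mult_left_mono) auto
            finally show ?thesis .
          qed
          then show "\<forall>\<^sub>F m in sequentially. cmod (\<gamma> (Y m) n - \<gamma> Z n) \<le> hsn (X n) * e m" by simp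
        qed simp
      qed
    qed
    then show "rep (\<gamma> Z) (d * hsn Z + \<epsilon>)"
      using \<epsilon>' by (elim rep_mono) (simp add: algebra_simps)
  qed
  then show ?thesis by (simp add: \<gamma>_def[abs_def] X_def d_def)
qed

end

section \<open>The exponential path\<close>

instance chilbert_space \<subseteq> banach ..

lemma summable_exp_op:
  fixes X :: "'a::chilbert_space \<Rightarrow>\<^sub>L 'a"
  shows "summable (\<lambda>n. norm (pow_op X n /\<^sub>R fact n))"
proof (rule summable_comparison_test')
  show "summable (\<lambda>n. inverse (fact n) * norm X ^ n)" by (rule summable_exp)
  show "norm (norm (pow_op X n /\<^sub>R fact n)) \<le> inverse (fact n) * norm X ^ n" for n
    using norm_pow_op_le[of X n] by (simp add: mult_left_mono)
qed

lemma pow_op_scaleR: "pow_op (r *\<^sub>R X) n = r ^ n *\<^sub>R pow_op X n"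
  by (induction n) (auto intro!: blinfun_eqI simp: blinfun.bilinear_simps)

text \<open>The remainder has a factor X on either side of a bounded \<Psi>; for Hilbert-Schmidt X
  it is a product of two Hilbert-Schmidt operators, quadratically small in X.\<close>

lemma exp_op_second_order:
  fixes X :: "'a::chilbert_space \<Rightarrow>\<^sub>L 'a"
  assumes X: "clinear_op X"
  shows "\<exists>\<Psi>. clinear_op \<Psi> \<and> norm \<Psi> \<le> exp (norm X) \<and>
    exp_op X = id_blinfun + X + (X o\<^sub>L (\<Psi> o\<^sub>L X))"
proof -
  define \<psi> where "\<psi> n = pow_op X n /\<^sub>R fact (n + 2)" for n
  have le: "norm (\<psi> n) \<le> norm X ^ n /\<^sub>R fact n" for n
  proof -
    have "norm (\<psi> n) = norm (pow_op X n) / fact (n + 2)" by (simp add: \<psi>_def divide_inverse_commute)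
    also have "\<dots> \<le> norm X ^ n / fact n"
      by (intro frac_le norm_pow_op_le fact_mono) auto
    finally show ?thesis by (simp add: divide_inverse_commute)
  qed
  have se: "(\<lambda>n. norm X ^ n /\<^sub>R fact n) sums exp (norm X)" by (rule exp_converges)
  then have sn: "summable (\<lambda>n. norm (\<psi> n))"
    by (intro summable_comparison_test'[of _ 0 "\<lambda>n. norm (\<psi> n)"]) (use le in \<open>auto simp: sums_iff\<close>)
  then have s: "summable \<psi>" by (rule summable_norm_cancel)
  define \<Psi> where "\<Psi> = suminf \<psi>"
  have "norm \<Psi> \<le> (\<Sum>n. norm (\<psi> n))" unfolding \<Psi>_def by (rule summable_norm[OF sn])
  also have "\<dots> \<le> exp (norm X)" using suminf_le[OF le sn] se by (simp add: sums_iff)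
  finally have "norm \<Psi> \<le> exp (norm X)" .
  moreover have "clinear_op \<Psi>"
    unfolding clinear_op_def
  proof (intro allI)
    fix c x
    have ap: "\<Psi> y = (\<Sum>n. \<psi> n y)" "summable (\<lambda>n. \<psi> n y)" for y
      unfolding \<Psi>_def by (rule bounded_linear.suminf[OF blinfun.bounded_linear_left s],
        rule bounded_linear.summable[OF blinfun.bounded_linear_left s])
    have "\<psi> n (c *\<^sub>C x) = c *\<^sub>C \<psi> n x" for n
      unfolding \<psi>_def using X by (intro clinear_opD) auto
    then show "\<Psi> (c *\<^sub>C x) = c *\<^sub>C \<Psi> x"
      unfolding ap(1) using bounded_linear.suminf[OF bounded_linear_scaleC ap(2)] by simp
  qed
  moreover have "exp_op X = id_blinfun + X + (X o\<^sub>L (\<Psi> o\<^sub>L X))"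
  proof -
    have "exp_op X = (\<Sum>n. pow_op X (n + 2) /\<^sub>R fact (n + 2)) + (\<Sum>n<2. pow_op X n /\<^sub>R fact n)"
      unfolding exp_op_def by (rule suminf_split_initial_segment[OF summable_norm_cancel[OF summable_exp_op]])
    also have "(\<lambda>n. pow_op X (n + 2) /\<^sub>R fact (n + 2)) = (\<lambda>n. X o\<^sub>L (\<psi> n o\<^sub>L X))"
    proof
      fix n
      have "pow_op X (n + 2) = X o\<^sub>L (pow_op X n o\<^sub>L X)"
        by (simp only: pow_op_simps pow_op_Suc_right[symmetric] add_2_eq_Suc')
      then show "pow_op X (n + 2) /\<^sub>R fact (n + 2) = X o\<^sub>L (\<psi> n o\<^sub>L X)"
        unfolding \<psi>_def by (auto intro!: blinfun_eqI simp: blinfun.bilinear_simps)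
    qed
    also have "(\<Sum>n. X o\<^sub>L (\<psi> n o\<^sub>L X)) = X o\<^sub>L (\<Psi> o\<^sub>L X)"
      unfolding \<Psi>_def
      by (rule bounded_linear.suminf[OF bounded_linear_compose[OF
            bounded_bilinear.bounded_linear_right[OF bounded_bilinear_blinfun_compose]
            bounded_bilinear.bounded_linear_left[OF bounded_bilinear_blinfun_compose]] s, symmetric])
    finally show ?thesis by (simp add: numeral_2_eq_2 add.commute)
  qed
  ultimately show ?thesis by blast
qed

text \<open>Termwise differentiation on a ball around 0 containing s. The differentiated partial
  sums are B times the original ones with one term fewer, so a single uniform limit serves
  both.\<close>

lemma exp_op_has_vector_derivative:
  fixes B :: "'a::chilbert_space \<Rightarrow>\<^sub>L 'a"
  shows "((\<lambda>s. exp_op (s *\<^sub>R B)) has_vector_derivative (B o\<^sub>L exp_op (s *\<^sub>R B))) (at s)"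
proof -
  define R where "R = \<bar>s\<bar> + 1"
  define S where "S = ball (0::real) R"
  define U where "U s = exp_op (s *\<^sub>R B)" for s
  define f where "f n s = (s ^ n / fact n) *\<^sub>R pow_op B n" for n and s :: real
  define f' where "f' n s h = (h * (real n * s ^ (n - 1) / fact n)) *\<^sub>R pow_op B n" for n and s h :: real
  have U: "U s = (\<Sum>n. f n s)" for s
    unfolding U_def exp_op_def f_def pow_op_scaleR by (simp add: divide_inverse_commute)
  have ul: "uniform_limit S (\<lambda>n s. \<Sum>i<n. f i s) U sequentially"
    unfolding U[abs_def]
  proof (rule Weierstrass_m_test)
    fix n s assume "s \<in> S"
    then have "\<bar>s\<bar> \<le> R" by (simp add: S_def)
    have "norm (f n s) = \<bar>s\<bar> ^ n / fact n * norm (pow_op B n)"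
      by (simp add: f_def power_abs)
    also have "\<dots> \<le> R ^ n / fact n * norm B ^ n"
      using \<open>\<bar>s\<bar> \<le> R\<close> by (intro mult_mono divide_right_mono power_mono norm_pow_op_le) (auto simp: R_def)
    also have "\<dots> = inverse (fact n) * (R * norm B) ^ n"
      by (simp add: power_mult_distrib divide_inverse_commute)
    finally show "norm (f n s) \<le> inverse (fact n) * (R * norm B) ^ n" .
  qed (rule summable_exp)
  have shift: "(\<Sum>i<Suc m. f' i s h) = h *\<^sub>R (B o\<^sub>L (\<Sum>i<m. f i s))" for m s h
  proof -
    have "(\<Sum>i<Suc m. f' i s h) = (\<Sum>i<m. f' (Suc i) s h)"
      unfolding sum.lessThan_Suc_shift by (simp add: f'_def)
    also have "\<dots> = (\<Sum>i<m. h *\<^sub>R (B o\<^sub>L f i s))"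
    proof (rule sum.cong[OF refl])
      fix i
      have "real (Suc i) * s ^ i / fact (Suc i) = s ^ i / fact i"
        by (simp add: fact_Suc del: of_nat_Suc)
      then show "f' (Suc i) s h = h *\<^sub>R (B o\<^sub>L f i s)"
        unfolding f'_def f_def by (auto intro!: blinfun_eqI simp: blinfun.bilinear_simps simp del: fact_Suc of_nat_Suc)
    qed
    also have "\<dots> = h *\<^sub>R (B o\<^sub>L (\<Sum>i<m. f i s))"
      by (simp add: scaleR_sum_right[symmetric] bounded_bilinear.sum_right[OF bounded_bilinear_blinfun_compose])
    finally show ?thesis .
  qed
  have "\<exists>g. \<forall>x\<in>S. (\<lambda>n. f n x) sums g x \<and> (g has_derivative (\<lambda>h. h *\<^sub>R (B o\<^sub>L U x))) (at x within S)"
  proof (rule has_derivative_series[where f' = f'])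
    show "convex S" by (simp add: S_def)
    show "(f n has_derivative f' n x) (at x within S)" for n x
      unfolding f_def f'_def by (auto intro!: derivative_eq_intros simp: mult_ac)
    show "0 \<in> S" by (simp add: S_def R_def)
    show "(\<lambda>n. f n 0) sums (\<Sum>n<1. f n 0)"
      by (rule sums_finite) (auto simp: f_def power_0_left)
    fix e :: real assume "e > 0"
    define d where "d = e / (norm B + 1)"
    have "norm B + 1 > 0" by (simp add: add_nonneg_pos)
    then have d: "d > 0" "norm B * d \<le> e"
      using \<open>e > 0\<close> by (auto simp: d_def field_simps)
    from uniform_limitD[OF ul d(1)] obtain N where N: "\<And>n x. n \<ge> N \<Longrightarrow> x \<in> S \<Longrightarrow> dist (\<Sum>i<n. f i x) (U x) < d"
      unfolding eventually_sequentially by blast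
    have "norm ((\<Sum>i<n. f' i x h) - h *\<^sub>R (B o\<^sub>L U x)) \<le> e * norm h" if n: "n \<ge> Suc N" and x: "x \<in> S" for n x h
    proof -
      obtain m where m: "n = Suc m" "m \<ge> N" using n by (cases n) auto
      have "norm ((\<Sum>i<n. f' i x h) - h *\<^sub>R (B o\<^sub>L U x)) = \<bar>h\<bar> * norm (B o\<^sub>L ((\<Sum>i<m. f i x) - U x))"
        unfolding m(1) shift by (simp add: compose_simps flip: scaleR_diff_right)
      also have "\<dots> \<le> \<bar>h\<bar> * (norm B * d)"
        using N[OF m(2) x] by (intro mult_left_mono order_trans[OF norm_blinfun_compose]) (auto simp: dist_norm)
      also have "\<dots> \<le> \<bar>h\<bar> * e" using d(2) by (intro mult_left_mono) auto
      finally show ?thesis by (simp add: mult.commute)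
    qed
    then show "\<forall>\<^sub>F n in sequentially. \<forall>x\<in>S. \<forall>h. norm ((\<Sum>i<n. f' i x h) - h *\<^sub>R (B o\<^sub>L U x)) \<le> e * norm h"
      unfolding eventually_sequentially by blast
  qed
  then obtain g where g: "\<And>x. x \<in> S \<Longrightarrow> (\<lambda>n. f n x) sums g x"
    and g': "\<And>x. x \<in> S \<Longrightarrow> (g has_derivative (\<lambda>h. h *\<^sub>R (B o\<^sub>L U x))) (at x within S)" by blast
  have gU: "g x = U x" if "x \<in> S" for x using g[OF that] by (simp add: U sums_iff)
  have sS: "s \<in> S" by (simp add: S_def R_def)
  have "(U has_derivative (\<lambda>h. h *\<^sub>R (B o\<^sub>L U s))) (at s within S)"
    by (rule has_derivative_transform[OF sS _ g'[OF sS]]) (simp add: gU)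
  then have "(U has_derivative (\<lambda>h. h *\<^sub>R (B o\<^sub>L U s))) (at s)"
    using at_within_open[OF sS] by (simp add: S_def)
  then show ?thesis by (simp add: has_vector_derivative_def U_def[abs_def])
qed

section \<open>The unitary group generated by \<open>\<i> *\<^sub>C A\<close>\<close>

locale rotation_path = hilbert_basis +
  fixes A T0 :: "'a \<Rightarrow>\<^sub>L 'a"
  assumes selfadjoint: "selfadjoint_op A" and hsA: "hs A" and contraction: "contraction_op T0"
begin

definition B :: "'a \<Rightarrow>\<^sub>L 'a" where "B = \<i> *\<^sub>C A"
definition U :: "real \<Rightarrow> 'a \<Rightarrow>\<^sub>L 'a" where "U s = exp_op (s *\<^sub>R B)"
definition Tp :: "real \<Rightarrow> 'a \<Rightarrow>\<^sub>L 'a" where "Tp s = U s o\<^sub>L T0"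

lemma clinear_A: "clinear_op A" and adj_A: "adj A = A"
  using selfadjoint by (auto simp: selfadjoint_op_def)

lemma clinear_B: "clinear_op B"
  by (simp add: B_def clinear_A)

lemma hs_B: "hs B"
  by (simp add: B_def hs_scaleC hsA)

lemma T_path_eq: "T_path A T0 s = Tp s"
proof -
  have "(\<i> * complex_of_real s) *\<^sub>C A = s *\<^sub>R B"
    by (rule blinfun_eqI) (simp add: B_def blinfun.scaleR_left scaleR_scaleC[where 'a='a] scaleC_scaleC mult.commute)
  then show ?thesis by (simp add: T_path_def Tp_def U_def)
qed

lemma U_deriv: "(U has_vector_derivative (B o\<^sub>L U s)) (at s within S)"
  unfolding U_def[abs_def] by (rule has_vector_derivative_at_within[OF exp_op_has_vector_derivative])

lemma U_clinear: "clinear_op (U s)"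
proof -
  have "clinear_op (s *\<^sub>R B)" by (simp add: clinear_B)
  from exp_op_second_order[OF this] show ?thesis
    unfolding U_def using \<open>clinear_op (s *\<^sub>R B)\<close> by auto
qed

lemma U_0: "U 0 = id_blinfun"
proof -
  have "pow_op (0 *\<^sub>R B) n /\<^sub>R fact n = (if n = 0 then id_blinfun else 0)" for n
    by (cases n) auto
  then show ?thesis
    unfolding U_def exp_op_def using sums_single[of 0 "\<lambda>_. id_blinfun :: 'a \<Rightarrow>\<^sub>L 'a"]
    by (simp add: sums_iff)
qed

text \<open>Solutions of \<open>y' = \<i> A y\<close> have constant norm because \<open>A\<close> is self-adjoint.\<close>

lemma norm_flow_constant:
  assumes y: "\<And>s. (y has_vector_derivative B (y s)) (at s)"
  shows "norm (y s) = norm (y 0)"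
proof -
  have "inner (B x) x = 0" for x
  proof -
    have "cinner (A x) x = cnj (cinner (A x) x)"
      using cinner_adj[OF clinear_A, of x x] cinner_commute[of "A x" x] by (simp add: adj_A)
    from arg_cong[OF this, of Im] have "Im (cinner (A x) x) = 0" by simp
    then show ?thesis by (simp add: inner_eq_Re_cinner B_def cinner_simps)
  qed
  then have "inner (y s) (B (y s)) + inner (B (y s)) (y s) = 0" for s
    by (simp add: inner_commute)
  moreover have "((\<lambda>s. inner (y s) (y s)) has_vector_derivative
      inner (y s) (B (y s)) + inner (B (y s)) (y s)) (at s)" for s
    by (rule bounded_bilinear.has_vector_derivative[OF bounded_bilinear_inner y y])
  ultimately have "\<forall>s. DERIV (\<lambda>s. inner (y s) (y s)) s :> 0"
    by (simp add: has_real_derivative_iff_has_vector_derivative)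
  from DERIV_isconst_all[OF this] show ?thesis by (simp add: norm_eq_sqrt_inner)
qed

lemma U_apply_deriv: "((\<lambda>s. U (s + h) x) has_vector_derivative B (U (s + h) x)) (at s)"
proof -
  have "(U \<circ> (\<lambda>s. s + h) has_vector_derivative (1 *\<^sub>R (B o\<^sub>L U (s + h)))) (at s)"
    by (intro vector_diff_chain_at U_deriv) (auto intro!: derivative_eq_intros)
  from bounded_linear.has_vector_derivative[OF blinfun.bounded_linear_left this]
  show ?thesis by (simp add: o_def)
qed

lemma norm_U: "norm (U s x) = norm x"
  using norm_flow_constant[of "\<lambda>s. U s x" s] U_apply_deriv[of 0 x] by (simp add: U_0)

text \<open>Both sides solve the same equation in s with the same initial value; the difference has
  constant norm, hence is 0.\<close>

lemma U_add: "U (s + h) = U s o\<^sub>L U h"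
proof (rule blinfun_eqI)
  fix x
  define y where "y s = U (s + h) x - U s (U h x)" for s
  have "(y has_vector_derivative B (y s)) (at s)" for s
    unfolding y_def blinfun.diff_right
    using U_apply_deriv[of h x s] U_apply_deriv[of 0 "U h x" s] by (intro has_vector_derivative_diff) auto
  from norm_flow_constant[OF this, of s] show "U (s + h) x = (U s o\<^sub>L U h) x"
    by (simp add: y_def U_0)
qed

lemma U_commute_A: "A (U s x) = U s (A x)"
proof -
  define y where "y s = A (U s x) - U s (A x)" for s
  have AB: "A (B z) = B (A z)" for z by (simp add: B_def clinear_opD[OF clinear_A])
  have "(y has_vector_derivative B (y s)) (at s)" for s
    unfolding y_def blinfun.diff_right AB[symmetric]
    using bounded_linear.has_vector_derivative[OF blinfun.bounded_linear_right U_apply_deriv[of 0 x s], of A]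
      U_apply_deriv[of 0 "A x" s] by (intro has_vector_derivative_diff) auto
  from norm_flow_constant[OF this, of s] show ?thesis by (simp add: y_def U_0)
qed

text \<open>The bound keeps \<open>norm (A x)\<close> for each x, so that applied to basis vectors
  it gives a Lipschitz bound in Hilbert-Schmidt norm. The speed is constant because U is isometric
  and commutes with A.\<close>

lemma norm_U_diff_le: "norm ((U s - U r) x) \<le> \<bar>s - r\<bar> * norm (A x)"
proof -
  have "norm (U s x - U r x) \<le> norm (A x) * norm (s - r)"
  proof (rule differentiable_bound[where S = UNIV and f' = "\<lambda>s h. h *\<^sub>R B (U s x)"])
    fix t
    show "((\<lambda>s. U s x) has_derivative (\<lambda>h. h *\<^sub>R B (U t x))) (at t within UNIV)"
      using U_apply_deriv[of 0 x t] by (simp add: has_vector_derivative_def)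
    have "norm (B (U t x)) = norm (A x)" by (simp add: B_def norm_scaleC U_commute_A norm_U)
    then show "onorm (\<lambda>h. h *\<^sub>R B (U t x)) \<le> norm (A x)"
      by (intro onorm_bound) (auto simp: mult.commute)
  qed auto
  then show ?thesis by (simp add: blinfun.diff_left mult.commute)
qed

lemma contraction_U: "contraction_op (U s)"
  unfolding contraction_op_def using U_clinear norm_blinfun_bound[of 1 "U s"] by (simp add: norm_U)

lemma contraction_compose:
  "contraction_op S \<Longrightarrow> contraction_op T \<Longrightarrow> contraction_op (S o\<^sub>L T)"
  unfolding contraction_op_def
  using norm_blinfun_compose[of S T] mult_le_one[of "norm S" "norm T"] by auto

lemma contraction_Tp: "contraction_op (Tp s)"
  unfolding Tp_def by (intro contraction_compose contraction_U contraction)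

lemma Tp_diff: "hs (Tp s - Tp r)" "hsn (Tp s - Tp r) \<le> \<bar>s - r\<bar> * hsn A"
proof -
  have U: "hs (U s - U r)"
    by (rule hs_bound[OF _ hsA norm_U_diff_le]) (simp add: U_clinear)
  have le: "hsn (U s - U r) \<le> \<bar>s - r\<bar> * hsn A"
    by (rule hsn_bound[OF U hsA norm_U_diff_le]) simp
  have eq: "Tp s - Tp r = (U s - U r) o\<^sub>L T0" by (simp add: Tp_def compose_simps)
  show "hs (Tp s - Tp r)" "hsn (Tp s - Tp r) \<le> \<bar>s - r\<bar> * hsn A"
    unfolding eq using contraction_hsn(3,4)[OF contraction U] le by auto
qed

section \<open>The second order remainder of a power\<close>

text \<open>The derivative of the n-th power of \<open>Tp\<close>, by the product rule with the last
  factor split off.\<close>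

fun dpow :: "real \<Rightarrow> nat \<Rightarrow> 'a \<Rightarrow>\<^sub>L 'a" where
  "dpow s 0 = 0"
| "dpow s (Suc n) = (pow_op (Tp s) n o\<^sub>L (B o\<^sub>L Tp s)) + (dpow s n o\<^sub>L Tp s)"

lemma pow_deriv: "((\<lambda>s. pow_op (Tp s) n) has_vector_derivative dpow s n) (at s within S)"
proof (induction n)
  case (Suc n)
  have "(Tp has_vector_derivative (B o\<^sub>L Tp s)) (at s within S)"
    using bounded_linear.has_vector_derivative[OF
        bounded_bilinear.bounded_linear_left[OF bounded_bilinear_blinfun_compose] U_deriv, of T0]
    by (simp add: Tp_def[abs_def] compose_assoc)
  from bounded_bilinear.has_vector_derivative[OF bounded_bilinear_blinfun_compose Suc this]
  show ?case by (simp add: pow_op_Suc_right del: pow_op_simps)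
qed simp

lemma hsn_pow_diff_le: "hsn (pow_op (Tp s) n - pow_op (Tp r) n) \<le> real n * (\<bar>s - r\<bar> * hsn A)"
proof (induction n)
  case (Suc n)
  note h = hs_pow_diff[OF contraction_Tp contraction_Tp Tp_diff(1)]
  have eq: "pow_op (Tp s) (Suc n) - pow_op (Tp r) (Suc n) =
      (pow_op (Tp s) n o\<^sub>L (Tp s - Tp r)) + ((pow_op (Tp s) n - pow_op (Tp r) n) o\<^sub>L Tp r)"
    by (simp only: pow_op_Suc_right compose_simps) simp
  have "hsn (pow_op (Tp s) (Suc n) - pow_op (Tp r) (Suc n)) \<le>
      hsn (pow_op (Tp s) n o\<^sub>L (Tp s - Tp r)) + hsn ((pow_op (Tp s) n - pow_op (Tp r) n) o\<^sub>L Tp r)"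
    unfolding eq using contraction_hsn[OF contraction_pow[OF contraction_Tp] Tp_diff(1)]
      contraction_hsn[OF contraction_Tp h] by (intro hsn_triangle)
  also have "\<dots> \<le> hsn (Tp s - Tp r) + hsn (pow_op (Tp s) n - pow_op (Tp r) n)"
    using contraction_hsn[OF contraction_pow[OF contraction_Tp] Tp_diff(1)]
      contraction_hsn[OF contraction_Tp h] by (intro add_mono)
  also have "\<dots> \<le> \<bar>s - r\<bar> * hsn A + real n * (\<bar>s - r\<bar> * hsn A)"
    using Tp_diff(2) Suc by (intro add_mono)
  finally show ?case by (simp add: distrib_right)
qed (simp add: hsn_def)

lemma nuc_contraction_left: "nuc T b \<Longrightarrow> contraction_op S \<Longrightarrow> nuc (S o\<^sub>L T) b"
  using nuc_compose_left[of T b S] nuc_nonneg[of T b] mult_right_mono[of "norm S" 1 b]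
  by (auto simp: contraction_op_def elim!: nuc_mono)

lemma nuc_contraction_right: "nuc T b \<Longrightarrow> contraction_op S \<Longrightarrow> nuc (T o\<^sub>L S) b"
  using nuc_compose_right[of T b S] nuc_nonneg[of T b] mult_left_mono[of "norm S" 1 b]
  by (auto simp: contraction_op_def elim!: nuc_mono)

text \<open>The group law moves the expansion to s = 0, which makes the bound uniform in s; the two
  factors of X give h^2, and |h| \<le> 1 keeps the exponential bounded.\<close>

lemma nuc_path_second_order:
  assumes "\<bar>h\<bar> \<le> 1"
  shows "nuc (Tp (s + h) - Tp s - h *\<^sub>R (B o\<^sub>L Tp s)) (h\<^sup>2 * (hsn B * exp (norm B) * hsn B))"
proof -
  define X where "X = h *\<^sub>R B"
  have cX: "clinear_op X" by (simp add: X_def clinear_B)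
  obtain \<Psi> where \<Psi>: "clinear_op \<Psi>" "norm \<Psi> \<le> exp (norm X)"
    "exp_op X = id_blinfun + X + (X o\<^sub>L (\<Psi> o\<^sub>L X))"
    using exp_op_second_order[OF cX] by blast
  have hX: "hs X" unfolding X_def by (intro hs_scaleR hs_B)
  have hsnX: "hsn X \<le> \<bar>h\<bar> * hsn B"
    by (rule hsn_bound[OF hX hs_B]) (auto simp: X_def blinfun.scaleR_left)
  have nX: "norm X \<le> norm B" unfolding X_def using assms mult_right_mono[of "\<bar>h\<bar>" 1 "norm B"] by simp
  have "Tp (s + h) - Tp s - h *\<^sub>R (B o\<^sub>L Tp s) = (X o\<^sub>L (\<Psi> o\<^sub>L X)) o\<^sub>L Tp s"
  proof (rule blinfun_eqI)
    fix x
    have "U h z = z + X z + X (\<Psi> (X z))" for z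
      using \<Psi>(3) unfolding X_def U_def[symmetric] by (simp add: blinfun.add_left)
    moreover have "Tp (s + h) x = U h (Tp s x)" by (simp add: Tp_def U_add add.commute)
    ultimately show "(Tp (s + h) - Tp s - h *\<^sub>R (B o\<^sub>L Tp s)) x = ((X o\<^sub>L (\<Psi> o\<^sub>L X)) o\<^sub>L Tp s) x"
      by (simp add: blinfun.diff_left blinfun.scaleR_left X_def)
  qed
  moreover have "nuc (X o\<^sub>L (\<Psi> o\<^sub>L X)) (h\<^sup>2 * (hsn B * exp (norm B) * hsn B))"
  proof (rule nuc.prod[OF hX hs_compose_left[OF \<Psi>(1) hX]])
    have "hsn X * hsn (\<Psi> o\<^sub>L X) \<le> (\<bar>h\<bar> * hsn B) * (exp (norm B) * (\<bar>h\<bar> * hsn B))"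
    proof (intro mult_mono hsnX)
      have "hsn (\<Psi> o\<^sub>L X) \<le> norm \<Psi> * hsn X" by (rule hsn_compose_left[OF \<Psi>(1) hX])
      also have "\<dots> \<le> exp (norm B) * (\<bar>h\<bar> * hsn B)"
        using \<Psi>(2) nX by (intro mult_mono hsnX) (auto intro: order_trans[OF \<Psi>(2)])
      finally show "hsn (\<Psi> o\<^sub>L X) \<le> exp (norm B) * (\<bar>h\<bar> * hsn B)" .
    qed auto
    also have "\<dots> = h\<^sup>2 * (hsn B * exp (norm B) * hsn B)" by (simp add: power2_eq_square)
    finally show "hsn X * hsn (\<Psi> o\<^sub>L X) \<le> h\<^sup>2 * (hsn B * exp (norm B) * hsn B)" .
  qed
  ultimately show ?thesis using nuc_contraction_right[OF _ contraction_Tp] by simp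
qed

text \<open>C must not depend on s, since the estimate is summed over a subdivision. The error
  splits into a product of two first order differences, the second order error of the path, and the
  error of the lower power.\<close>

lemma nuc_pow_second_order:
  "\<exists>C. \<forall>s h. \<bar>h\<bar> \<le> 1 \<longrightarrow> nuc (pow_op (Tp (s + h)) n - pow_op (Tp s) n - h *\<^sub>R dpow s n) (h\<^sup>2 * C)"
proof (induction n)
  case 0
  then show ?case using nuc_zero by (auto intro!: exI[of _ 0])
next
  case (Suc n)
  then obtain C where C: "\<And>s h. \<bar>h\<bar> \<le> 1 \<Longrightarrow>
    nuc (pow_op (Tp (s + h)) n - pow_op (Tp s) n - h *\<^sub>R dpow s n) (h\<^sup>2 * C)" by blast
  define C' where "C' = real n * hsn A * hsn A + hsn B * exp (norm B) * hsn B + C"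
  have "nuc (pow_op (Tp (s + h)) (Suc n) - pow_op (Tp s) (Suc n) - h *\<^sub>R dpow s (Suc n)) (h\<^sup>2 * C')"
    if h: "\<bar>h\<bar> \<le> 1" for s h
  proof -
    define S where "S = Tp (s + h)"
    define T where "T = Tp s"
    have "pow_op S (Suc n) - pow_op T (Suc n) - h *\<^sub>R dpow s (Suc n) =
      (((pow_op S n - pow_op T n) o\<^sub>L (S - T)) + (pow_op T n o\<^sub>L (S - T - h *\<^sub>R (B o\<^sub>L T)))) +
      ((pow_op S n - pow_op T n - h *\<^sub>R dpow s n) o\<^sub>L T)"
      by (rule blinfun_eqI) (simp add: pow_op_Suc_right T_def[symmetric] blinfun.bilinear_simps algebra_simps del: pow_op_simps)
    moreover have "nuc ((pow_op S n - pow_op T n) o\<^sub>L (S - T)) (h\<^sup>2 * (real n * hsn A * hsn A))"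
    proof (rule nuc.prod)
      show "hs (pow_op S n - pow_op T n)" "hs (S - T)"
        unfolding S_def T_def by (intro hs_pow_diff contraction_Tp Tp_diff)+
      have "hsn (pow_op S n - pow_op T n) * hsn (S - T) \<le> (real n * (\<bar>s + h - s\<bar> * hsn A)) * (\<bar>s + h - s\<bar> * hsn A)"
        unfolding S_def T_def by (intro mult_mono hsn_pow_diff_le Tp_diff(2)) auto
      then show "hsn (pow_op S n - pow_op T n) * hsn (S - T) \<le> h\<^sup>2 * (real n * hsn A * hsn A)"
        by (simp add: power2_eq_square mult_ac)
    qed
    moreover have "nuc (pow_op T n o\<^sub>L (S - T - h *\<^sub>R (B o\<^sub>L T))) (h\<^sup>2 * (hsn B * exp (norm B) * hsn B))"
      unfolding S_def T_def
      by (intro nuc_contraction_left nuc_path_second_order h contraction_pow contraction_Tp)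
    moreover have "nuc ((pow_op S n - pow_op T n - h *\<^sub>R dpow s n) o\<^sub>L T) (h\<^sup>2 * C)"
      unfolding S_def T_def by (intro nuc_contraction_right C h contraction_Tp)
    ultimately show ?thesis
      unfolding S_def[symmetric] T_def[symmetric] C'_def distrib_left by (simp only:) (intro nuc.add)
  qed
  then show ?case by blast
qed

text \<open>Each term by itself is known only to be Hilbert-Schmidt. The difference splits into two
  products pairing a power difference with a factor containing B; cyclicity moves the outer powers
  together, and the pieces add up to the difference of the powers j + k.\<close>

lemma tr_sandwich_diff:
  assumes S: "contraction_op S" and T: "contraction_op T" and ST: "hs (S - T)"
  shows "\<exists>b. nuc ((pow_op S j o\<^sub>L (B o\<^sub>L pow_op S k)) - (pow_op T j o\<^sub>L (B o\<^sub>L pow_op T k))) b"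
    and "tr ((pow_op S j o\<^sub>L (B o\<^sub>L pow_op S k)) - (pow_op T j o\<^sub>L (B o\<^sub>L pow_op T k)))
      = \<i> * hsi (pow_op S (j + k) - pow_op T (j + k)) A"
proof -
  have cS: "clinear_op (pow_op S m)" and cT: "clinear_op (pow_op T m)" for m
    using S T by (auto simp: contraction_op_def)
  define X where "X m = pow_op S m - pow_op T m" for m
  have hX: "hs (X m)" for m unfolding X_def by (rule hs_pow_diff[OF S T ST])
  have eq: "(pow_op S j o\<^sub>L (B o\<^sub>L pow_op S k)) - (pow_op T j o\<^sub>L (B o\<^sub>L pow_op T k))
      = (X j o\<^sub>L (B o\<^sub>L pow_op S k)) + ((pow_op T j o\<^sub>L B) o\<^sub>L X k)"
    by (simp add: X_def compose_simps compose_assoc)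
  have h1: "hs (B o\<^sub>L pow_op S k)" and h2: "hs (pow_op T j o\<^sub>L B)"
    using hs_B cS cT by (auto intro: hs_compose_left hs_compose_right)
  have n1: "nuc (X j o\<^sub>L (B o\<^sub>L pow_op S k)) (hsn (X j) * hsn (B o\<^sub>L pow_op S k))"
    and n2: "nuc ((pow_op T j o\<^sub>L B) o\<^sub>L X k) (hsn (pow_op T j o\<^sub>L B) * hsn (X k))"
    using hX h1 h2 by (auto intro: nuc.prod)
  show "\<exists>b. nuc ((pow_op S j o\<^sub>L (B o\<^sub>L pow_op S k)) - (pow_op T j o\<^sub>L (B o\<^sub>L pow_op T k))) b"
    unfolding eq using nuc.add[OF n1 n2] by blast
  have adjB: "adj B = (- \<i>) *\<^sub>C A"
    by (rule adj_eqI[OF clinear_B])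
      (simp add: B_def cinner_simps flip: cinner_adj[OF clinear_A, unfolded adj_A])
  have "tr (X j o\<^sub>L (B o\<^sub>L pow_op S k)) = hsi (X j) (adj (pow_op S k) o\<^sub>L adj B)"
    using tr_prod_commute[OF hX h1] adj_compose[OF clinear_B cS] by simp
  also have "\<dots> = hsi (pow_op S k o\<^sub>L X j) (adj B)"
    using hsi_compose_left[OF cS hX hs_adj[OF hs_B]] by simp
  also have "\<dots> = \<i> * hsi (pow_op S k o\<^sub>L X j) A"
    unfolding adjB using hsi_scaleC_right[OF hs_compose_left[OF cS hX] hsA] by simp
  finally have t1: "tr (X j o\<^sub>L (B o\<^sub>L pow_op S k)) = \<i> * hsi (pow_op S k o\<^sub>L X j) A" .
  have "tr ((pow_op T j o\<^sub>L B) o\<^sub>L X k) = hsi (X k) (adj B o\<^sub>L adj (pow_op T j))"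
    using tr_prod[OF h2 hX] adj_compose[OF cT clinear_B] by simp
  also have "\<dots> = hsi (X k o\<^sub>L pow_op T j) (adj B)"
    using hsi_compose_right[OF cT hX hs_adj[OF hs_B]] by simp
  also have "\<dots> = \<i> * hsi (X k o\<^sub>L pow_op T j) A"
    unfolding adjB using hsi_scaleC_right[OF hs_compose_right[OF cT hX] hsA] by simp
  finally have t2: "tr ((pow_op T j o\<^sub>L B) o\<^sub>L X k) = \<i> * hsi (X k o\<^sub>L pow_op T j) A" .
  have "pow_op S (j + k) = pow_op S k o\<^sub>L pow_op S j" "pow_op T (j + k) = pow_op T k o\<^sub>L pow_op T j"
    by (simp_all add: pow_op_add[symmetric] add.commute)
  then have "(pow_op S k o\<^sub>L X j) + (X k o\<^sub>L pow_op T j) = X (j + k)"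
    by (simp add: X_def compose_simps)
  then have "hsi (pow_op S k o\<^sub>L X j) A + hsi (X k o\<^sub>L pow_op T j) A = hsi (X (j + k)) A"
    using hsi_add_left[OF hs_compose_left[OF cS hX] hs_compose_right[OF cT hX] hsA, of k j k j] by simp
  then show "tr ((pow_op S j o\<^sub>L (B o\<^sub>L pow_op S k)) - (pow_op T j o\<^sub>L (B o\<^sub>L pow_op T k)))
      = \<i> * hsi (pow_op S (j + k) - pow_op T (j + k)) A"
    unfolding eq tr_add[OF n1 n2] t1 t2 by (simp add: X_def[symmetric] flip: distrib_left)
qed

text \<open>Each of the n positions of B contributes the same trace. The trailing power k is carried
  along because \<open>dpow\<close> splits off factors on the right.\<close>

lemma tr_dpow_diff:
  "\<exists>b. nuc ((dpow s n o\<^sub>L pow_op (Tp s) k) - (dpow r n o\<^sub>L pow_op (Tp r) k)) b \<and>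
    tr ((dpow s n o\<^sub>L pow_op (Tp s) k) - (dpow r n o\<^sub>L pow_op (Tp r) k))
      = of_nat n * (\<i> * hsi (pow_op (Tp s) (n + k) - pow_op (Tp r) (n + k)) A)"
proof (induction n arbitrary: k)
  case 0
  then show ?case using nuc_zero by (auto simp: tr_zero)
next
  case (Suc n)
  define P where "P = (pow_op (Tp s) n o\<^sub>L (B o\<^sub>L pow_op (Tp s) (Suc k))) - (pow_op (Tp r) n o\<^sub>L (B o\<^sub>L pow_op (Tp r) (Suc k)))"
  define Q where "Q = (dpow s n o\<^sub>L pow_op (Tp s) (Suc k)) - (dpow r n o\<^sub>L pow_op (Tp r) (Suc k))"
  have eq: "(dpow s (Suc n) o\<^sub>L pow_op (Tp s) k) - (dpow r (Suc n) o\<^sub>L pow_op (Tp r) k) = P + Q"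
    by (simp add: P_def Q_def compose_simps compose_assoc)
  obtain b where b: "nuc Q b" "tr Q = of_nat n * (\<i> * hsi (pow_op (Tp s) (n + Suc k) - pow_op (Tp r) (n + Suc k)) A)"
    using Suc[of "Suc k"] unfolding Q_def by blast
  obtain a where a: "nuc P a" "tr P = \<i> * hsi (pow_op (Tp s) (n + Suc k) - pow_op (Tp r) (n + Suc k)) A"
    using tr_sandwich_diff[OF contraction_Tp[of s] contraction_Tp[of r] Tp_diff(1), of n "Suc k"] unfolding P_def by blast
  show ?case
    unfolding eq tr_add[OF a(1) b(1)] a(2) b(2)
    using nuc.add[OF a(1) b(1)] by (auto simp: distrib_right simp del: pow_op_simps)
qed

section \<open>The trace of the remainder as a limit of Riemann sums\<close>

definition rem :: "nat \<Rightarrow> 'a \<Rightarrow>\<^sub>L 'a" where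
  "rem n = pow_op (Tp 1) n - pow_op (Tp 0) n - dpow 0 n"

lemma nuc_rem: "\<exists>b. nuc (rem n) b"
proof -
  obtain C where "\<And>s h. \<bar>h\<bar> \<le> 1 \<Longrightarrow>
    nuc (pow_op (Tp (s + h)) n - pow_op (Tp s) n - h *\<^sub>R dpow s n) (h\<^sup>2 * C)"
    using nuc_pow_second_order by blast
  from this[of 1 0] show ?thesis by (auto simp: rem_def)
qed

definition \<gamma> :: "real \<Rightarrow> nat \<Rightarrow> complex" where
  "\<gamma> s n = hsi (pow_op (Tp s) n - pow_op (Tp 0) n) A / of_nat n"

text \<open>The second order expansion on each of K subintervals has trace norm error C / K^2, hence
  C / K in total. What remains compares derivatives at the grid points with the one at 0, whose
  traces are known.\<close>

lemma tr_rem_limit: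
  assumes n: "n \<ge> 1"
  shows "(\<lambda>K. (\<Sum>i<Suc K. \<gamma> (real i / real (Suc K)) n) / of_nat (Suc K)) \<longlonglongrightarrow> tr (rem n) / (\<i> * of_nat n ^ 2)"
proof -
  obtain C where C: "\<And>s h. \<bar>h\<bar> \<le> 1 \<Longrightarrow>
    nuc (pow_op (Tp (s + h)) n - pow_op (Tp s) n - h *\<^sub>R dpow s n) (h\<^sup>2 * C)"
    using nuc_pow_second_order by blast
  define g where "g s = of_nat n * (\<i> * hsi (pow_op (Tp s) n - pow_op (Tp 0) n) A)" for s
  have bound: "cmod (tr (rem n) - (\<Sum>i<K. g (real i / real K)) / of_nat K) \<le> C / real K" if K: "K \<ge> 1" for K
  proof -
    define h where "h = 1 / real K"
    have h: "\<bar>h\<bar> \<le> 1" "real K * h = 1" using K by (auto simp: h_def)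
    define E1 where "E1 i = pow_op (Tp (real i * h + h)) n - pow_op (Tp (real i * h)) n - h *\<^sub>R dpow (real i * h) n" for i
    define E2 where "E2 i = dpow (real i * h) n - dpow 0 n" for i
    have E1: "nuc (E1 i) (h\<^sup>2 * C)" for i unfolding E1_def by (rule C[OF h(1)])
    have "\<exists>b. nuc (E2 i) b \<and> tr (E2 i) = g (real i * h)" for i
      using tr_dpow_diff[of "real i * h" n 0 0] by (simp add: E2_def g_def)
    then obtain b where E2: "\<And>i. nuc (E2 i) (b i)" "\<And>i. tr (E2 i) = g (real i * h)" by metis
    have hE2: "nuc (of_real h *\<^sub>C E2 i) (cmod (of_real h) * b i)" for i by (rule nuc_scaleC[OF E2(1)])
    \<comment> \<open>The powers telescope; \<open>E2\<close> exchanges the derivative at the grid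
      point for the one at 0.\<close>
    have "(\<Sum>i<m. E1 i + of_real h *\<^sub>C E2 i) = pow_op (Tp (real m * h)) n - pow_op (Tp 0) n - (real m * h) *\<^sub>R dpow 0 n" for m
    proof (induction m)
      case (Suc m)
      have "of_real h *\<^sub>C E2 m = h *\<^sub>R E2 m"
        by (rule blinfun_eqI) (simp add: scaleC_of_real blinfun.scaleR_left)
      then show ?case
        unfolding sum.lessThan_Suc Suc by (simp add: E1_def E2_def distrib_right scaleR_add_left scaleR_diff_right add.commute)
    qed simp
    from this[of K] have "rem n = (\<Sum>i<K. E1 i + of_real h *\<^sub>C E2 i)" by (simp add: h(2) rem_def)
    then have "tr (rem n) = (\<Sum>i<K. tr (E1 i + of_real h *\<^sub>C E2 i))"
      using tr_sum[of "{..<K}", OF _ nuc.add[OF E1 hE2]] by simp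
    also have "\<dots> = (\<Sum>i<K. tr (E1 i)) + (\<Sum>i<K. of_real h * g (real i * h))"
      using tr_add[OF E1 hE2] by (simp add: tr_scaleC E2(2) sum.distrib)
    also have "(\<Sum>i<K. of_real h * g (real i * h)) = (\<Sum>i<K. g (real i / real K)) / of_nat K"
      by (simp add: h_def sum_divide_distrib)
    finally have "tr (rem n) - (\<Sum>i<K. g (real i / real K)) / of_nat K = (\<Sum>i<K. tr (E1 i))" by simp
    also have "cmod \<dots> \<le> (\<Sum>i<K. h\<^sup>2 * C)" by (rule sum_norm_le) (rule norm_tr_le[OF E1])
    also have "\<dots> = C / real K" using K by (simp add: h_def power2_eq_square)
    finally show ?thesis .
  qed
  have lim0: "(\<lambda>K. C / real (Suc K)) \<longlonglongrightarrow> 0"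
    using tendsto_mult[OF tendsto_const[of C] LIMSEQ_Suc[OF lim_1_over_n]] by simp
  have "(\<lambda>K. (\<Sum>i<Suc K. g (real i / real (Suc K))) / of_nat (Suc K) - tr (rem n)) \<longlonglongrightarrow> 0"
  proof (rule tendsto_norm_zero_cancel, rule tendsto_sandwich[OF _ _ tendsto_const lim0])
    have "cmod ((\<Sum>i<Suc K. g (real i / real (Suc K))) / of_nat (Suc K) - tr (rem n)) \<le> C / real (Suc K)" for K
      using bound[of "Suc K"] by (simp add: norm_minus_commute)
    then show "\<forall>\<^sub>F K in sequentially.
      cmod ((\<Sum>i<Suc K. g (real i / real (Suc K))) / of_nat (Suc K) - tr (rem n)) \<le> C / real (Suc K)" by (rule always_eventually[OF allI])
  qed simp
  then have "(\<lambda>K. (\<Sum>i<Suc K. g (real i / real (Suc K))) / of_nat (Suc K)) \<longlonglongrightarrow> tr (rem n)"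
    by (rule LIM_zero_cancel)
  from tendsto_divide[OF this tendsto_const[of "\<i> * of_nat n ^ 2"]]
  have "(\<lambda>K. (\<Sum>i<Suc K. g (real i / real (Suc K))) / of_nat (Suc K) / (\<i> * of_nat n ^ 2)) \<longlonglongrightarrow> tr (rem n) / (\<i> * of_nat n ^ 2)"
    using n by simp
  moreover have "g s = (\<i> * of_nat n ^ 2) * \<gamma> s n" for s
    using n by (simp add: g_def \<gamma>_def power2_eq_square)
  then have "(\<Sum>i<Suc K. g (real i / real (Suc K))) / of_nat (Suc K) / (\<i> * of_nat n ^ 2) =
      (\<Sum>i<Suc K. \<gamma> (real i / real (Suc K)) n) / of_nat (Suc K)" for K
    using n by (simp only: sum_distrib_left[symmetric]) simp
  ultimately show ?thesis by simp
qed

end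

section \<open>The spectral shift function\<close>

lemma bounded_linear_scaleC_blinfun:
  "bounded_linear (\<lambda>T::'a::chilbert_space \<Rightarrow>\<^sub>L 'a. c *\<^sub>C T)"
proof (rule bounded_linear_intro[of _ "cmod c"])
  show "norm (c *\<^sub>C T) \<le> norm T * cmod c" for T :: "'a \<Rightarrow>\<^sub>L 'a"
    using norm_scaleC_blinfun_le[of c T] by (simp add: mult.commute)
qed (auto intro!: blinfun_eqI simp: blinfun.add_left blinfun.scaleR_left scaleC.add_right scaleC.scaleR_right)

lemma cis_sum_deriv:
  fixes a :: "nat \<Rightarrow> complex"
  shows "((\<lambda>u. \<Sum>k\<in>I. a k * cis (real k * u)) has_vector_derivative
    (\<Sum>k\<in>I. (\<i> * of_nat k * a k) * cis (real k * t))) (at t)"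
proof (rule has_vector_derivative_sum)
  fix k
  have cis: "cis (real k * x) = exp (\<i> * of_nat k * of_real x)" for x
    by (simp add: cis_conv_exp mult.assoc)
  have "((\<lambda>z. a k * exp (\<i> * of_nat k * z)) has_field_derivative
      \<i> * of_nat k * a k * exp (\<i> * of_nat k * of_real t)) (at (of_real t))"
    by (auto intro!: derivative_eq_intros)
  from has_vector_derivative_real_field[OF this]
  show "((\<lambda>u. a k * cis (real k * u)) has_vector_derivative
      (\<i> * of_nat k * a k) * cis (real k * t)) (at t)"
    unfolding cis .
qed

lemma second_deriv_poly_cis:
  "second_deriv (\<lambda>u. poly p (cis u)) t
    = (\<Sum>k\<le>degree p. (- (of_nat k)\<^sup>2 * coeff p k) * cis (real k * t))"
proof -
  have sq: "\<i> * k * (\<i> * k * c) = - k\<^sup>2 * c" for k c :: complex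
    by (simp add: complex_eq_iff power2_eq_square algebra_simps)
  have "(\<lambda>u. poly p (cis u)) = (\<lambda>u. \<Sum>k\<le>degree p. coeff p k * cis (real k * u))"
    by (simp add: poly_altdef Complex.DeMoivre)
  then show ?thesis
    unfolding second_deriv_def
    by (simp only: vector_derivative_at[OF cis_sum_deriv] sq)
qed

lemma LINT_second_deriv:
  assumes \<eta>: "\<eta> \<in> L1_circle"
  shows "(LINT t:{0..2*pi}|lebesgue. second_deriv (\<lambda>u. poly p (cis u)) t * \<eta> t)
    = (\<Sum>k\<le>degree p. (- (of_nat k)\<^sup>2 * coeff p k) * mom \<eta> k)"
proof -
  have "(LINT t:{0..2*pi}|lebesgue. second_deriv (\<lambda>u. poly p (cis u)) t * \<eta> t)
      = (LINT t|lebesgue. (\<Sum>k\<le>degree p. (- (of_nat k)\<^sup>2 * coeff p k) * (cis (real k * t) * cut \<eta> t)))"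
    unfolding set_lebesgue_integral_def second_deriv_poly_cis cut_def
    by (intro Bochner_Integration.integral_cong refl)
      (simp add: sum_distrib_right scaleR_conv_of_real sum_distrib_left mult_ac)
  also have "\<dots> = (\<Sum>k\<le>degree p. (- (of_nat k)\<^sup>2 * coeff p k) * mom \<eta> k)"
    unfolding mom_cut using \<eta>
    by (subst Bochner_Integration.integral_sum) (auto simp: L1_circle_cut intro!: integrable_cis)
  finally show ?thesis .
qed

lemma H1_circle_iff_mom:
  assumes "f \<in> L1_circle"
  shows "f \<in> H1_circle \<longleftrightarrow> (\<forall>n\<ge>1. mom f n = 0)"
proof -
  have "fourier_coeff f (- int n) = mom f n / (2 * pi)" for n
    by (simp add: fourier_coeff_def mom_def mult.commute)
  moreover have "(\<forall>m<0. fourier_coeff f m = 0) \<longleftrightarrow> (\<forall>n\<ge>1. fourier_coeff f (- int n) = 0)"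
  proof safe
    fix m :: int assume *: "\<forall>n\<ge>1. fourier_coeff f (- int n) = 0" and "m < 0"
    then show "fourier_coeff f m = 0" using spec[OF *, of "nat (- m)"] by simp
  qed simp
  ultimately show ?thesis using assms by (simp add: H1_circle_def)
qed

section \<open>Moments of the spectral shift function\<close>

context rotation_path
begin

lemma rep_\<gamma>_diff: "rep (\<lambda>n. \<gamma> s n - \<gamma> r n) (\<bar>s - r\<bar> * (hsn A)\<^sup>2)"
proof -
  note h = hs_pow_diff[OF contraction_Tp contraction_Tp Tp_diff(1)]
  have "\<gamma> s n - \<gamma> r n = hsi (pow_op (Tp s) n - pow_op (Tp r) n) A / of_nat n" for n
    using hsi_diff_left[OF h h hsA, of s n 0 r n 0] by (simp add: \<gamma>_def diff_divide_distrib)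
  then have "rep (\<lambda>n. \<gamma> s n - \<gamma> r n) (hsn (Tp s - Tp r) * hsn A)"
    using rep_power_difference[OF contraction_Tp contraction_Tp Tp_diff(1) hsA, of s r] by simp
  moreover have "hsn (Tp s - Tp r) * hsn A \<le> \<bar>s - r\<bar> * (hsn A)\<^sup>2"
    using mult_right_mono[OF Tp_diff(2), of "hsn A" s r] by (simp add: power2_eq_square mult.assoc)
  ultimately show ?thesis by (rule rep_mono)
qed

lemma \<gamma>_0: "\<gamma> 0 n = 0"
  by (simp add: \<gamma>_def hsi_def cinner_simps)

definition riem :: "nat \<Rightarrow> nat \<Rightarrow> complex" where
  "riem K n = - \<i> * ((\<Sum>i<K. \<gamma> (real i / real K) n) / of_nat K)"

text \<open>The moments forced by the formula for monomials: the second derivative of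
  \<open>cis (n * t)\<close> produces - n^2.\<close>

definition moment :: "nat \<Rightarrow> complex" where
  "moment n = - tr (rem n) / (of_nat n)\<^sup>2"

text \<open>As \<gamma> vanishes at 0, the node i / K costs i / K times the squared norm of A; the
  average of these costs is at most 1/2. This is the origin of the constant.\<close>

lemma rep_riem:
  assumes "K \<ge> 1" shows "rep (riem K) ((hsn A)\<^sup>2 / 2)"
proof -
  have "rep (\<lambda>n. \<Sum>i<K. (- \<i> / of_nat K) * (\<gamma> (real i / real K) n - \<gamma> 0 n))
      (\<Sum>i<K. cmod (- \<i> / of_nat K) * (\<bar>real i / real K - 0\<bar> * (hsn A)\<^sup>2))"
    by (intro rep_sum rep_cmult rep_\<gamma>_diff) auto
  also have "(\<lambda>n. \<Sum>i<K. (- \<i> / of_nat K) * (\<gamma> (real i / real K) n - \<gamma> 0 n)) = riem K"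
    by (simp add: fun_eq_iff riem_def \<gamma>_0 sum_divide_distrib sum_distrib_left sum_negf)
  finally have R: "rep (riem K) (\<Sum>i<K. cmod (- \<i> / of_nat K) * (\<bar>real i / real K - 0\<bar> * (hsn A)\<^sup>2))" .
  have "(\<Sum>i<K. cmod (- \<i> / of_nat K) * (\<bar>real i / real K - 0\<bar> * (hsn A)\<^sup>2)) = (\<Sum>i<K. real i) * ((hsn A)\<^sup>2 / (real K)\<^sup>2)"
    unfolding sum_distrib_right by (intro sum.cong refl) (simp add: norm_divide power2_eq_square)
  also have "(\<Sum>i<K. real i) \<le> (real K)\<^sup>2 / 2"
    by (induction K) (simp_all add: power2_eq_square field_simps)
  then have "(\<Sum>i<K. real i) * ((hsn A)\<^sup>2 / (real K)\<^sup>2) \<le> (real K)\<^sup>2 / 2 * ((hsn A)\<^sup>2 / (real K)\<^sup>2)"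
    by (intro mult_right_mono) auto
  also have "\<dots> = (hsn A)\<^sup>2 / 2" using assms by simp
  finally show ?thesis by (rule rep_mono[OF R])
qed

lemma sum_even_odd: "(\<Sum>i<2 * K. f i) = (\<Sum>i<K. f (2 * i) + f (2 * i + 1 :: nat) :: complex)"
  by (induction K) (simp_all add: add.assoc)

text \<open>The even nodes of the refined sum are the old ones. Each of the K new nodes lies at
  distance 1 / (2K) from its left neighbour and has weight 1 / (2K), in total 1 / (4K).\<close>

lemma rep_riem_refine:
  assumes "K \<ge> 1" shows "rep (\<lambda>n. riem (2 * K) n - riem K n) ((hsn A)\<^sup>2 / (4 * real K))"
proof -
  define s where "s i = real (2 * i + 1) / real (2 * K)" for i
  have R: "rep (\<lambda>n. \<Sum>i<K. (- \<i> / of_nat (2 * K)) * (\<gamma> (s i) n - \<gamma> (real i / real K) n))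
      (\<Sum>i<K. cmod (- \<i> / of_nat (2 * K)) * (\<bar>s i - real i / real K\<bar> * (hsn A)\<^sup>2))"
    by (intro rep_sum rep_cmult rep_\<gamma>_diff) auto
  have "riem (2 * K) n - riem K n = (\<Sum>i<K. (- \<i> / of_nat (2 * K)) * (\<gamma> (s i) n - \<gamma> (real i / real K) n))" for n
  proof -
    have "riem (2 * K) n = - \<i> / of_nat (2 * K) * (\<Sum>i<K. \<gamma> (real i / real K) n + \<gamma> (s i) n)"
      unfolding riem_def sum_even_odd by (simp add: s_def)
    moreover have "riem K n = - \<i> / of_nat (2 * K) * (\<Sum>i<K. 2 * \<gamma> (real i / real K) n)"
      by (simp add: riem_def sum_distrib_left[symmetric])
    ultimately have "riem (2 * K) n - riem K n = - \<i> / of_nat (2 * K) *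
        ((\<Sum>i<K. \<gamma> (real i / real K) n + \<gamma> (s i) n) - (\<Sum>i<K. 2 * \<gamma> (real i / real K) n))"
      by (simp only: right_diff_distrib)
    also have "\<dots> = - \<i> / of_nat (2 * K) * (\<Sum>i<K. \<gamma> (s i) n - \<gamma> (real i / real K) n)"
      unfolding sum_subtractf[symmetric] by (intro arg_cong2[of _ _ _ _ "(*)"] sum.cong refl) simp
    finally show ?thesis by (simp only: sum_distrib_left)
  qed
  moreover have "(\<Sum>i<K. cmod (- \<i> / of_nat (2 * K)) * (\<bar>s i - real i / real K\<bar> * (hsn A)\<^sup>2)) = (hsn A)\<^sup>2 / (4 * real K)"
  proof -
    have "\<bar>s i - real i / real K\<bar> = 1 / (2 * real K)" for i
    proof -
      have "s i - real i / real K = 1 / (2 * real K)" using assms by (simp add: s_def field_simps)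
      then show ?thesis by simp
    qed
    moreover have "cmod (- \<i> / of_nat (2 * K)) = 1 / (2 * real K)"
      by (simp add: norm_divide norm_mult)
    ultimately show ?thesis using assms by (simp only:) (simp add: field_simps power2_eq_square)
  qed
  ultimately show ?thesis using R by simp
qed

text \<open>Any starting sum costs at most half the squared norm of A, while the dyadic refinements
  cost a geometric series that shrinks with the starting level; starting late gives the constant
  1/2.\<close>

lemma rep_moment: "rep moment ((hsn A)\<^sup>2 / 2)"
proof (rule rep_limit_bound)
  fix \<epsilon> :: real assume "\<epsilon> > 0"
  define a where "a = (hsn A)\<^sup>2"
  obtain m0 where m0: "(1 / 2) ^ m0 < \<epsilon> / (a + 1)"
    using real_arch_pow_inv[of "\<epsilon> / (a + 1)" "1/2"] \<open>\<epsilon> > 0\<close> by (auto simp: a_def add_nonneg_pos)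
  define r where "r k = riem (2 ^ (m0 + k))" for k
  have "rep moment (a / 2 + a / (4 * 2 ^ m0) * 2)"
  proof (rule rep_telescope[where r = r])
    show "rep (r 0) (a / 2)" unfolding r_def a_def by (rule rep_riem) simp
    show "rep (\<lambda>n. r (Suc k) n - r k n) (a / (4 * 2 ^ m0) * (1 / 2) ^ k)" for k
      using rep_riem_refine[of "2 ^ (m0 + k)"] by (simp add: r_def a_def power_add power_divide mult.assoc)
    show "(\<lambda>k. a / (4 * 2 ^ m0) * (1 / 2) ^ k) sums (a / (4 * 2 ^ m0) * 2)"
      using geometric_sums[of "1/2::real"] by (intro sums_mult) simp
    fix n :: nat assume n: "n \<ge> 1"
    define g where "g K = (\<Sum>i<K. \<gamma> (real i / real K) n) / of_nat K" for K
    have "(\<lambda>K. g (Suc K)) \<longlonglongrightarrow> tr (rem n) / (\<i> * of_nat n ^ 2)"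
      unfolding g_def by (rule tr_rem_limit[OF n])
    then have "g \<longlonglongrightarrow> tr (rem n) / (\<i> * of_nat n ^ 2)" by (rule LIMSEQ_imp_Suc)
    moreover have "strict_mono (\<lambda>k. 2 ^ (m0 + k) :: nat)" by (auto simp: strict_mono_def)
    ultimately have "(\<lambda>k. g (2 ^ (m0 + k))) \<longlonglongrightarrow> tr (rem n) / (\<i> * of_nat n ^ 2)"
      using LIMSEQ_subseq_LIMSEQ[of g] by (simp add: o_def)
    from tendsto_mult[OF tendsto_const[of "- \<i>"] this]
    show "(\<lambda>k. r k n) \<longlonglongrightarrow> moment n"
      by (simp add: r_def riem_def g_def moment_def)
  qed
  moreover have "a / (4 * 2 ^ m0) * 2 \<le> \<epsilon>"
  proof -
    have "a + 1 > 0" by (simp add: a_def add_nonneg_pos)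
    have "a / (4 * 2 ^ m0) * 2 = a / 2 * (1 / 2) ^ m0" by (simp add: power_divide)
    also have "\<dots> \<le> (a + 1) * (1 / 2) ^ m0"
      by (intro mult_right_mono) (auto simp: a_def)
    also have "\<dots> \<le> \<epsilon>" using m0 \<open>a + 1 > 0\<close> by (simp add: field_simps)
    finally show ?thesis .
  qed
  ultimately show "rep moment ((hsn A)\<^sup>2 / 2 + \<epsilon>)" by (elim rep_mono) (simp add: a_def)
qed

section \<open>From powers to polynomials\<close>

lemma poly_path_deriv:
  "((\<lambda>s. poly_op p (T_path A T0 s)) has_vector_derivative (\<Sum>k\<le>degree p. coeff p k *\<^sub>C dpow s k)) (at s within S)"
  unfolding poly_op_def T_path_eq
  by (intro has_vector_derivative_sum bounded_linear.has_vector_derivative[OF bounded_linear_scaleC_blinfun pow_deriv])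

lemma Tp_0: "Tp 0 = T0"
  by (simp add: Tp_def U_0)

lemma remainder_eq: "remainder A T0 p = (\<Sum>k\<le>degree p. coeff p k *\<^sub>C rem k)"
proof -
  have vd: "vector_derivative (\<lambda>s. poly_op p (T_path A T0 s)) (at 0 within {0..1})
      = (\<Sum>k\<le>degree p. coeff p k *\<^sub>C dpow 0 k)"
    using vector_derivative_within_cbox[of 0 1 0, OF _ _ poly_path_deriv] by simp
  show ?thesis
    unfolding remainder_def vd
    unfolding poly_op_def T_path_eq rem_def Tp_0 sum_subtractf[symmetric]
    by (intro sum.cong refl) (auto intro!: blinfun_eqI simp: blinfun.diff_left scaleC.diff_right)
qed

lemma nuc_coeff_rem: "\<exists>b. \<forall>k. nuc (coeff p k *\<^sub>C rem k) (b k)"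
proof -
  have "\<forall>k. \<exists>b. nuc (coeff p k *\<^sub>C rem k) b" using nuc_rem nuc_scaleC by blast
  then show ?thesis by (rule choice)
qed

lemma trace_class_remainder: "trace_class (remainder A T0 p)"
proof -
  obtain b where "\<And>k. nuc (coeff p k *\<^sub>C rem k) (b k)" using nuc_coeff_rem by blast
  then show ?thesis
    unfolding remainder_eq
    by (intro nuc_trace_class[OF nuc_sum[of "{..degree p}" "\<lambda>k. coeff p k *\<^sub>C rem k" b]]) auto
qed

lemma tr_remainder:
  "tr (remainder A T0 p) = (\<Sum>k\<le>degree p. (- (of_nat k)\<^sup>2 * coeff p k) * moment k)"
proof -
  obtain b where b: "\<And>k. nuc (coeff p k *\<^sub>C rem k) (b k)" using nuc_coeff_rem by blast
  have "tr (remainder A T0 p) = (\<Sum>k\<le>degree p. coeff p k * tr (rem k))"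
    unfolding remainder_eq using tr_sum[of "{..degree p}" "\<lambda>k. coeff p k *\<^sub>C rem k" b] b by (simp add: tr_scaleC)
  also have "\<dots> = (\<Sum>k\<le>degree p. (- (of_nat k)\<^sup>2 * coeff p k) * moment k)"
  proof (rule sum.cong[OF refl])
    fix k
    \<comment> \<open>For k = 0 both sides vanish, \<open>rem 0\<close> being zero.\<close>
    show "coeff p k * tr (rem k) = (- (of_nat k)\<^sup>2 * coeff p k) * moment k"
      by (cases "k = 0") (simp_all add: moment_def rem_def tr_zero)
  qed
  finally show ?thesis .
qed

text \<open>Reduces the formula to a moment problem: monomials test each n \<ge> 1 separately, and
  the constant term drops out through the factor k^2. Uniqueness modulo the Hardy space and the norm
  bound thereby become statements on \<open>mom\<close>.\<close>

lemma trace_formula_iff: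
  assumes E: "E = some_onb" and \<eta>: "\<eta> \<in> L1_circle"
  shows "trace_formula A T0 \<eta> \<longleftrightarrow> (\<forall>n\<ge>1. mom \<eta> n = moment n)"
proof -
  have tr: "trace_op T = tr T" for T unfolding tr_def unfolding trace_op_def E ..
  have eq: "trace_formula A T0 \<eta> \<longleftrightarrow> (\<forall>p. (\<Sum>k\<le>degree p. (- (of_nat k)\<^sup>2 * coeff p k) * moment k)
      = (\<Sum>k\<le>degree p. (- (of_nat k)\<^sup>2 * coeff p k) * mom \<eta> k))"
    unfolding trace_formula_def tr tr_remainder LINT_second_deriv[OF \<eta>] ..
  show ?thesis
    unfolding eq
  proof (intro iffI allI impI)
    fix n :: nat
    assume *: "\<forall>p. (\<Sum>k\<le>degree p. (- (of_nat k)\<^sup>2 * coeff p k) * moment k)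
      = (\<Sum>k\<le>degree p. (- (of_nat k)\<^sup>2 * coeff p k) * mom \<eta> k)" and n: "1 \<le> n"
    have mono: "(\<Sum>k\<le>n. (- (of_nat k)\<^sup>2 * coeff (monom 1 n) k) * m k) = - (of_nat n)\<^sup>2 * m n" for m :: "nat \<Rightarrow> complex"
    proof -
      have "(\<Sum>k\<le>n. (- (of_nat k)\<^sup>2 * coeff (monom 1 n) k) * m k)
          = (\<Sum>k\<le>n. if k = n then - (of_nat n)\<^sup>2 * m n else 0)"
        by (intro sum.cong) auto
      then show ?thesis by simp
    qed
    have "- (of_nat n)\<^sup>2 * moment n = - (of_nat n)\<^sup>2 * mom \<eta> n"
      using spec[OF *, of "monom 1 n"] unfolding degree_monom_eq[OF one_neq_zero] mono .
    then show "mom \<eta> n = moment n" using n by simp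
  next
    fix p
    assume *: "\<forall>n\<ge>1. mom \<eta> n = moment n"
    show "(\<Sum>k\<le>degree p. (- (of_nat k)\<^sup>2 * coeff p k) * moment k)
      = (\<Sum>k\<le>degree p. (- (of_nat k)\<^sup>2 * coeff p k) * mom \<eta> k)"
    proof (rule sum.cong[OF refl])
      fix k
      show "(- (of_nat k)\<^sup>2 * coeff p k) * moment k = (- (of_nat k)\<^sup>2 * coeff p k) * mom \<eta> k"
        using * by (cases "k = 0") auto
    qed
  qed
qed

text \<open>For A = 0 the required bound is 0, below any slack allowed by \<open>rep\<close>, so the
  zero function itself has to be a solution.\<close>

lemma moment_eq_0:
  assumes "hsn A = 0" "n \<ge> 1" shows "moment n = 0"
proof -
  have "cmod (hsi X A) \<le> 0" if "hs X" for X using norm_hsi_le[OF that hsA] assms(1) by simp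
  then have "\<gamma> s n = 0" for s
    using hs_pow_diff[OF contraction_Tp contraction_Tp Tp_diff(1)] by (simp add: \<gamma>_def)
  then have "(\<lambda>K. 0) \<longlonglongrightarrow> tr (rem n) / (\<i> * of_nat n ^ 2)"
    using tr_rem_limit[OF assms(2)] by simp
  then have "tr (rem n) / (\<i> * of_nat n ^ 2) = 0" using LIMSEQ_unique[OF tendsto_const] by metis
  then show ?thesis using assms(2) by (simp add: moment_def)
qed

lemma exists_spectral_shift:
  assumes "\<epsilon> > 0"
  shows "\<exists>\<eta>\<in>L1_circle. (\<forall>n\<ge>1. mom \<eta> n = moment n) \<and> L1_norm \<eta> \<le> (1 / 2 + \<epsilon>) * (hsn A)\<^sup>2"
proof (cases "hsn A = 0")
  case True
  then show ?thesis
    using moment_eq_0 by (intro bexI[of _ "\<lambda>t. 0"])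
      (auto simp: L1_circle_def mom_def L1_norm_def set_integrable_def)
next
  case False
  \<comment> \<open>The slack in \<open>rep\<close> is absolute, whereas the claimed one is relative
    to the norm of A.\<close>
  then have "\<epsilon> * (hsn A)\<^sup>2 > 0" using assms by simp
  then show ?thesis
    using rep_moment unfolding rep_def distrib_right by (auto simp: mult.commute)
qed

end

theorem theorem9p1:
  fixes N0 V T0 A :: "'a::chilbert_space \<Rightarrow>\<^sub>L 'a"
  assumes "separable_space (euclidean :: 'a topology)"
    and "\<not> (\<exists>B :: 'a set. finite B \<and> cvec.span B = UNIV)"
    and "contraction_op T0" and "T0 = N0 + V"
    and "normal_op N0" and "hilbert_schmidt V"
    and "selfadjoint_op A" and "hilbert_schmidt A"
  shows
    "(\<forall>p. (\<lambda>s. poly_op p (T_path A T0 s)) differentiable (at 0 within {0..1})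
          \<and> trace_class (remainder A T0 p))
     \<and> (\<exists>\<eta>\<in>L1_circle. trace_formula A T0 \<eta>
          \<and> (\<forall>\<eta>'\<in>L1_circle. trace_formula A T0 \<eta>' \<longleftrightarrow> (\<lambda>t. \<eta>' t - \<eta> t) \<in> H1_circle))
     \<and> (\<forall>\<epsilon>>0. \<exists>\<eta>\<in>L1_circle. trace_formula A T0 \<eta>
          \<and> L1_norm \<eta> \<le> (1/2 + \<epsilon>) * (hs_norm A)\<^sup>2)"
proof -
  \<comment> \<open>Existence of a basis makes the choice behind \<open>some_onb\<close>
    meaningful.\<close>
  have "\<exists>E :: 'a set. is_onb E" using assms(6) by (auto simp: hilbert_schmidt_def)
  then have "is_onb (some_onb :: 'a set)" unfolding some_onb_def by (rule someI_ex)
  then interpret hilbert_basis "some_onb :: 'a set" by unfold_locales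
  interpret rotation_path "some_onb :: 'a set" A T0
    by unfold_locales (use assms hilbert_schmidt_imp_hs in auto)
  have norm: "hsn A = hs_norm A" by (simp add: hsn_def hs_norm_def)
  have tf: "trace_formula A T0 \<eta> \<longleftrightarrow> (\<forall>n\<ge>1. mom \<eta> n = moment n)" if "\<eta> \<in> L1_circle" for \<eta>
    by (rule trace_formula_iff[OF refl that])
  have part1: "(\<lambda>s. poly_op p (T_path A T0 s)) differentiable (at 0 within {0..1})
      \<and> trace_class (remainder A T0 p)" for p
    by (intro conjI trace_class_remainder differentiableI_vector[OF poly_path_deriv])
  have part3: "\<exists>\<eta>\<in>L1_circle. trace_formula A T0 \<eta> \<and> L1_norm \<eta> \<le> (1/2 + \<epsilon>) * (hs_norm A)\<^sup>2"
    if "\<epsilon> > 0" for \<epsilon>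
    using exists_spectral_shift[OF that] tf unfolding norm by (metis (no_types))
  obtain \<eta> where \<eta>: "\<eta> \<in> L1_circle" "trace_formula A T0 \<eta>"
    using part3[of 1] by auto
  have "trace_formula A T0 \<eta>' \<longleftrightarrow> (\<lambda>t. \<eta>' t - \<eta> t) \<in> H1_circle" if \<eta>': "\<eta>' \<in> L1_circle" for \<eta>'
    using \<eta>(2) unfolding tf[OF \<eta>'] tf[OF \<eta>(1)] H1_circle_iff_mom[OF L1_circle_diff[OF \<eta>' \<eta>(1)]]
      mom_diff[OF \<eta>' \<eta>(1)] by auto
  with \<eta> part1 part3 show ?thesis by blast
qed

end
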